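(* Let $1\le p<\infty$ and let $B_p$ denote the open unit ball of the complex sequence space $\ell^p$. Then: (i) Any two distinct points in $B_p$ can be joined by a unique normalized complex geodesic. (ii) All complex geodesics in $B_p$ are continuous, i.e. every complex geodesic $\phi:\mathbb{D}\to B_p$ extends to a continuous function $\overline{\mathbb{D}}\to\overline{B_p}$. (iii) A map $\phi:\mathbb{D}\to B_p$ is a complex geodesic if and only if it is a non-constant map of the form $\phi(\zeta)=(\phi_j(\zeta))_{j=1}^\infty$ with $$\phi_j(\zeta)=c_j\left(\frac{\zeta-\alpha_j}{1-\bar\alpha_j\zeta}\right)^{\beta_j}\left(\frac{1-\bar\alpha_j\zeta}{1-\bar\gamma\zeta}\right)^{2/p}\qquad(\zeta\in\mathbb{D}),$$ where $\gamma\in\mathbb{D}$, and for all $j$, $\alpha_j\in\overline{\mathbb{D}}$, $c_j\in\mathbb{C}$, $\beta_j\in\{0,1\}$, and $$\sum_j|c_j|^p(1+|\alpha_j|^2)=1+|\gamma|^2,\qquad \sum_j|c_j|^p\alpha_j=\gamma.$$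
   Context: $\mathbb{D}$ is the open unit disc in $\mathbb{C}$ and $\rho(z,w)=\tanh^{-1}\left|\frac{z-w}{1-\bar w z}\right|$ is the Poincaré distance. $H(\mathcal{D}_1,\mathcal{D}_2)$ is the set of holomorphic maps from $\mathcal{D}_1$ to $\mathcal{D}_2$. The Carathéodory distance on a domain $\mathcal{D}$ is $C_{\mathcal{D}}(p,q)=\sup\{\rho(f(p),f(q)): f\in H(\mathcal{D},\mathbb{D})\}$. A map $\phi\in H(\mathbb{D},\mathcal{D})$ is a complex geodesic in $\mathcal{D}$ if $\rho(u,v)=C_{\mathcal{D}}(\phi(u),\phi(v))$ for all $u,v\in\mathbb{D}$. It is a normalized complex geodesic joining distinct points $x$ and $y$ if $\phi(0)=x$ and $\phi(s)=y$ for some positive real $s$. The power $2/p$ is understood via principal branches: $\left(\frac{1-\bar\alpha\zeta}{1-\bar\gamma\zeta}\right)^{2/p}=(1-\bar\alpha\zeta)^{2/p}/(1-\bar\gamma\zeta)^{2/p}$, with $1-\bar\alpha\zeta$ and $1-\bar\gamma\zeta$ in the right half plane for $\zeta\in\mathbb{D}$. *)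

theory Defs
  imports "HOL-Analysis.Analysis"
begin

section \<open>The complex sequence space \<open>\<ell>\<^sup>p\<close>, \<open>1 \<le> p < \<infinity>\<close>\<close>

text \<open>
  Since \<open>p\<close> is a real parameter, \<open>\<ell>\<^sup>p\<close> is a carrier set of sequences and not a type. The
  sequences are indexed from \<open>0\<close>.
\<close>

definition lp_space :: "real \<Rightarrow> (nat \<Rightarrow> complex) set" where
  "lp_space p = {x. summable (\<lambda>j. cmod (x j) powr p)}"

definition lp_norm :: "real \<Rightarrow> (nat \<Rightarrow> complex) \<Rightarrow> real" where
  "lp_norm p x = (\<Sum>j. cmod (x j) powr p) powr (1 / p)"

definition lp_dist :: "real \<Rightarrow> (nat \<Rightarrow> complex) \<Rightarrow> (nat \<Rightarrow> complex) \<Rightarrow> real" where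
  "lp_dist p x y = lp_norm p (\<lambda>j. x j - y j)"

definition lp_topology :: "real \<Rightarrow> (nat \<Rightarrow> complex) topology" where
  "lp_topology p = Metric_space.mtopology (lp_space p) (lp_dist p)"

definition lp_ball :: "real \<Rightarrow> (nat \<Rightarrow> complex) set" where
  "lp_ball p = {x \<in> lp_space p. lp_norm p x < 1}"

text \<open>
  \<open>Metric_space.mtopology\<close> is only meaningful for a metric; the next facts (Minkowski's
  inequality) show that \<open>lp_dist p\<close> is one for \<open>p \<ge> 1\<close>.
\<close>

lemma lp_norm_nonneg: "0 \<le> lp_norm p x"
  by (simp add: lp_norm_def)

lemma lp_norm_powr:
  assumes "1 \<le> p" "x \<in> lp_space p"
  shows "lp_norm p x powr p = (\<Sum>j. cmod (x j) powr p)"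
  using assms by (simp add: lp_norm_def lp_space_def powr_powr suminf_nonneg)

lemma lp_norm_eq_0:
  assumes "1 \<le> p" "x \<in> lp_space p"
  shows "lp_norm p x = 0 \<longleftrightarrow> (\<forall>j. x j = 0)"
proof -
  have "lp_norm p x = 0 \<longleftrightarrow> (\<Sum>j. cmod (x j) powr p) = 0"
    by (simp add: lp_norm_def)
  also have "\<dots> \<longleftrightarrow> (\<forall>j. cmod (x j) powr p = 0)"
    using assms by (intro suminf_eq_zero_iff) (auto simp: lp_space_def)
  finally show ?thesis by simp
qed

lemma powr_convex_comb:
  fixes a b t :: real
  assumes "1 \<le> p" "0 \<le> a" "0 \<le> b" "0 < t" "t < 1"
  shows "(t * a + (1 - t) * b) powr p \<le> t * a powr p + (1 - t) * b powr p"
proof -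
  have scale: "(s * c) powr p \<le> s * c powr p" if "0 < s" "s < 1" "0 \<le> c" for s c :: real
  proof -
    have "s powr p \<le> s powr 1"
      using that assms(1) by (intro powr_mono') auto
    then show ?thesis
      using that by (simp add: powr_mult mult_right_mono)
  qed
  consider "a = 0" | "b = 0" | "0 < a" "0 < b" using assms by linarith
  then show ?thesis
  proof cases
    case 1 then show ?thesis using scale[of "1 - t" b] assms by simp
  next
    case 2 then show ?thesis using scale[of t a] assms by simp
  next
    case 3
    then show ?thesis
      using convex_onD[OF powr_convex[OF assms(1)], of t b a] assms by (simp add: add.commute)
  qed
qed

lemma lp_minkowski:
  assumes p: "1 \<le> p" and x: "x \<in> lp_space p" and y: "y \<in> lp_space p"
  shows "(\<lambda>j. x j + y j) \<in> lp_space p"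
    and "lp_norm p (\<lambda>j. x j + y j) \<le> lp_norm p x + lp_norm p y"
proof -
  define A where "A = lp_norm p x"
  define B where "B = lp_norm p y"
  have "(\<lambda>j. x j + y j) \<in> lp_space p \<and> lp_norm p (\<lambda>j. x j + y j) \<le> A + B"
  proof -
    consider "A = 0" | "B = 0" | "0 < A" "0 < B"
      using lp_norm_nonneg[of p x] lp_norm_nonneg[of p y] unfolding A_def B_def by linarith
    then show ?thesis
    proof cases
      case 1
      then show ?thesis using lp_norm_eq_0[OF p x] y by (simp add: A_def B_def)
    next
      case 2
      then show ?thesis using lp_norm_eq_0[OF p y] x by (simp add: A_def B_def)
    next
      case 3
      define t where "t = A / (A + B)"
      have t: "0 < t" "t < 1" and t': "1 - t = B / (A + B)"
        using 3 by (auto simp: t_def field_simps)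
      define g where "g j = (A + B) powr p * (t * (cmod (x j) powr p / A powr p) +
        (1 - t) * (cmod (y j) powr p / B powr p))" for j
      have bound: "cmod (x j + y j) powr p \<le> g j" for j
      proof -
        have eq: "t * (cmod (x j) / A) + (1 - t) * (cmod (y j) / B) =
            (cmod (x j) + cmod (y j)) / (A + B)"
          unfolding t' using 3 by (simp add: t_def add_divide_distrib)
        have "cmod (x j + y j) powr p \<le> (cmod (x j) + cmod (y j)) powr p"
          using p by (intro powr_mono2 norm_triangle_ineq) auto
        also have "\<dots> = (A + B) powr p * (t * (cmod (x j) / A) + (1 - t) * (cmod (y j) / B)) powr p"
          unfolding eq using 3 by (simp add: powr_divide)
        also have "\<dots> \<le> (A + B) powr p *
            (t * (cmod (x j) / A) powr p + (1 - t) * (cmod (y j) / B) powr p)"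
          using 3 by (intro mult_left_mono powr_convex_comb[OF p _ _ t]) auto
        also have "\<dots> = g j"
          using 3 by (simp add: g_def powr_divide)
        finally show ?thesis .
      qed
      have sx: "(\<lambda>j. cmod (x j) powr p) sums (A powr p)"
        using x lp_norm_powr[OF p x] by (simp add: A_def lp_space_def summable_sums)
      have sy: "(\<lambda>j. cmod (y j) powr p) sums (B powr p)"
        using y lp_norm_powr[OF p y] by (simp add: B_def lp_space_def summable_sums)
      have "g sums ((A + B) powr p * (t * (A powr p / A powr p) + (1 - t) * (B powr p / B powr p)))"
        unfolding g_def by (intro sums_mult sums_add sums_divide sx sy)
      then have g: "g sums ((A + B) powr p)"
        using 3 by simp
      have mem: "summable (\<lambda>j. cmod (x j + y j) powr p)"
        by (rule summable_comparison_test'[OF sums_summable[OF g], of 0]) (simp add: bound)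
      have "(\<Sum>j. cmod (x j + y j) powr p) \<le> (A + B) powr p"
        using suminf_le[OF bound mem sums_summable[OF g]] sums_unique[OF g] by simp
      then have "lp_norm p (\<lambda>j. x j + y j) \<le> ((A + B) powr p) powr (1 / p)"
        unfolding lp_norm_def using p mem by (intro powr_mono2 suminf_nonneg) auto
      also have "\<dots> = A + B"
        using p 3 by (simp add: powr_powr)
      finally show ?thesis using mem by (simp add: lp_space_def)
    qed
  qed
  then show "(\<lambda>j. x j + y j) \<in> lp_space p"
    and "lp_norm p (\<lambda>j. x j + y j) \<le> lp_norm p x + lp_norm p y"
    by (auto simp: A_def B_def)
qed

lemma lp_diff_mem:
  assumes "1 \<le> p" "x \<in> lp_space p" "y \<in> lp_space p"
  shows "(\<lambda>j. x j - y j) \<in> lp_space p"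
  using lp_minkowski(1)[OF assms(1,2), of "\<lambda>j. - y j"] assms(3) by (simp add: lp_space_def)

lemma Metric_space_lp:
  assumes p: "1 \<le> p"
  shows "Metric_space (lp_space p) (lp_dist p)"
proof
  show "0 \<le> lp_dist p x y" for x y
    by (simp add: lp_dist_def lp_norm_nonneg)
  show "lp_dist p x y = lp_dist p y x" for x y
    by (simp add: lp_dist_def lp_norm_def norm_minus_commute)
  show "lp_dist p x y = 0 \<longleftrightarrow> x = y" if "x \<in> lp_space p" "y \<in> lp_space p" for x y
    using lp_norm_eq_0[OF p lp_diff_mem[OF p that]] by (auto simp: lp_dist_def)
  show "lp_dist p x z \<le> lp_dist p x y + lp_dist p y z"
    if "x \<in> lp_space p" "y \<in> lp_space p" "z \<in> lp_space p" for x y z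
    using lp_minkowski(2)[OF p lp_diff_mem[OF p that(1,2)] lp_diff_mem[OF p that(2,3)]]
    by (simp add: lp_dist_def)
qed


section \<open>Holomorphic maps between the disc and domains in \<open>\<ell>\<^sup>p\<close>\<close>

abbreviation unit_disc :: "complex set" where
  "unit_disc \<equiv> ball 0 1"

definition lp_functional :: "real \<Rightarrow> ((nat \<Rightarrow> complex) \<Rightarrow> complex) \<Rightarrow> bool" where
  "lp_functional p L \<longleftrightarrow>
     (\<forall>x\<in>lp_space p. \<forall>y\<in>lp_space p. L (\<lambda>j. x j + y j) = L x + L y) \<and>
     (\<forall>a. \<forall>x\<in>lp_space p. L (\<lambda>j. a * x j) = a * L x) \<and>
     (\<exists>K. \<forall>x\<in>lp_space p. cmod (L x) \<le> K * lp_norm p x)"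

text \<open>Complex Frechet differentiability at every point of \<open>D\<close>, which is meant to be open in \<open>\<ell>\<^sup>p\<close>.\<close>

definition lp_holomorphic_on ::
    "real \<Rightarrow> (nat \<Rightarrow> complex) set \<Rightarrow> ((nat \<Rightarrow> complex) \<Rightarrow> complex) \<Rightarrow> bool" where
  "lp_holomorphic_on p D f \<longleftrightarrow>
     (\<forall>x\<in>D. \<exists>L. lp_functional p L \<and>
        (\<forall>e>0. \<exists>d>0. \<forall>y\<in>D. lp_dist p y x < d \<longrightarrow>
           cmod (f y - f x - L (\<lambda>j. y j - x j)) \<le> e * lp_dist p y x))"

text \<open>\<open>H(D, unit_disc)\<close>\<close>

definition hol_to_disc ::
    "real \<Rightarrow> (nat \<Rightarrow> complex) set \<Rightarrow> ((nat \<Rightarrow> complex) \<Rightarrow> complex) set" where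
  "hol_to_disc p D = {f. f ` D \<subseteq> unit_disc \<and> lp_holomorphic_on p D f}"

text \<open>
  \<open>H(unit_disc, D)\<close> for \<open>D \<subseteq> \<ell>\<^sup>p\<close>: the difference quotients converge in the norm of \<open>\<ell>\<^sup>p\<close>. Values outside
  \<open>unit_disc\<close> are irrelevant, so maps are to be compared on \<open>unit_disc\<close> only.
\<close>

definition hol_from_disc ::
    "real \<Rightarrow> (nat \<Rightarrow> complex) set \<Rightarrow> (complex \<Rightarrow> nat \<Rightarrow> complex) set" where
  "hol_from_disc p D = {\<phi>. \<phi> ` unit_disc \<subseteq> D \<and>
     (\<forall>z\<in>unit_disc. \<exists>v\<in>lp_space p.
        ((\<lambda>w. lp_dist p (\<lambda>j. (\<phi> w j - \<phi> z j) / (w - z)) v) \<longlongrightarrow> 0) (at z))}"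


section \<open>Caratheodory distance and complex geodesics\<close>

definition poincare_dist :: "complex \<Rightarrow> complex \<Rightarrow> real" where
  "poincare_dist z w = artanh (cmod ((z - w) / (1 - cnj w * z)))"

text \<open>
  The set is non-empty (constants), and it is bounded above whenever \<open>D\<close> is a domain and \<open>x\<close>, \<open>y\<close>
  are in \<open>D\<close> (join them by a chain of discs), so the real supremum is the intended one.
\<close>

definition caratheodory_dist ::
    "real \<Rightarrow> (nat \<Rightarrow> complex) set \<Rightarrow> (nat \<Rightarrow> complex) \<Rightarrow> (nat \<Rightarrow> complex) \<Rightarrow> real" where
  "caratheodory_dist p D x y = (SUP f\<in>hol_to_disc p D. poincare_dist (f x) (f y))"

definition complex_geodesic ::
    "real \<Rightarrow> (nat \<Rightarrow> complex) set \<Rightarrow> (complex \<Rightarrow> nat \<Rightarrow> complex) \<Rightarrow> bool" where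
  "complex_geodesic p D \<phi> \<longleftrightarrow> \<phi> \<in> hol_from_disc p D \<and>
     (\<forall>u\<in>unit_disc. \<forall>v\<in>unit_disc. poincare_dist u v = caratheodory_dist p D (\<phi> u) (\<phi> v))"

text \<open>The parameter \<open>s\<close> is a point of the domain \<open>unit_disc\<close> of \<open>\<phi>\<close>, whence \<open>s < 1\<close>.\<close>

definition normalized_geodesic_joining ::
    "real \<Rightarrow> (nat \<Rightarrow> complex) set \<Rightarrow> (nat \<Rightarrow> complex) \<Rightarrow> (nat \<Rightarrow> complex) \<Rightarrow>
     (complex \<Rightarrow> nat \<Rightarrow> complex) \<Rightarrow> bool" where
  "normalized_geodesic_joining p D x y \<phi> \<longleftrightarrow>
     complex_geodesic p D \<phi> \<and> \<phi> 0 = x \<and> (\<exists>s::real. 0 < s \<and> s < 1 \<and> \<phi> (complex_of_real s) = y)"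

end

theory Submission
  imports Defs "HOL-Complex_Analysis.Complex_Analysis"
begin

text \<open>
  To the data \<open>\<gamma>, \<alpha>, c, \<beta>\<close> of an extremal disc \<open>\<phi>\<close> belong explicit functionals \<open>k\<^sub>j\<close> with
  \<open>\<bar>\<Sum>\<^sub>j x\<^sub>j k\<^sub>j(\<zeta>)\<bar> \<le> \<parallel>x\<parallel>\<close> and \<open>\<Sum>\<^sub>j \<phi>\<^sub>j(\<zeta>) k\<^sub>j(\<zeta>) = mob \<gamma> \<zeta>\<close>. Hence \<open>\<zeta>\<close> is the fixed point of the self-map
  \<open>mob (- \<gamma>) (\<Sum>\<^sub>j x\<^sub>j k\<^sub>j)\<close> of the disc for \<open>x = \<phi>(\<zeta>)\<close>. The iterates of this map at \<open>0\<close> are holomorphic in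
  \<open>x\<close>, and along \<open>\<phi>\<close> they converge to the identity, so \<open>\<phi>\<close> is a geodesic. If another geodesic \<open>\<psi>\<close> agrees with
  \<open>\<phi>\<close> at \<open>0\<close> and \<open>s\<close>, then \<open>\<Sum>\<^sub>j \<psi>\<^sub>j k\<^sub>j = mob \<gamma>\<close> by the Schwarz lemma, and equality in Hoelder's inequality on
  the unit circle forces \<open>\<psi> = \<phi>\<close>.

  It remains to join two points \<open>x\<close>, \<open>y\<close> by an extremal disc. For given \<open>s\<close> and \<open>\<gamma>\<close> the conditions
  \<open>\<phi>\<^sub>j(0) = x\<^sub>j\<close>, \<open>\<phi>\<^sub>j(s) = y\<^sub>j\<close> determine \<open>\<alpha>\<^sub>j, c\<^sub>j, \<beta>\<^sub>j\<close>, essentially through a homeomorphism of the plane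
  that depends on \<open>s\<close>. Brouwer's theorem then gives \<open>s\<close> and \<open>\<gamma>\<close> such that the two sums have the right values.
  So extremal discs join all pairs of points, and by uniqueness there are no other geodesics.
\<close>

section \<open>Moebius transformations and boundary values\<close>

text \<open>The left inverse of an extremal disc sends \<open>x\<close> to the fixed point of a
  self-map of the disc that depends on \<open>x\<close>. Its own holomorphy would take an implicit
  function argument, but the Caratheodory distance is a supremum, so approximations suffice, and
  finite iterates are holomorphic by construction.

  For \<open>p = 1\<close> the dual space is \<open>\<ell>\<^sup>\<infinity>\<close> and the ball is
  not strictly convex, and no boundary values of \<open>\<psi>\<close> are at hand. Equality in
  Hoelder's inequality is therefore used quantitatively: one coordinate at a time, at points inside
  the disc close to the circle.

  In the two-point problem the data jump between \<open>\<beta> j = 0\<close> and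
  \<open>\<beta> j = 1\<close>. A parameter \<open>w\<close> in the whole plane glues the two cases
  along |\<open>\<alpha> j\<close>| = 1, and Brouwer's theorem only sees the terms of the two sums,
  which are continuous in \<open>w\<close>. There \<gamma> is replaced by \<kappa> = \<gamma> / (1 +
  |\<gamma>|^2), since |\<kappa>| \<le> 1/2 is automatic from 2|\<alpha>| \<le> 1 + |\<alpha>|^2;
  the remaining scalar condition is met by varying \<open>s\<close>.\<close>

definition mob :: "complex \<Rightarrow> complex \<Rightarrow> complex" where
  "mob a z = (z - a) / (1 - cnj a * z)"

lemma Re_one_minus_cnj_pos:
  assumes "cmod a * cmod z < 1"
  shows "0 < Re (1 - cnj a * z)"
proof -
  have "Re (cnj a * z) \<le> cmod (cnj a * z)" by (rule complex_Re_le_cmod)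
  also have "\<dots> < 1" using assms by (simp add: norm_mult)
  finally show ?thesis by simp
qed

lemma norm_mult_less_1:
  fixes a z :: complex
  assumes "cmod a \<le> 1" "cmod z < 1"
  shows "cmod a * cmod z < 1"
  using assms mult_right_mono[of "cmod a" 1 "cmod z"] by simp

lemma one_minus_cnj_nonzero:
  assumes "cmod a * cmod z < 1"
  shows "1 - cnj a * z \<noteq> 0"
proof
  assume "1 - cnj a * z = 0"
  with Re_one_minus_cnj_pos[OF assms] show False by (simp only: less_irrefl zero_complex.sel)
qed

lemma cnj_mult_neq_1:
  assumes "cmod a * cmod z < 1"
  shows "cnj a * z \<noteq> 1"
  using one_minus_cnj_nonzero[OF assms] by simp

lemma holomorphic_on_compose_mem:
  assumes "f holomorphic_on S" "g holomorphic_on T" "\<And>z. z \<in> S \<Longrightarrow> f z \<in> T"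
  shows "(\<lambda>z. g (f z)) holomorphic_on S"
  using holomorphic_on_compose_gen[OF assms(1,2)] assms(3) by (simp add: o_def image_subset_iff)

lemma mob_norm_sq:
  assumes "1 - cnj a * z \<noteq> 0"
  shows "1 - (cmod (mob a z))\<^sup>2 = (1 - (cmod a)\<^sup>2) * (1 - (cmod z)\<^sup>2) / (cmod (1 - cnj a * z))\<^sup>2"
proof -
  have "(cmod (1 - cnj a * z))\<^sup>2 - (cmod (z - a))\<^sup>2 = (1 - (cmod a)\<^sup>2) * (1 - (cmod z)\<^sup>2)"
    unfolding cmod_power2 by (simp add: power2_eq_square algebra_simps)
  then show ?thesis
    using assms by (simp add: mob_def norm_divide power_divide field_simps)
qed

lemma mob_le_1:
  assumes "cmod a \<le> 1" "cmod z < 1"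
  shows "cmod (mob a z) \<le> 1"
proof -
  have nz: "1 - cnj a * z \<noteq> 0"
    using assms by (intro one_minus_cnj_nonzero norm_mult_less_1)
  have "0 \<le> 1 - (cmod (mob a z))\<^sup>2"
    unfolding mob_norm_sq[OF nz] using assms
    by (intro divide_nonneg_nonneg mult_nonneg_nonneg) (auto simp: power_le_one)
  then show ?thesis
    using power2_le_imp_le[of "cmod (mob a z)" 1] by simp
qed

lemma mob_less_1:
  assumes "cmod a < 1" "cmod z < 1"
  shows "cmod (mob a z) < 1"
proof -
  have nz: "1 - cnj a * z \<noteq> 0"
    using assms by (intro one_minus_cnj_nonzero norm_mult_less_1) auto
  have "0 < 1 - (cmod (mob a z))\<^sup>2"
    unfolding mob_norm_sq[OF nz] using assms nz
    by (intro divide_pos_pos mult_pos_pos) (auto simp: power_less_one_iff)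
  then show ?thesis
    by (metis abs_norm_cancel diff_gt_0_iff_gt abs_square_less_1)
qed

lemma mob_mob_uminus:
  assumes "cmod a < 1" "cmod z < 1"
  shows "mob (- a) (mob a z) = z"
proof -
  have 1: "1 - cnj a * z \<noteq> 0"
    using assms by (intro one_minus_cnj_nonzero norm_mult_less_1) auto
  have 2: "1 - cnj a * a \<noteq> 0"
    using assms by (intro one_minus_cnj_nonzero norm_mult_less_1) auto
  have "mob (- a) (mob a z) = ((z - a) + a * (1 - cnj a * z)) / ((1 - cnj a * z) + cnj a * (z - a))"
    unfolding mob_def using 1 by (simp add: divide_simps)
  also have "(1 - cnj a * z) + cnj a * (z - a) = 1 - cnj a * a" by (simp add: algebra_simps)
  also have "(z - a) + a * (1 - cnj a * z) = z * (1 - cnj a * a)" by (simp add: algebra_simps)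
  finally show ?thesis using 2 by simp
qed

lemma mob_0 [simp]: "mob a 0 = - a" and mob_self [simp]: "mob a a = 0"
  by (simp_all add: mob_def)

lemma holomorphic_on_mob:
  assumes "cmod a \<le> 1"
  shows "mob a holomorphic_on ball 0 1"
  unfolding mob_def
  by (intro holomorphic_intros) (use assms in \<open>auto simp: cnj_mult_neq_1 norm_mult_less_1\<close>)

lemma holomorphic_on_mob_compose:
  assumes "cmod a \<le> 1" "f holomorphic_on S" "\<And>z. z \<in> S \<Longrightarrow> cmod (f z) < 1"
  shows "(\<lambda>z. mob a (f z)) holomorphic_on S"
  using holomorphic_on_compose_mem[OF assms(2) holomorphic_on_mob[OF assms(1)]] assms(3) by simp

lemma Schwarz_Pick:
  assumes hol: "f holomorphic_on ball 0 1" and f: "\<And>z. cmod z < 1 \<Longrightarrow> cmod (f z) < 1"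
    and u: "cmod u < 1" and v: "cmod v < 1"
  shows "cmod (mob (f v) (f u)) \<le> cmod (mob v u)"
proof -
  define g where "g z = mob (f v) (f (mob (- v) z))" for z
  have m: "cmod (mob (- v) z) < 1" if "cmod z < 1" for z
    using v that by (intro mob_less_1) auto
  have "(\<lambda>z. f (mob (- v) z)) holomorphic_on ball 0 1"
    using v m by (intro holomorphic_on_compose_mem[OF holomorphic_on_mob hol]) auto
  then have "g holomorphic_on ball 0 1"
    unfolding g_def using f[OF v] m by (intro holomorphic_on_mob_compose) (auto intro: f)
  moreover have "g 0 = 0" by (simp add: g_def)
  moreover have "cmod (g z) < 1" if "cmod z < 1" for z
    unfolding g_def using that by (intro mob_less_1 f m v)
  ultimately have "cmod (g (mob v u)) \<le> cmod (mob v u)"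
    by (rule Schwarz_Lemma(1)) (use mob_less_1[OF v u] in auto)
  then show ?thesis by (simp add: g_def mob_mob_uminus u v)
qed

text \<open>Composition with the inverse \<open>mob (- a)\<close> produces a self-map of the disc
  that fixes 0 and \<open>s\<close>; the equality case of the Schwarz lemma makes it the
  identity.\<close>

lemma Schwarz_Pick_unique:
  assumes hol: "f holomorphic_on ball 0 1" and f: "\<And>z. cmod z < 1 \<Longrightarrow> cmod (f z) < 1"
    and a: "cmod a < 1" and 0: "f 0 = mob a 0"
    and s: "cmod s < 1" "s \<noteq> 0" "f s = mob a s" and z: "cmod z < 1"
  shows "f z = mob a z"
proof -
  define g where "g z = mob (- a) (f z)" for z
  have g1: "g holomorphic_on ball 0 1"
    unfolding g_def using a f by (intro holomorphic_on_mob_compose[OF _ hol]) auto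
  have g2: "g 0 = 0"
    unfolding g_def 0 using a by (simp only: mob_mob_uminus norm_zero zero_less_one)
  have g3: "cmod (g z) < 1" if "cmod z < 1" for z
    unfolding g_def using a f[OF that] by (intro mob_less_1) simp_all
  have g4: "g s = s"
    unfolding g_def s using a s by (simp only: mob_mob_uminus)
  have "\<exists>\<alpha>. (\<forall>z. cmod z < 1 \<longrightarrow> g z = \<alpha> * z) \<and> cmod \<alpha> = 1"
    by (rule Schwarz_Lemma(3)[OF g1 g2 g3, of 0]) (use s g4 in auto)
  then obtain \<kappa> where \<kappa>: "\<And>z. cmod z < 1 \<Longrightarrow> g z = \<kappa> * z"
    by blast
  with g4 s have "\<kappa> = 1" by (metis mult_cancel_right1)
  with \<kappa> have "g z = z" using z by simp
  moreover have "mob (- (- a)) (mob (- a) (f z)) = f z"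
    using a f[OF z] by (intro mob_mob_uminus) simp_all
  ultimately show ?thesis by (simp add: g_def)
qed

section \<open>Iteration towards a fixed point in the disc\<close>

lemma mob_norm_bound:
  assumes u: "cmod u < 1" and r: "r < 1"
  obtains q where "0 < q" "q < 1" "\<And>z. cmod z \<le> r \<Longrightarrow> cmod (mob u z) < q"
proof (cases "r < 0")
  case True
  show thesis by (rule that[of "1/2"]) (use True in \<open>auto dest: order_trans[OF norm_ge_zero]\<close>)
next
  case False
  \<comment> \<open>A lower bound for 1 - |\<open>mob u z\<close>|^2 read off from
    \<open>mob_norm_sq\<close>, whose divisor is at most 4. Halving it in \<open>q\<close> makes the
    final inequality strict.\<close>
  define d where "d = (1 - (cmod u)\<^sup>2) * (1 - r\<^sup>2) / 4"
  have d: "0 < d" "d < 1"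
  proof -
    have 1: "0 < 1 - (cmod u)\<^sup>2" "1 - (cmod u)\<^sup>2 \<le> 1" "0 < 1 - r\<^sup>2" "1 - r\<^sup>2 \<le> 1"
      using u r False by (auto simp: power_less_one_iff)
    then show "0 < d" by (simp add: d_def)
    have "(1 - (cmod u)\<^sup>2) * (1 - r\<^sup>2) \<le> 1" using 1 mult_mono[of "1 - (cmod u)\<^sup>2" 1 "1 - r\<^sup>2" 1] by simp
    then show "d < 1" by (simp add: d_def)
  qed
  define q where "q = sqrt (1 - d / 2)"
  have "cmod (mob u z) < q" if z: "cmod z \<le> r" for z
  proof -
    have zu: "cmod u * cmod z < 1" using z r u by (intro norm_mult_less_1) auto
    then have nz: "1 - cnj u * z \<noteq> 0" by (rule one_minus_cnj_nonzero)
    have "cmod (1 - cnj u * z) \<le> 1 + cmod u * cmod z"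
      by (metis complex_mod_cnj norm_mult norm_one norm_triangle_ineq4)
    then have "(cmod (1 - cnj u * z))\<^sup>2 \<le> 2\<^sup>2" using zu by (intro power_mono) auto
    moreover have "(1 - (cmod u)\<^sup>2) * (1 - r\<^sup>2) \<le> (1 - (cmod u)\<^sup>2) * (1 - (cmod z)\<^sup>2)"
      using u z by (intro mult_left_mono) (auto simp: power_le_one power_mono)
    ultimately have "d \<le> 1 - (cmod (mob u z))\<^sup>2"
      unfolding mob_norm_sq[OF nz] d_def using nz z r u
      by (intro frac_le) (auto simp: power_le_one intro!: mult_nonneg_nonneg)
    then have "(cmod (mob u z))\<^sup>2 < 1 - d / 2" using d by linarith
    then show ?thesis unfolding q_def by (simp add: real_less_rsqrt)
  qed
  moreover have "0 < q" "q < 1" using d by (auto simp: q_def)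
  ultimately show thesis using that by blast
qed

text \<open>Seen from the fixed point, the map sends the disc into a disc of radius
  \<open>q < 1\<close>. Dividing by \<open>q\<close> leaves room for the Schwarz lemma, so each step
  shrinks the pseudohyperbolic distance to \<open>u\<close> by the factor \<open>q\<close>.\<close>

lemma iterates_tendsto_fixed_point:
  assumes hol: "T holomorphic_on ball 0 1" and T: "\<And>z. cmod z < 1 \<Longrightarrow> cmod (T z) \<le> r" and r: "r < 1"
    and u: "cmod u < 1" "T u = u"
  shows "(\<lambda>n. (T ^^ n) 0) \<longlonglongrightarrow> u"
proof -
  obtain q where q: "0 < q" "q < 1" "\<And>z. cmod z \<le> r \<Longrightarrow> cmod (mob u z) < q"
    using mob_norm_bound[OF u(1) r] by blast
  define S where "S z = mob u (T (mob (- u) z)) / q" for z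
  have m: "cmod (mob (- u) z) < 1" if "cmod z < 1" for z
    using u that by (intro mob_less_1) auto
  have T1: "cmod (T z) < 1" if "cmod z < 1" for z using T[OF that] r by simp
  have "(\<lambda>z. T (mob (- u) z)) holomorphic_on ball 0 1"
    using u m by (intro holomorphic_on_compose_mem[OF holomorphic_on_mob hol]) auto
  then have "S holomorphic_on ball 0 1"
    unfolding S_def using u m q(1)
    by (intro holomorphic_intros holomorphic_on_mob_compose) (auto intro: T1)
  moreover have "S 0 = 0" using u by (simp add: S_def)
  moreover have "cmod (S z) < 1" if "cmod z < 1" for z
    using q(3)[OF T[OF m[OF that]]] q(1) by (simp add: S_def norm_divide)
  ultimately have S: "cmod (S z) \<le> cmod z" if "cmod z < 1" for z
    using Schwarz_Lemma(1) that by blast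
  have step: "cmod (mob u (T z)) \<le> q * cmod (mob u z)" if "cmod z < 1" for z
  proof -
    have "cmod (S (mob u z)) \<le> cmod (mob u z)" using mob_less_1[OF u(1) that] by (rule S)
    then show ?thesis using u q(1) that by (simp add: S_def mob_mob_uminus norm_divide field_simps)
  qed
  define x where "x n = (T ^^ n) 0" for n
  have x: "cmod (x n) < 1" for n by (induction n) (auto simp: x_def T1)
  have "cmod (mob u (x n)) \<le> q ^ n" for n
  proof (induction n)
    case 0 then show ?case using u by (simp add: x_def)
  next
    case (Suc n)
    have "cmod (mob u (x (Suc n))) \<le> q * cmod (mob u (x n))" using step[OF x[of n]] by (simp add: x_def)
    also have "\<dots> \<le> q * q ^ n" using Suc q by (intro mult_left_mono) auto
    finally show ?case by simp
  qed
  then have "(\<lambda>n. mob u (x n)) \<longlonglongrightarrow> 0"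
    using q by (intro Lim_null_comparison[OF _ LIMSEQ_realpow_zero[of q]]) auto
  moreover have "isCont (mob (- u)) 0"
    using holomorphic_on_imp_continuous_on[OF holomorphic_on_mob[of "- u"]] u
    by (auto simp: continuous_on_eq_continuous_at)
  ultimately have "(\<lambda>n. mob (- u) (mob u (x n))) \<longlonglongrightarrow> mob (- u) 0"
    by (rule isCont_tendsto_compose[rotated])
  then show ?thesis using u x by (simp add: mob_mob_uminus x_def)
qed

section \<open>Maximum principles in terms of values near the unit circle\<close>

lemma holomorphic_bound_near_boundary:
  assumes hol: "F holomorphic_on ball 0 1" and z: "cmod z < 1" and r: "r < 1"
    and F: "\<And>z. r < cmod z \<Longrightarrow> cmod z < 1 \<Longrightarrow> cmod (F z) \<le> B"
  shows "cmod (F z) \<le> B"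
proof -
  define R where "R = (max (max r 0) (cmod z) + 1) / 2"
  have R: "r < R" "R < 1" "cmod z < R" "0 < R" using z r by (auto simp: R_def)
  have "continuous_on (cball 0 R) F"
    by (rule continuous_on_subset[OF holomorphic_on_imp_continuous_on[OF hol]]) (use R in auto)
  then have "continuous_on (closure (cball 0 R)) F" by simp
  moreover have "F holomorphic_on interior (cball 0 R)"
    by (rule holomorphic_on_subset[OF hol]) (use R in auto)
  moreover have "cmod (F x) \<le> B" if "x \<in> frontier (cball 0 R)" for x
    using that R by (intro F) auto
  ultimately show ?thesis
    using R(3) by (metis bounded_cball maximum_modulus_frontier mem_cball_0 less_imp_le)
qed

lemma holomorphic_eq_0_if_boundary_null:
  assumes hol: "F holomorphic_on ball 0 1" and z: "cmod z < 1"
    and F: "\<And>e. e > 0 \<Longrightarrow> \<exists>r<1. \<forall>z. r < cmod z \<and> cmod z < 1 \<longrightarrow> cmod (F z) \<le> e"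
  shows "F z = 0"
proof -
  have "cmod (F z) \<le> e" if e: "e > 0" for e
    using holomorphic_bound_near_boundary[OF hol z] F[OF e] by blast
  then show ?thesis using dense_ge[of 0 "cmod (F z)"] by simp
qed

text \<open>The modulus of exp(-i \<sigma> F) is exp(\<sigma> Im F), so for both signs \<sigma> the
  maximum principle bounds the imaginary part by every \<open>e > 0\<close>. A real-valued
  holomorphic function is constant by the open mapping theorem.\<close>

lemma holomorphic_constant_if_boundary_real:
  assumes hol: "F holomorphic_on ball 0 1"
    and F: "\<And>e. e > 0 \<Longrightarrow> \<exists>r<1. \<forall>z. r < cmod z \<and> cmod z < 1 \<longrightarrow> \<bar>Im (F z)\<bar> \<le> e"
  shows "F constant_on ball 0 1"
proof -
  have le: "\<sigma> * Im (F z) \<le> e" if z: "cmod z < 1" and e: "e > 0" and \<sigma>: "\<sigma> \<in> {1, -1}" for z e \<sigma>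
  proof -
    obtain r where r: "r < 1" "\<And>z. r < cmod z \<Longrightarrow> cmod z < 1 \<Longrightarrow> \<bar>Im (F z)\<bar> \<le> e"
      using F[OF e] by blast
    have "cmod (exp (- \<i> * \<sigma> * F z)) \<le> exp e"
    proof (rule holomorphic_bound_near_boundary[OF _ z r(1)])
      show "(\<lambda>z. exp (- \<i> * \<sigma> * F z)) holomorphic_on ball 0 1"
        by (intro holomorphic_intros hol)
      show "cmod (exp (- \<i> * \<sigma> * F z)) \<le> exp e" if "r < cmod z" "cmod z < 1" for z
        using r(2)[OF that] \<sigma> by auto
    qed
    then show ?thesis by simp
  qed
  have Im0: "Im (F z) = 0" if z: "cmod z < 1" for z
  proof -
    have "Im (F z) \<le> 0" by (rule field_le_epsilon) (use le[OF z, of _ 1] in auto)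
    moreover have "- Im (F z) \<le> 0" by (rule field_le_epsilon) (use le[OF z, of _ "-1"] in auto)
    ultimately show ?thesis by simp
  qed
  show ?thesis
  proof (rule ccontr)
    assume nc: "\<not> F constant_on ball 0 1"
    have "open (F ` ball 0 1)"
      by (rule open_mapping_thm[OF hol _ _ _ _ nc]) (auto simp: connected_ball)
    then obtain d where d: "d > 0" "ball (F 0) d \<subseteq> F ` ball 0 1"
      unfolding open_contains_ball by force
    have "F 0 + \<i> * (d / 2) \<in> ball (F 0) d" using d by (simp add: dist_norm norm_mult)
    then obtain z where "cmod z < 1" "F z = F 0 + \<i> * (d / 2)" using d(2) by fastforce
    then show False using Im0[of z] Im0[of 0] d by simp
  qed
qed

section \<open>Holomorphic maps into and out of \<open>\<ell>\<^sup>p\<close>\<close>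

lemma powr_le_powr_iff:
  fixes a b p :: real
  assumes "0 < p" "0 \<le> a" "0 \<le> b"
  shows "a powr p \<le> b powr p \<longleftrightarrow> a \<le> b"
  using assms powr_mono2[of p a b] powr_less_mono2[of p b a] by linarith

lemma lp_norm_bound:
  assumes p: "1 \<le> p" and M: "summable M" and b: "0 \<le> b"
    and x: "\<And>j. cmod (x j) powr p \<le> b powr p * M j"
  shows "x \<in> lp_space p" "lp_norm p x \<le> b * suminf M powr (1 / p)"
proof -
  have s: "summable (\<lambda>j. b powr p * M j)" using M by (rule summable_mult)
  show mem: "x \<in> lp_space p"
    unfolding lp_space_def by (auto intro!: summable_comparison_test'[OF s, of 0] x)
  have "lp_norm p x \<le> (b powr p * suminf M) powr (1 / p)"
    unfolding lp_norm_def suminf_mult[OF M, symmetric]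
    using mem p by (intro powr_mono2 suminf_le[OF x _ s] suminf_nonneg) (auto simp: lp_space_def)
  also have "\<dots> = b * suminf M powr (1 / p)"
    using p b by (simp add: powr_mult powr_powr)
  finally show "lp_norm p x \<le> b * suminf M powr (1 / p)" .
qed

lemma lp_scale:
  assumes "1 \<le> p" "x \<in> lp_space p"
  shows "(\<lambda>j. a * x j) \<in> lp_space p" "lp_norm p (\<lambda>j. a * x j) = cmod a * lp_norm p x"
proof -
  have s: "summable (\<lambda>j. cmod (x j) powr p)" using assms by (simp add: lp_space_def)
  then show "(\<lambda>j. a * x j) \<in> lp_space p"
    by (simp add: lp_space_def norm_mult powr_mult summable_mult)
  show "lp_norm p (\<lambda>j. a * x j) = cmod a * lp_norm p x"
    using assms s by (simp add: lp_norm_def norm_mult powr_mult suminf_mult powr_powr)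
qed

lemma lp_norm_coordinate:
  assumes p: "1 \<le> p" and x: "x \<in> lp_space p"
  shows "cmod (x j) \<le> lp_norm p x"
proof -
  have "cmod (x j) powr p \<le> lp_norm p x powr p"
    unfolding lp_norm_powr[OF assms]
    using sum_le_suminf[of "\<lambda>j. cmod (x j) powr p" "{j}"] x by (simp add: lp_space_def)
  then show ?thesis using p lp_norm_nonneg[of p x] by (simp add: powr_le_powr_iff)
qed

lemma lp_norm_less_1_iff:
  assumes p: "1 \<le> p" and x: "x \<in> lp_space p"
  shows "lp_norm p x < 1 \<longleftrightarrow> (\<Sum>j. cmod (x j) powr p) < 1"
proof -
  have "lp_norm p x < 1 \<longleftrightarrow> lp_norm p x powr p < 1 powr p"
    using p lp_norm_nonneg[of p x] powr_le_powr_iff[of p 1 "lp_norm p x"] by (simp flip: not_le)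
  then show ?thesis by (simp add: lp_norm_powr[OF assms])
qed

lemma lp_ball_subset: "lp_ball p \<subseteq> lp_space p"
  by (auto simp: lp_ball_def)

section \<open>Bounded functionals and the chain rule for functions on
  \<open>\<ell>\<^sup>p\<close>\<close>

lemma lp_functional_diff:
  assumes "lp_functional p L" "1 \<le> p" "x \<in> lp_space p" "y \<in> lp_space p"
  shows "L (\<lambda>j. x j - y j) = L x - L y"
proof -
  have "\<forall>x\<in>lp_space p. \<forall>y\<in>lp_space p. L (\<lambda>j. x j + y j) = L x + L y"
    using assms(1) unfolding lp_functional_def by blast
  from bspec[OF bspec[OF this lp_diff_mem[OF assms(2-4)]] assms(4)]
  show ?thesis by simp
qed

lemma lp_functional_bound:
  assumes "lp_functional p L"
  obtains K where "0 < K" "\<And>x. x \<in> lp_space p \<Longrightarrow> cmod (L x) \<le> K * lp_norm p x"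
proof -
  obtain K where K: "\<And>x. x \<in> lp_space p \<Longrightarrow> cmod (L x) \<le> K * lp_norm p x"
    using assms unfolding lp_functional_def by blast
  have "cmod (L x) \<le> (\<bar>K\<bar> + 1) * lp_norm p x" if "x \<in> lp_space p" for x
    using K[OF that] mult_right_mono[of K "\<bar>K\<bar> + 1" "lp_norm p x"] lp_norm_nonneg[of p x] by linarith
  then show thesis using that[of "\<bar>K\<bar> + 1"] by simp
qed

lemma lp_functional_zero: "lp_functional p (\<lambda>x. 0)"
  by (auto simp: lp_functional_def intro: exI[of _ 0])

lemma lp_functional_add_mult:
  assumes "1 \<le> p" "lp_functional p L" "lp_functional p N"
  shows "lp_functional p (\<lambda>x. L x + d * N x)"
proof -
  obtain K where K: "\<And>x. x \<in> lp_space p \<Longrightarrow> cmod (L x) \<le> K * lp_norm p x"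
    using assms(2) unfolding lp_functional_def by blast
  obtain K' where K': "\<And>x. x \<in> lp_space p \<Longrightarrow> cmod (N x) \<le> K' * lp_norm p x"
    using assms(3) unfolding lp_functional_def by blast
  have "cmod (L x + d * N x) \<le> (K + cmod d * K') * lp_norm p x" if "x \<in> lp_space p" for x
  proof -
    have "cmod (L x + d * N x) \<le> cmod (L x) + cmod d * cmod (N x)"
      by (rule order_trans[OF norm_triangle_ineq]) (simp add: norm_mult)
    also have "\<dots> \<le> K * lp_norm p x + cmod d * (K' * lp_norm p x)"
      using K[OF that] K'[OF that] by (intro add_mono mult_left_mono) auto
    finally show ?thesis by (simp add: algebra_simps)
  qed
  moreover have "\<forall>x\<in>lp_space p. \<forall>y\<in>lp_space p. L (\<lambda>j. x j + y j) + d * N (\<lambda>j. x j + y j) = L x + d * N x + (L y + d * N y)"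
    using assms(2,3) by (simp add: lp_functional_def algebra_simps)
  moreover have "\<forall>a. \<forall>x\<in>lp_space p. L (\<lambda>j. a * x j) + d * N (\<lambda>j. a * x j) = a * (L x + d * N x)"
    using assms(2,3) by (simp add: lp_functional_def algebra_simps)
  ultimately show ?thesis unfolding lp_functional_def by blast
qed

lemma lp_holomorphic_on_const: "lp_holomorphic_on p D (\<lambda>x. a)"
  unfolding lp_holomorphic_on_def
  by (intro ballI exI[of _ "\<lambda>x. 0"] conjI lp_functional_zero)
     (auto simp: lp_dist_def lp_norm_nonneg intro: exI[of _ 1])

text \<open>\<open>H\<close> depends on \<open>y\<close> directly and through \<open>f y\<close>,
  with a total derivative split as \<open>A\<close> and \<open>d\<close>. This one form serves both
  composition with a scalar function and the map that pairs \<open>y\<close> with a functional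
  depending on \<open>y\<close>, without any calculus on a product space.\<close>

lemma lp_holomorphic_on_chain:
  assumes p: "1 \<le> p" and D: "D \<subseteq> lp_space p" and f: "lp_holomorphic_on p D f"
    and S: "\<And>y. y \<in> D \<Longrightarrow> f y \<in> S"
    and H: "\<And>x. x \<in> D \<Longrightarrow> \<exists>A d. lp_functional p A \<and> (\<forall>e>0. \<exists>\<delta>>0. \<forall>y\<in>D. \<forall>b\<in>S.
       lp_dist p y x < \<delta> \<longrightarrow> cmod (b - f x) < \<delta> \<longrightarrow>
       cmod (H y b - H x (f x) - A (\<lambda>j. y j - x j) - d * (b - f x)) \<le> e * (lp_dist p y x + cmod (b - f x)))"
  shows "lp_holomorphic_on p D (\<lambda>y. H y (f y))"
  unfolding lp_holomorphic_on_def
proof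
  fix x assume x: "x \<in> D"
  obtain A d where A: "lp_functional p A"
    and Hx: "\<And>e. e > 0 \<Longrightarrow> \<exists>\<delta>>0. \<forall>y\<in>D. \<forall>b\<in>S. lp_dist p y x < \<delta> \<longrightarrow> cmod (b - f x) < \<delta> \<longrightarrow>
       cmod (H y b - H x (f x) - A (\<lambda>j. y j - x j) - d * (b - f x)) \<le> e * (lp_dist p y x + cmod (b - f x))"
    using H[OF x] by blast
  obtain L where L: "lp_functional p L" and
    fx: "\<And>e. e > 0 \<Longrightarrow> \<exists>\<delta>>0. \<forall>y\<in>D. lp_dist p y x < \<delta> \<longrightarrow>
           cmod (f y - f x - L (\<lambda>j. y j - x j)) \<le> e * lp_dist p y x"
    using f x unfolding lp_holomorphic_on_def by blast
  obtain K where K: "0 < K" "\<And>x. x \<in> lp_space p \<Longrightarrow> cmod (L x) \<le> K * lp_norm p x"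
    using lp_functional_bound[OF L] by blast
  show "\<exists>L. lp_functional p L \<and> (\<forall>e>0. \<exists>\<delta>>0. \<forall>y\<in>D. lp_dist p y x < \<delta> \<longrightarrow>
           cmod (H y (f y) - H x (f x) - L (\<lambda>j. y j - x j)) \<le> e * lp_dist p y x)"
  proof (rule exI[of _ "\<lambda>h. A h + d * L h"], intro conjI allI impI)
    show "lp_functional p (\<lambda>h. A h + d * L h)" by (rule lp_functional_add_mult[OF p A L])
    fix e :: real assume e: "e > 0"
    \<comment> \<open>Each of the two errors gets \<open>e / 2\<close>: the error of
      \<open>H\<close> is weighed by |y - x| + |f y - f x|, at most \<open>K + 2\<close> times |y -
      x|, and the error of \<open>f\<close> is multiplied by \<open>d\<close>.\<close>
    define e1 where "e1 = e / (2 * (K + 2))"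
    define e2 where "e2 = e / (2 * (cmod d + 1))"
    have dp: "0 < cmod d + 1" by (simp add: add_nonneg_pos)
    have e12: "e1 > 0" "e2 > 0" using e K dp by (auto simp: e1_def e2_def)
    obtain \<delta>0 where d0: "\<delta>0 > 0" "\<And>y. y \<in> D \<Longrightarrow> lp_dist p y x < \<delta>0 \<Longrightarrow>
        cmod (f y - f x - L (\<lambda>j. y j - x j)) \<le> lp_dist p y x"
      using fx[of 1] by auto
    obtain \<delta>1 where d1: "\<delta>1 > 0" "\<And>y. y \<in> D \<Longrightarrow> lp_dist p y x < \<delta>1 \<Longrightarrow>
        cmod (f y - f x - L (\<lambda>j. y j - x j)) \<le> e2 * lp_dist p y x"
      using fx[OF e12(2)] by auto
    obtain \<delta>2 where d2: "\<delta>2 > 0" "\<And>y b. y \<in> D \<Longrightarrow> b \<in> S \<Longrightarrow> lp_dist p y x < \<delta>2 \<Longrightarrow> cmod (b - f x) < \<delta>2 \<Longrightarrow>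
       cmod (H y b - H x (f x) - A (\<lambda>j. y j - x j) - d * (b - f x)) \<le> e1 * (lp_dist p y x + cmod (b - f x))"
      using Hx[OF e12(1)] by blast
    \<comment> \<open>The last bound forces |f y - f x| \<le> (K + 1) |y - x| <
      \<open>\<delta>2\<close>, so that the expansion of \<open>H\<close> applies.\<close>
    define \<delta> where "\<delta> = min (min \<delta>0 \<delta>1) (min \<delta>2 (\<delta>2 / (K + 1)))"
    show "\<exists>\<delta>>0. \<forall>y\<in>D. lp_dist p y x < \<delta> \<longrightarrow>
           cmod (H y (f y) - H x (f x) - (A (\<lambda>j. y j - x j) + d * L (\<lambda>j. y j - x j))) \<le> e * lp_dist p y x"
    proof (intro exI[of _ \<delta>] conjI ballI impI)
      show "\<delta> > 0" using d0 d1 d2 K by (simp add: \<delta>_def)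
      fix y assume y: "y \<in> D" and yx: "lp_dist p y x < \<delta>"
      define N where "N = lp_dist p y x"
      have N: "0 \<le> N" "N < \<delta>0" "N < \<delta>1" "N < \<delta>2" "N * (K + 1) < \<delta>2"
        using yx K(1) lp_norm_nonneg[of p] by (auto simp: N_def \<delta>_def lp_dist_def pos_less_divide_eq)
      have "cmod (L (\<lambda>j. y j - x j)) \<le> K * N"
        unfolding N_def lp_dist_def using x y D by (intro K(2) lp_diff_mem[OF p]) auto
      then have b: "cmod (f y - f x) \<le> N * (K + 1)"
        using d0(2)[OF y N(2)[unfolded N_def]] norm_triangle_sub[of "f y - f x" "L (\<lambda>j. y j - x j)"]
        by (simp add: N_def algebra_simps)
      have "cmod (H y (f y) - H x (f x) - (A (\<lambda>j. y j - x j) + d * L (\<lambda>j. y j - x j)))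
          = cmod ((H y (f y) - H x (f x) - A (\<lambda>j. y j - x j) - d * (f y - f x)) + d * (f y - f x - L (\<lambda>j. y j - x j)))"
        by (rule arg_cong[where f = cmod]) (simp add: algebra_simps)
      also have "\<dots> \<le> cmod (H y (f y) - H x (f x) - A (\<lambda>j. y j - x j) - d * (f y - f x)) + cmod d * cmod (f y - f x - L (\<lambda>j. y j - x j))"
        by (rule order_trans[OF norm_triangle_ineq]) (simp add: norm_mult)
      also have "\<dots> \<le> e1 * (N + cmod (f y - f x)) + cmod d * (e2 * N)"
        using N b unfolding N_def by (intro add_mono mult_left_mono d1 d2 y S) auto
      also have "\<dots> \<le> e1 * (N + N * (K + 1)) + (cmod d + 1) * (e2 * N)"
        using b e12 N by (intro add_mono mult_left_mono mult_right_mono) auto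
      also have "\<dots> = e * N"
      proof -
        have "e1 * (N + N * (K + 1)) = e / 2 * N" using K(1) by (simp add: e1_def field_simps)
        moreover have "(cmod d + 1) * (e2 * N) = e / 2 * N" using dp by (simp add: e2_def field_simps)
        ultimately show ?thesis by linarith
      qed
      finally show "cmod (H y (f y) - H x (f x) - (A (\<lambda>j. y j - x j) + d * L (\<lambda>j. y j - x j))) \<le> e * lp_dist p y x"
        by (simp add: N_def)
    qed
  qed
qed

lemma field_derivative_remainder:
  fixes g :: "complex \<Rightarrow> complex"
  assumes "(g has_field_derivative d) (at a)" "e > 0"
  shows "\<exists>\<delta>>0. \<forall>b. cmod (b - a) < \<delta> \<longrightarrow> cmod (g b - g a - d * (b - a)) \<le> e * cmod (b - a)"
  using assms unfolding has_field_derivative_def has_derivative_at_alt by auto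

lemma lp_holomorphic_on_compose:
  assumes p: "1 \<le> p" and D: "D \<subseteq> lp_space p" and f: "lp_holomorphic_on p D f"
    and S: "open S" "\<And>y. y \<in> D \<Longrightarrow> f y \<in> S" and g: "g holomorphic_on S"
  shows "lp_holomorphic_on p D (\<lambda>y. g (f y))"
proof (rule lp_holomorphic_on_chain[OF p D f S(2)])
  fix x assume x: "x \<in> D"
  have "(g has_field_derivative deriv g (f x)) (at (f x))"
    using holomorphic_derivI[OF g S(1) S(2)[OF x]] .
  note r = field_derivative_remainder[OF this]
  show "\<exists>A d. lp_functional p A \<and> (\<forall>e>0. \<exists>\<delta>>0. \<forall>y\<in>D. \<forall>b\<in>S.
       lp_dist p y x < \<delta> \<longrightarrow> cmod (b - f x) < \<delta> \<longrightarrow>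
       cmod (g b - g (f x) - A (\<lambda>j. y j - x j) - d * (b - f x)) \<le> e * (lp_dist p y x + cmod (b - f x)))"
  proof (intro exI[of _ "\<lambda>x. 0"] exI[of _ "deriv g (f x)"] conjI lp_functional_zero allI impI)
    fix e :: real assume e: "e > 0"
    then obtain \<delta> where d: "\<delta> > 0" "\<And>b. cmod (b - f x) < \<delta> \<Longrightarrow>
        cmod (g b - g (f x) - deriv g (f x) * (b - f x)) \<le> e * cmod (b - f x)"
      using r by blast
    have "e * cmod (b - f x) \<le> e * (lp_dist p y x + cmod (b - f x))" for y b
      using e by (intro mult_left_mono) (auto simp: lp_dist_def lp_norm_nonneg)
    with d show "\<exists>\<delta>>0. \<forall>y\<in>D. \<forall>b\<in>S. lp_dist p y x < \<delta> \<longrightarrow> cmod (b - f x) < \<delta> \<longrightarrow>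
       cmod (g b - g (f x) - 0 - deriv g (f x) * (b - f x)) \<le> e * (lp_dist p y x + cmod (b - f x))"
      by (intro exI[of _ \<delta>]) (auto intro: order_trans)
  qed
qed

section \<open>Functions along discs in \<open>\<ell>\<^sup>p\<close>\<close>

lemma hol_from_disc_tendsto:
  assumes p: "1 \<le> p" and \<phi>: "\<phi> \<in> hol_from_disc p D" and z: "cmod z < 1" and D: "D \<subseteq> lp_space p"
  obtains v where "v \<in> lp_space p"
    "((\<lambda>w. lp_dist p (\<lambda>j. (\<phi> w j - \<phi> z j) / (w - z)) v) \<longlongrightarrow> 0) (at z)"
    "((\<lambda>w. lp_dist p (\<phi> w) (\<phi> z)) \<longlongrightarrow> 0) (at z)"
    "eventually (\<lambda>w. (\<lambda>j. (\<phi> w j - \<phi> z j) / (w - z)) \<in> lp_space p \<and> \<phi> w \<in> D \<and> w \<noteq> z \<and> cmod w < 1) (at z)"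
    "eventually (\<lambda>w. lp_dist p (\<phi> w) (\<phi> z) \<le>
        cmod (w - z) * (lp_dist p (\<lambda>j. (\<phi> w j - \<phi> z j) / (w - z)) v + lp_norm p v)) (at z)"
proof -
  obtain v where v: "v \<in> lp_space p" and
    lim: "((\<lambda>w. lp_dist p (\<lambda>j. (\<phi> w j - \<phi> z j) / (w - z)) v) \<longlongrightarrow> 0) (at z)"
    using \<phi> z unfolding hol_from_disc_def by fastforce
  have mem: "\<phi> w \<in> D" if "cmod w < 1" for w using \<phi> that by (auto simp: hol_from_disc_def)
  have q: "(\<lambda>j. (\<phi> w j - \<phi> z j) / (w - z)) \<in> lp_space p" if "cmod w < 1" for w
    using lp_scale(1)[OF p lp_diff_mem[OF p], of "\<phi> w" "\<phi> z" "1 / (w - z)"] mem z that D by auto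
  have ev: "eventually (\<lambda>w. w \<noteq> z \<and> cmod w < 1) (at z)"
    using eventually_at_in_open[of "ball 0 1" z] z by (auto elim: eventually_mono)
  have ev1: "eventually (\<lambda>w. (\<lambda>j. (\<phi> w j - \<phi> z j) / (w - z)) \<in> lp_space p \<and> \<phi> w \<in> D \<and> w \<noteq> z \<and> cmod w < 1) (at z)"
    using ev by eventually_elim (auto intro: q mem)
  have le: "lp_dist p (\<phi> w) (\<phi> z) \<le>
        cmod (w - z) * (lp_dist p (\<lambda>j. (\<phi> w j - \<phi> z j) / (w - z)) v + lp_norm p v)"
    if w: "w \<noteq> z" "cmod w < 1" for w
  proof -
    define u where "u = (\<lambda>j. (\<phi> w j - \<phi> z j) / (w - z))"
    have u: "u \<in> lp_space p" using q[OF w(2)] by (simp add: u_def)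
    have "(\<lambda>j. \<phi> w j - \<phi> z j) = (\<lambda>j. (w - z) * u j)" using w by (simp add: u_def)
    then have "lp_dist p (\<phi> w) (\<phi> z) = cmod (w - z) * lp_norm p u"
      unfolding lp_dist_def using lp_scale(2)[OF p u] by simp
    moreover have "lp_norm p u \<le> lp_dist p u v + lp_norm p v"
      using lp_minkowski(2)[OF p lp_diff_mem[OF p u v] v] by (simp add: lp_dist_def)
    ultimately show ?thesis by (simp add: mult_left_mono u_def)
  qed
  have ev2: "eventually (\<lambda>w. lp_dist p (\<phi> w) (\<phi> z) \<le>
        cmod (w - z) * (lp_dist p (\<lambda>j. (\<phi> w j - \<phi> z j) / (w - z)) v + lp_norm p v)) (at z)"
    using ev by eventually_elim (auto intro: le)
  have "((\<lambda>w. cmod (w - z) * (lp_dist p (\<lambda>j. (\<phi> w j - \<phi> z j) / (w - z)) v + lp_norm p v)) \<longlongrightarrow> cmod (z - z) * (0 + lp_norm p v)) (at z)"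
    by (intro tendsto_intros lim)
  then have "((\<lambda>w. lp_dist p (\<phi> w) (\<phi> z)) \<longlongrightarrow> 0) (at z)"
    using Lim_null_comparison[of "\<lambda>w. lp_dist p (\<phi> w) (\<phi> z)", OF eventually_mono[OF ev2]]
    by (simp add: lp_dist_def lp_norm_nonneg)
  then show thesis using that v lim ev1 ev2 by blast
qed

lemma holomorphic_on_lp_compose:
  assumes p: "1 \<le> p" and D: "D \<subseteq> lp_space p" and f: "lp_holomorphic_on p D f" and \<phi>: "\<phi> \<in> hol_from_disc p D"
  shows "(\<lambda>z. f (\<phi> z)) holomorphic_on ball 0 1"
proof (unfold holomorphic_on_open[OF open_ball], intro ballI)
  fix z :: complex assume "z \<in> ball 0 1"
  then have z: "cmod z < 1" by simp
  define q where "q w = (\<lambda>j. (\<phi> w j - \<phi> z j) / (w - z))" for w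
  obtain v where v: "v \<in> lp_space p" and lim: "((\<lambda>w. lp_dist p (q w) v) \<longlongrightarrow> 0) (at z)"
    and lim0: "((\<lambda>w. lp_dist p (\<phi> w) (\<phi> z)) \<longlongrightarrow> 0) (at z)"
    and ev: "eventually (\<lambda>w. q w \<in> lp_space p \<and> \<phi> w \<in> D \<and> w \<noteq> z \<and> cmod w < 1) (at z)"
    and le: "eventually (\<lambda>w. lp_dist p (\<phi> w) (\<phi> z) \<le> cmod (w - z) * (lp_dist p (q w) v + lp_norm p v)) (at z)"
    using hol_from_disc_tendsto[OF p \<phi> z D] unfolding q_def by blast
  have \<phi>z: "\<phi> z \<in> D" using \<phi> z by (auto simp: hol_from_disc_def)
  obtain L where L: "lp_functional p L" and
    fx: "\<And>e. e > 0 \<Longrightarrow> \<exists>\<delta>>0. \<forall>y\<in>D. lp_dist p y (\<phi> z) < \<delta> \<longrightarrow>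
           cmod (f y - f (\<phi> z) - L (\<lambda>j. y j - \<phi> z j)) \<le> e * lp_dist p y (\<phi> z)"
    using f \<phi>z unfolding lp_holomorphic_on_def by blast
  obtain K where K: "0 < K" "\<And>x. x \<in> lp_space p \<Longrightarrow> cmod (L x) \<le> K * lp_norm p x"
    using lp_functional_bound[OF L] by blast
  have "((\<lambda>w. (f (\<phi> w) - f (\<phi> z)) / (w - z)) \<longlongrightarrow> L v) (at z)"
  proof (rule tendstoI)
    fix e :: real assume e: "e > 0"
    \<comment> \<open>Near \<open>z\<close> the difference quotient has norm at most
      \<open>1 + lp_norm p v\<close>, so the remainder of \<open>f\<close> contributes at most
      \<open>e / 2\<close>; the other half pays for replacing \<open>q w\<close> by \<open>v\<close>
      inside \<open>L\<close>.\<close>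
    define e1 where "e1 = e / (2 * (1 + lp_norm p v))"
    have vp: "0 < 1 + lp_norm p v" by (simp add: add_pos_nonneg lp_norm_nonneg)
    have e1: "e1 > 0" using e vp by (simp add: e1_def)
    obtain \<delta> where d: "\<delta> > 0" "\<And>y. y \<in> D \<Longrightarrow> lp_dist p y (\<phi> z) < \<delta> \<Longrightarrow>
           cmod (f y - f (\<phi> z) - L (\<lambda>j. y j - \<phi> z j)) \<le> e1 * lp_dist p y (\<phi> z)"
      using fx[OF e1] by blast
    have ev1: "eventually (\<lambda>w. lp_dist p (q w) v < min 1 (e / (2 * K))) (at z)"
      using order_tendstoD(2)[OF lim, of "min 1 (e / (2 * K))"] e K by simp
    have ev2: "eventually (\<lambda>w. lp_dist p (\<phi> w) (\<phi> z) < \<delta>) (at z)"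
      using order_tendstoD(2)[OF lim0 d(1)] .
    show "eventually (\<lambda>w. dist ((f (\<phi> w) - f (\<phi> z)) / (w - z)) (L v) < e) (at z)"
      using ev ev1 ev2 le
    proof eventually_elim
      case (elim w)
      then have w: "w \<noteq> z" and qw: "q w \<in> lp_space p" and wD: "\<phi> w \<in> D" by auto
      have eq: "(\<lambda>j. \<phi> w j - \<phi> z j) = (\<lambda>j. (w - z) * q w j)" using w by (simp add: q_def)
      have "L (\<lambda>j. \<phi> w j - \<phi> z j) = (w - z) * L (q w)"
        unfolding eq using L qw unfolding lp_functional_def by blast
      then have "(f (\<phi> w) - f (\<phi> z)) / (w - z) - L v =
          (f (\<phi> w) - f (\<phi> z) - L (\<lambda>j. \<phi> w j - \<phi> z j)) / (w - z) + L (\<lambda>j. q w j - v j)"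
        using w lp_functional_diff[OF L p qw v] by (simp add: diff_divide_distrib)
      then have "dist ((f (\<phi> w) - f (\<phi> z)) / (w - z)) (L v) \<le>
          cmod (f (\<phi> w) - f (\<phi> z) - L (\<lambda>j. \<phi> w j - \<phi> z j)) / cmod (w - z) + cmod (L (\<lambda>j. q w j - v j))"
        unfolding dist_norm by (simp add: norm_triangle_ineq flip: norm_divide)
      also have "\<dots> \<le> e1 * (cmod (w - z) * (lp_dist p (q w) v + lp_norm p v)) / cmod (w - z) + K * lp_dist p (q w) v"
        unfolding lp_dist_def[of p "q w"]
        using elim e1 by (intro add_mono divide_right_mono order_trans[OF d(2)[OF wD]] mult_left_mono
           K(2) lp_diff_mem[OF p qw v]) (auto simp: lp_dist_def)
      also have "\<dots> = e1 * (lp_dist p (q w) v + lp_norm p v) + K * lp_dist p (q w) v"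
        using w by simp
      also have "\<dots> < e1 * (1 + lp_norm p v) + K * (e / (2 * K))"
        using elim e1 K(1) by (intro add_less_le_mono mult_strict_left_mono mult_left_mono) auto
      also have "\<dots> = e" using vp K(1) by (simp add: e1_def field_simps)
      finally show ?case .
    qed
  qed
  then show "\<exists>d. ((\<lambda>z. f (\<phi> z)) has_field_derivative d) (at z)"
    unfolding has_field_derivative_iff by blast
qed

section \<open>Cauchy estimates and discs with a summable majorant\<close>

lemma Cauchy_remainder:
  fixes f :: "complex \<Rightarrow> complex"
  assumes hol: "f holomorphic_on ball 0 1" and B: "\<And>w. cmod w < 1 \<Longrightarrow> cmod (f w) \<le> B"
    and z: "cmod z < 1" and r: "r = (1 - cmod z) / 4"
  shows "cmod (deriv f z) \<le> B / r"
    and "w \<in> ball z r \<Longrightarrow> w \<noteq> z \<Longrightarrow> cmod ((f w - f z) / (w - z) - deriv f z) \<le> 2 * B / r\<^sup>2 * cmod (w - z)"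
proof -
  have r0: "r > 0" using z r by simp
  \<comment> \<open>The radius is a quarter of the distance to the circle, which leaves room for
    Cauchy's inequality at every point of \<open>cball z r\<close>.\<close>
  have sub: "cball x r \<subseteq> ball 0 1" if "x \<in> cball z r" for x
  proof
    fix y assume "y \<in> cball x r"
    then have "cmod y \<le> cmod z + dist z x + dist x y"
      by (metis dist_norm dist_triangle norm_minus_commute norm_triangle_sub add.assoc add_left_mono order_trans dist_commute)
    also have "\<dots> \<le> cmod z + r + r" using that \<open>y \<in> cball x r\<close> by simp
    also have "\<dots> < 1" using z r by simp
    finally show "y \<in> ball 0 1" by simp
  qed
  have C: "cmod ((deriv ^^ n) f x) \<le> fact n * B / r ^ n" if x: "x \<in> cball z r" for x n
  proof (rule Cauchy_inequality)
    show "f holomorphic_on ball x r" using sub[OF x] hol by (meson ball_subset_cball holomorphic_on_subset order_trans)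
    show "continuous_on (cball x r) f"
      using sub[OF x] hol by (meson holomorphic_on_imp_continuous_on continuous_on_subset)
    show "0 < r" by (rule r0)
    show "cmod (f w) \<le> B" if "cmod (x - w) = r" for w
      using sub[OF x] that by (intro B) (auto simp: subset_iff dist_norm)
  qed
  show "cmod (deriv f z) \<le> B / r" using C[of z 1] r0 by simp
  assume w: "w \<in> ball z r" "w \<noteq> z"
  have "cmod (f w - (\<Sum>i\<le>1. (deriv ^^ i) f z * (w - z) ^ i / fact i)) \<le> 2 * B / r\<^sup>2 * cmod (w - z) ^ Suc 1 / fact 1"
  proof (rule complex_Taylor[of "ball z r" 1 "\<lambda>i. (deriv ^^ i) f", simplified funpow_0])
    show "convex (ball z r)" by simp
    show "((deriv ^^ i) f has_field_derivative (deriv ^^ Suc i) f x) (at x within ball z r)"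
      if "x \<in> ball z r" "i \<le> 1" for i x
    proof -
      have "x \<in> cball x r" using r0 by simp
      then have "x \<in> ball 0 1" using subsetD[OF sub[of x]] that by simp
      then have "((deriv ^^ i) f has_field_derivative (deriv ^^ Suc i) f x) (at x)"
        using holomorphic_derivI[OF holomorphic_higher_deriv[OF hol open_ball] open_ball] by simp
      then show ?thesis by (rule has_field_derivative_at_within)
    qed
    show "cmod ((deriv ^^ Suc 1) f x) \<le> 2 * B / r\<^sup>2" if "x \<in> ball z r" for x
      using C[of x 2] that by (simp add: numeral_2_eq_2)
    show "z \<in> ball z r" "w \<in> ball z r" using w r0 by auto
  qed
  then have "cmod (f w - f z - deriv f z * (w - z)) \<le> 2 * B / r\<^sup>2 * cmod (w - z) ^ 2"
    by (simp add: diff_diff_eq power2_eq_square)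
  moreover have "(f w - f z) / (w - z) - deriv f z = (f w - f z - deriv f z * (w - z)) / (w - z)"
    using w by (simp add: diff_divide_distrib)
  ultimately have "cmod ((f w - f z) / (w - z) - deriv f z) \<le> (2 * B / r\<^sup>2 * cmod (w - z) ^ 2) / cmod (w - z)"
    by (simp only: norm_divide divide_right_mono norm_ge_zero)
  then show "cmod ((f w - f z) / (w - z) - deriv f z) \<le> 2 * B / r\<^sup>2 * cmod (w - z)"
    using w by (simp add: power2_eq_square)
qed

text \<open>The constants in \<open>Cauchy_remainder\<close> are linear in the bound on the
  function. Applied to each coordinate with the bound \<open>M j powr (1 / p)\<close>, they give
  errors whose p-th powers are summable, hence convergence of the difference quotients in
  norm.\<close>

lemma hol_from_disc_dominated:
  assumes p: "1 \<le> p" and hol: "\<And>j. (\<lambda>z. \<phi> z j) holomorphic_on ball 0 1"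
    and M: "summable M" "\<And>j z. cmod z < 1 \<Longrightarrow> cmod (\<phi> z j) powr p \<le> M j"
    and D: "\<phi> ` ball 0 1 \<subseteq> D"
  shows "\<phi> \<in> hol_from_disc p D"
proof -
  define B where "B j = M j powr (1 / p)" for j
  have M0: "0 \<le> M j" for j by (rule order_trans[OF powr_ge_zero M(2)[of 0]]) simp
  have Bp: "B j powr p = M j" for j using p M0[of j] by (simp add: B_def powr_powr)
  have B0: "0 \<le> B j" for j by (simp add: B_def)
  have B: "cmod (\<phi> z j) \<le> B j" if "cmod z < 1" for z j
    using M(2)[OF that, of j] p B0[of j] unfolding Bp[symmetric] by (simp add: powr_le_powr_iff)
  have "\<exists>v\<in>lp_space p. ((\<lambda>w. lp_dist p (\<lambda>j. (\<phi> w j - \<phi> z j) / (w - z)) v) \<longlongrightarrow> 0) (at z)"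
    if z: "cmod z < 1" for z
  proof -
    define r where "r = (1 - cmod z) / 4"
    have r: "r > 0" using z by (simp add: r_def)
    define v where "v j = deriv (\<lambda>z. \<phi> z j) z" for j
    have "cmod (v j) powr p \<le> (1 / r) powr p * M j" for j
    proof -
      have "cmod (v j) \<le> 1 / r * B j"
        using Cauchy_remainder(1)[OF hol B z r_def] by (simp add: v_def)
      then have "cmod (v j) powr p \<le> (1 / r * B j) powr p" using p by (intro powr_mono2) auto
      then show ?thesis using r B0[of j] unfolding Bp[of j, symmetric] by (simp add: powr_mult powr_divide)
    qed
    then have v: "v \<in> lp_space p" using r by (intro lp_norm_bound(1)[OF p M(1), of "1 / r"]) auto
    have "lp_dist p (\<lambda>j. (\<phi> w j - \<phi> z j) / (w - z)) v \<le> 2 / r\<^sup>2 * cmod (w - z) * suminf M powr (1 / p)"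
      if w: "w \<in> ball z r" "w \<noteq> z" for w
      unfolding lp_dist_def
    proof (rule lp_norm_bound(2)[OF p M(1)])
      fix j
      have "cmod ((\<phi> w j - \<phi> z j) / (w - z) - v j) \<le> 2 / r\<^sup>2 * cmod (w - z) * B j"
        using Cauchy_remainder(2)[OF hol B z r_def w, of j] by (simp add: v_def mult_ac)
      then have "cmod ((\<phi> w j - \<phi> z j) / (w - z) - v j) powr p \<le> (2 / r\<^sup>2 * cmod (w - z) * B j) powr p"
        using p by (intro powr_mono2) auto
      then show "cmod ((\<phi> w j - \<phi> z j) / (w - z) - v j) powr p \<le> (2 / r\<^sup>2 * cmod (w - z)) powr p * M j"
        using B0[of j] r unfolding Bp[of j, symmetric] by (subst (asm) powr_mult) auto
    qed (use r in auto)
    moreover have "eventually (\<lambda>w. w \<in> ball z r \<and> w \<noteq> z) (at z)"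
      using eventually_at_in_open[of "ball z r" z] r by (auto elim: eventually_mono)
    ultimately have ev: "eventually (\<lambda>w. norm (lp_dist p (\<lambda>j. (\<phi> w j - \<phi> z j) / (w - z)) v) \<le>
        2 / r\<^sup>2 * cmod (w - z) * suminf M powr (1 / p)) (at z)"
      by (auto elim!: eventually_mono simp: lp_dist_def lp_norm_nonneg)
    have "((\<lambda>w. 2 / r\<^sup>2 * cmod (w - z) * suminf M powr (1 / p)) \<longlongrightarrow> 2 / r\<^sup>2 * cmod (z - z) * suminf M powr (1 / p)) (at z)"
      by (intro tendsto_intros) (use r in auto)
    then have "((\<lambda>w. lp_dist p (\<lambda>j. (\<phi> w j - \<phi> z j) / (w - z)) v) \<longlongrightarrow> 0) (at z)"
      by (intro Lim_null_comparison[OF ev]) simp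
    with v show ?thesis by blast
  qed
  then show ?thesis using D by (auto simp: hol_from_disc_def)
qed

section \<open>Discs of functionals\<close>

lemma hol_from_disc_mem:
  assumes "\<psi> \<in> hol_from_disc p D" "cmod z < 1"
  shows "\<psi> z \<in> D"
  using assms by (auto simp: hol_from_disc_def image_subset_iff)

text \<open>Young's inequality for the terms normalized by the norm of \<open>x\<close> and by
  \<open>S\<close>, then summation. Writing the second factor as a power of \<open>w\<close> avoids
  the conjugate exponent, which is infinite for \<open>p = 1\<close>.\<close>

lemma lp_Hoelder:
  assumes p: "1 \<le> p" and x: "x \<in> lp_space p" and w: "summable w" "\<And>j. 0 \<le> w j" and S: "0 < S" "suminf w \<le> S"
  shows "summable (\<lambda>j. cmod (x j) * w j powr (1 - 1 / p))"
    and "(\<Sum>j. cmod (x j) * w j powr (1 - 1 / p)) \<le> lp_norm p x * S powr (1 - 1 / p)"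
proof -
  define N where "N = lp_norm p x"
  define a where "a = 1 - 1 / p"
  have a: "0 \<le> a" "1 / p + a = 1" using p by (auto simp: a_def)
  have "summable (\<lambda>j. cmod (x j) * w j powr a) \<and> (\<Sum>j. cmod (x j) * w j powr a) \<le> N * S powr a"
  proof (cases "N = 0")
    case True
    then show ?thesis using lp_norm_eq_0[OF p x] by (simp add: N_def)
  next
    case False
    then have N: "N > 0" using lp_norm_nonneg[of p x] by (simp add: N_def)
    define g where "g j = N * S powr a * (1 / p * (cmod (x j) powr p / N powr p) + a * (w j / S))" for j
    have sx: "(\<lambda>j. cmod (x j) powr p) sums (N powr p)"
      using x lp_norm_powr[OF p x] by (simp add: N_def lp_space_def summable_sums)
    have "g sums (N * S powr a * (1 / p * (N powr p / N powr p) + a * (suminf w / S)))"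
      unfolding g_def by (intro sums_mult sums_add sums_divide sx summable_sums w)
    moreover have "N * S powr a * (1 / p * (N powr p / N powr p) + a * (suminf w / S)) \<le> N * S powr a * 1"
    proof (intro mult_left_mono)
      have "suminf w / S \<le> 1" using S by simp
      then have "a * (suminf w / S) \<le> a * 1" using a by (intro mult_left_mono) auto
      then show "1 / p * (N powr p / N powr p) + a * (suminf w / S) \<le> 1" using a N by simp
    qed (use N in auto)
    ultimately have g: "summable g" "suminf g \<le> N * S powr a" by (auto simp: sums_iff)
    have le: "cmod (x j) * w j powr a \<le> g j" for j
    \<comment> \<open>Young's inequality is applied to positive numbers only. For
      \<open>p = 1\<close> and \<open>w j = 0\<close> the factor is \<open>0 powr 0\<close>, which
      is 0.\<close>
    proof (cases "x j = 0 \<or> w j = 0")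
      case True
      have "0 \<le> g j" unfolding g_def using N S w a p by (intro mult_nonneg_nonneg add_nonneg_nonneg) auto
      then show ?thesis using True by auto
    next
      case False
      have "(cmod (x j) powr p / N powr p) powr (1 / p) * (w j / S) powr a \<le>
          1 / p * (cmod (x j) powr p / N powr p) + a * (w j / S)"
        using p a N S w(2)[of j] False by (intro Youngs_inequality_0) auto
      moreover have "(cmod (x j) powr p / N powr p) powr (1 / p) = cmod (x j) / N"
        using p N by (simp add: powr_divide powr_powr)
      moreover have "(w j / S) powr a = w j powr a / S powr a"
        using w S by (simp add: powr_divide)
      ultimately have "N * S powr a * (cmod (x j) / N * (w j powr a / S powr a)) \<le> g j"
        unfolding g_def using N by (intro mult_left_mono) auto
      then show ?thesis using N S by simp
    qed
    have s: "summable (\<lambda>j. cmod (x j) * w j powr a)"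
      by (rule summable_comparison_test'[OF g(1), of 0]) (use le in auto)
    then show ?thesis using suminf_le[OF le s g(1)] g(2) by simp
  qed
  then show "summable (\<lambda>j. cmod (x j) * w j powr (1 - 1 / p))"
    "(\<Sum>j. cmod (x j) * w j powr (1 - 1 / p)) \<le> lp_norm p x * S powr (1 - 1 / p)"
    by (auto simp: a_def N_def)
qed

text \<open>
  A holomorphic disc of functionals on \<open>\<ell>\<^sup>p\<close>. The bound \<open>w\<^sub>j powr (1 - 1 / p)\<close> on the \<open>j\<close>-th
  coefficient says that the functionals lie in the unit ball of \<open>\<ell>\<^sup>q\<close>, in a form that makes sense for \<open>p = 1\<close>, too.
\<close>

locale disc_functionals =
  fixes p :: real and k :: "nat \<Rightarrow> complex \<Rightarrow> complex" and w :: "nat \<Rightarrow> complex \<Rightarrow> real" and M :: "nat \<Rightarrow> real"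
  assumes p: "1 \<le> p"
    and k_holomorphic: "\<And>j. k j holomorphic_on ball 0 1"
    and k_le: "\<And>j z. cmod z < 1 \<Longrightarrow> cmod (k j z) \<le> w j z powr (1 - 1 / p)"
    and w_nonneg: "\<And>j z. cmod z < 1 \<Longrightarrow> 0 \<le> w j z"
    and w_le: "\<And>j z. cmod z < 1 \<Longrightarrow> w j z \<le> M j"
    and M_summable: "summable M"
    and w_sum: "\<And>z. cmod z < 1 \<Longrightarrow> (\<Sum>j. w j z) \<le> 1"
begin

definition pairing :: "(nat \<Rightarrow> complex) \<Rightarrow> complex \<Rightarrow> complex" where
  "pairing x z = (\<Sum>j. x j * k j z)"

lemma w_summable: "cmod z < 1 \<Longrightarrow> summable (\<lambda>j. w j z)"
  by (rule summable_comparison_test'[OF M_summable, of 0]) (use w_nonneg w_le in auto)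

lemma pairing_norm_le:
  assumes x: "x \<in> lp_space p" and z: "cmod z < 1"
  shows "summable (\<lambda>j. cmod (x j * k j z))" "(\<Sum>j. cmod (x j * k j z)) \<le> lp_norm p x"
proof -
  note H = lp_Hoelder[OF p x w_summable[OF z] w_nonneg[OF z] zero_less_one w_sum[OF z]]
  have le: "cmod (x j * k j z) \<le> cmod (x j) * w j z powr (1 - 1 / p)" for j
    using k_le[OF z, of j] by (simp add: norm_mult mult_left_mono)
  show s: "summable (\<lambda>j. cmod (x j * k j z))"
    by (rule summable_comparison_test'[OF H(1), of 0]) (use le in auto)
  show "(\<Sum>j. cmod (x j * k j z)) \<le> lp_norm p x"
    using suminf_le[OF le s H(1)] H(2) by simp
qed

lemma pairing_summable:
  assumes "x \<in> lp_space p" "cmod z < 1"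
  shows "summable (\<lambda>j. x j * k j z)"
  using pairing_norm_le(1)[OF assms] by (rule summable_norm_cancel)

lemma pairing_norm:
  assumes "x \<in> lp_space p" "cmod z < 1"
  shows "cmod (pairing x z) \<le> lp_norm p x"
  unfolding pairing_def using summable_norm[OF pairing_norm_le(1)[OF assms]] pairing_norm_le(2)[OF assms] by simp

lemma pairing_add:
  assumes "x \<in> lp_space p" "y \<in> lp_space p" "cmod z < 1"
  shows "pairing (\<lambda>j. x j + y j) z = pairing x z + pairing y z"
  unfolding pairing_def using suminf_add[OF pairing_summable[OF assms(1,3)] pairing_summable[OF assms(2,3)]] by (simp add: distrib_right)

lemma pairing_diff:
  assumes "x \<in> lp_space p" "y \<in> lp_space p" "cmod z < 1"
  shows "pairing (\<lambda>j. x j - y j) z = pairing x z - pairing y z"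
  unfolding pairing_def using suminf_diff[OF pairing_summable[OF assms(1,3)] pairing_summable[OF assms(2,3)]] by (simp add: left_diff_distrib)

lemma pairing_scale:
  assumes "x \<in> lp_space p" "cmod z < 1"
  shows "pairing (\<lambda>j. a * x j) z = a * pairing x z"
  unfolding pairing_def using suminf_mult[OF pairing_summable[OF assms]] by (simp add: mult.assoc)

lemma lp_functional_pairing:
  assumes z: "cmod z < 1"
  shows "lp_functional p (\<lambda>x. pairing x z)"
  unfolding lp_functional_def using z
  by (auto simp: pairing_add pairing_scale pairing_norm intro!: exI[of _ 1])

lemma pairing_holomorphic:
  assumes x: "x \<in> lp_space p"
  shows "pairing x holomorphic_on ball 0 1"
proof -
  have M0: "0 \<le> M j" for j using w_nonneg[of 0 j] w_le[of 0 j] by simp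
  \<comment> \<open>The summand 1 in \<open>suminf M + 1\<close> keeps the constant positive when
    \<open>M\<close> vanishes.\<close>
  have s: "summable (\<lambda>j. cmod (x j) * M j powr (1 - 1 / p))"
    by (rule lp_Hoelder(1)[OF p x M_summable M0, of "suminf M + 1"]) (use suminf_nonneg[OF M_summable M0] in auto)
  have "uniform_limit (ball 0 1) (\<lambda>n z. \<Sum>j<n. x j * k j z) (\<lambda>z. \<Sum>j. x j * k j z) sequentially"
  proof (rule Weierstrass_m_test[OF _ s])
    fix n z assume "z \<in> ball (0 :: complex) 1"
    then have z: "cmod z < 1" by simp
    have "cmod (k n z) \<le> M n powr (1 - 1 / p)"
      using k_le[OF z, of n] powr_mono2[OF _ w_nonneg[OF z] w_le[OF z], of "1 - 1 / p" n] p by simp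
    then show "cmod (x n * k n z) \<le> cmod (x n) * M n powr (1 - 1 / p)"
      by (simp add: norm_mult mult_left_mono)
  qed
  then have ul: "uniform_limit (ball 0 1) (\<lambda>n z. \<Sum>j<n. x j * k j z) (pairing x) sequentially"
    by (simp add: pairing_def[abs_def])
  show ?thesis
  proof (rule holomorphic_uniform_sequence[OF open_ball])
    show "(\<lambda>z. \<Sum>j<n. x j * k j z) holomorphic_on ball 0 1" for n
      by (intro holomorphic_intros k_holomorphic)
    fix z :: complex assume "z \<in> ball 0 1"
    then obtain d where "d > 0" "cball z d \<subseteq> ball 0 1"
      using open_contains_cball[of "ball (0::complex) 1"] by blast
    then show "\<exists>d>0. cball z d \<subseteq> ball 0 1 \<and> uniform_limit (cball z d) (\<lambda>n z. \<Sum>j<n. x j * k j z) (pairing x) sequentially"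
      using uniform_limit_on_subset[OF ul] by blast
  qed
qed

text \<open>The bound has to be linear in the norm of \<open>x\<close>, so that the pairing can be
  differentiated in both arguments at once. It is the Schwarz-Pick inequality for the pairing
  divided by twice that norm; the factor 2 keeps the values well inside the disc.\<close>

lemma pairing_Lipschitz:
  assumes x: "x \<in> lp_space p" and z: "cmod z < 1" and z': "cmod z' < 1"
  shows "cmod (pairing x z' - pairing x z) \<le> 4 / (1 - cmod z) * lp_norm p x * cmod (z' - z)"
proof (cases "lp_norm p x = 0")
  case True
  then have "cmod (pairing x z' - pairing x z) = 0" using pairing_norm[OF x z] pairing_norm[OF x z'] by simp
  then show ?thesis using True by simp
next
  case False
  then have N: "lp_norm p x > 0" using lp_norm_nonneg[of p x] by simp
  define f where "f z = pairing x z / of_real (2 * lp_norm p x)" for z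
  have f: "cmod (f z) \<le> 1 / 2" if "cmod z < 1" for z
    using pairing_norm[OF x that] N by (simp add: f_def norm_divide field_simps)
  have "f holomorphic_on ball 0 1"
    unfolding f_def using N by (intro holomorphic_intros pairing_holomorphic x) auto
  then have "cmod (mob (f z) (f z')) \<le> cmod (mob z z')"
  proof (rule Schwarz_Pick[OF _ _ z' z])
    show "cmod (f z) < 1" if "cmod z < 1" for z using f[OF that] by linarith
  qed
  moreover have "cmod (f z' - f z) / 2 \<le> cmod (mob (f z) (f z'))"
  proof -
    have "cmod (cnj (f z) * f z') \<le> 1 / 2 * 1"
      using f[OF z] f[OF z'] unfolding norm_mult complex_mod_cnj by (intro mult_mono) auto
    then have "cmod (1 - cnj (f z) * f z') \<le> 2" "1 - cnj (f z) * f z' \<noteq> 0"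
      using norm_triangle_ineq4[of 1 "cnj (f z) * f z'"] by auto
    then show ?thesis unfolding mob_def norm_divide by (intro divide_left_mono) auto
  qed
  moreover have "cmod (mob z z') \<le> cmod (z' - z) / (1 - cmod z)"
  proof -
    have "cmod (cnj z * z') \<le> cmod z * 1"
      unfolding norm_mult complex_mod_cnj using z' by (intro mult_left_mono) auto
    then have "1 - cmod z \<le> cmod (1 - cnj z * z')"
      using norm_triangle_ineq2[of 1 "cnj z * z'"] by simp
    then show ?thesis unfolding mob_def norm_divide using z by (intro divide_left_mono) (auto intro!: mult_pos_pos)
  qed
  ultimately have "cmod (f z' - f z) / 2 \<le> cmod (z' - z) / (1 - cmod z)" by linarith
  moreover have "cmod (f z' - f z) = cmod (pairing x z' - pairing x z) / (2 * lp_norm p x)"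
    using N by (simp add: f_def norm_divide flip: diff_divide_distrib)
  ultimately show ?thesis using N z by (simp add: field_simps)
qed

lemma lp_holomorphic_on_pairing:
  assumes D: "D \<subseteq> lp_space p" and f: "lp_holomorphic_on p D f" and fD: "\<And>y. y \<in> D \<Longrightarrow> f y \<in> ball 0 1"
  shows "lp_holomorphic_on p D (\<lambda>y. pairing y (f y))"
proof (rule lp_holomorphic_on_chain[OF p D f fD])
  fix x assume x: "x \<in> D"
  then have xl: "x \<in> lp_space p" using D by auto
  define a where "a = f x"
  have a: "cmod a < 1" using fD[OF x] by (simp add: a_def)
  have "(pairing x has_field_derivative deriv (pairing x) a) (at a)"
    using holomorphic_derivI[OF pairing_holomorphic[OF xl] open_ball] a by simp
  note r = field_derivative_remainder[OF this]
  show "\<exists>A d. lp_functional p A \<and> (\<forall>e>0. \<exists>\<delta>>0. \<forall>y\<in>D. \<forall>b\<in>ball 0 1.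
       lp_dist p y x < \<delta> \<longrightarrow> cmod (b - f x) < \<delta> \<longrightarrow>
       cmod (pairing y b - pairing x (f x) - A (\<lambda>j. y j - x j) - d * (b - f x)) \<le> e * (lp_dist p y x + cmod (b - f x)))"
    unfolding a_def[symmetric]
  proof (intro exI[of _ "\<lambda>h. pairing h a"] exI[of _ "deriv (pairing x) a"] conjI lp_functional_pairing a allI impI)
    fix e :: real assume e: "e > 0"
    then obtain \<delta> where d: "\<delta> > 0" "\<And>b. cmod (b - a) < \<delta> \<Longrightarrow>
        cmod (pairing x b - pairing x a - deriv (pairing x) a * (b - a)) \<le> e * cmod (b - a)"
      using r by blast
    show "\<exists>\<delta>>0. \<forall>y\<in>D. \<forall>b\<in>ball 0 1. lp_dist p y x < \<delta> \<longrightarrow> cmod (b - a) < \<delta> \<longrightarrow>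
       cmod (pairing y b - pairing x a - pairing (\<lambda>j. y j - x j) a - deriv (pairing x) a * (b - a)) \<le> e * (lp_dist p y x + cmod (b - a))"
    \<comment> \<open>The mixed term \<open>pairing h b - pairing h a\<close> is at most
      \<open>4 / (1 - cmod a) * lp_norm p h * cmod (b - a)\<close>; the second entry of the minimum
      turns this into \<open>e * lp_norm p h\<close>.\<close>
    proof (intro exI[of _ "min \<delta> (e * (1 - cmod a) / 4)"] conjI ballI impI)
      show "0 < min \<delta> (e * (1 - cmod a) / 4)" using d e a by simp
      fix y b assume y: "y \<in> D" and "b \<in> ball (0::complex) 1" and "lp_dist p y x < min \<delta> (e * (1 - cmod a) / 4)"
        and ba: "cmod (b - a) < min \<delta> (e * (1 - cmod a) / 4)"
      then have b: "cmod b < 1" by simp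
      have yl: "y \<in> lp_space p" using y D by auto
      define h where "h = (\<lambda>j. y j - x j)"
      have h: "h \<in> lp_space p" unfolding h_def by (rule lp_diff_mem[OF p yl xl])
      have hN: "lp_norm p h = lp_dist p y x" by (simp add: h_def lp_dist_def)
      have "pairing y b = pairing h b + pairing x b"
        using pairing_diff[OF yl xl b] by (simp add: h_def)
      then have "pairing y b - pairing x a - pairing h a - deriv (pairing x) a * (b - a) =
          (pairing h b - pairing h a) + (pairing x b - pairing x a - deriv (pairing x) a * (b - a))"
        by simp
      then have "cmod (pairing y b - pairing x a - pairing h a - deriv (pairing x) a * (b - a)) \<le>
          cmod (pairing h b - pairing h a) + cmod (pairing x b - pairing x a - deriv (pairing x) a * (b - a))"
        by (metis norm_triangle_ineq)
      also have "\<dots> \<le> 4 / (1 - cmod a) * lp_norm p h * cmod (b - a) + e * cmod (b - a)"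
        using ba by (intro add_mono pairing_Lipschitz h a b d) auto
      also have "\<dots> \<le> 4 / (1 - cmod a) * lp_norm p h * (e * (1 - cmod a) / 4) + e * cmod (b - a)"
        using ba a by (intro add_right_mono mult_left_mono mult_nonneg_nonneg lp_norm_nonneg) auto
      also have "\<dots> = e * (lp_dist p y x + cmod (b - a))"
        using a by (simp add: hN field_simps)
      finally show "cmod (pairing y b - pairing x a - pairing (\<lambda>j. y j - x j) a - deriv (pairing x) a * (b - a)) \<le> e * (lp_dist p y x + cmod (b - a))"
        by (simp add: h_def)
    qed
  qed
qed

text \<open>A product rule. The difference quotient splits into the pairing with
  \<open>q u - v\<close>, which tends to 0 because the functionals have norm at most 1, the pairing
  with the derivative \<open>v\<close>, and the scalar difference quotient of
  \<open>pairing (\<psi> z)\<close>.\<close>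

lemma pairing_along_disc_holomorphic:
  assumes D: "D \<subseteq> lp_space p" and \<psi>: "\<psi> \<in> hol_from_disc p D"
  shows "(\<lambda>z. pairing (\<psi> z) z) holomorphic_on ball 0 1"
proof (unfold holomorphic_on_open[OF open_ball], intro ballI)
  fix z :: complex assume "z \<in> ball 0 1"
  then have z: "cmod z < 1" by simp
  define q where "q u = (\<lambda>j. (\<psi> u j - \<psi> z j) / (u - z))" for u
  obtain v where v: "v \<in> lp_space p" and lim: "((\<lambda>u. lp_dist p (q u) v) \<longlongrightarrow> 0) (at z)"
    and ev: "eventually (\<lambda>u. q u \<in> lp_space p \<and> \<psi> u \<in> D \<and> u \<noteq> z \<and> cmod u < 1) (at z)"
    using hol_from_disc_tendsto[OF p \<psi> z D] unfolding q_def by blast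
  have \<psi>z: "\<psi> z \<in> lp_space p" using hol_from_disc_mem[OF \<psi> z] D by auto
  have d1: "((\<lambda>u. (pairing (\<psi> z) u - pairing (\<psi> z) z) / (u - z)) \<longlongrightarrow> deriv (pairing (\<psi> z)) z) (at z)"
    using holomorphic_derivI[OF pairing_holomorphic[OF \<psi>z] open_ball, of z] z
    by (simp add: has_field_derivative_iff)
  have "isCont (pairing v) z"
    using holomorphic_on_imp_continuous_on[OF pairing_holomorphic[OF v]] z
    by (auto simp: continuous_on_eq_continuous_at)
  then have d2: "((\<lambda>u. pairing v u) \<longlongrightarrow> pairing v z) (at z)" by (simp add: isCont_def)
  have d3: "((\<lambda>u. pairing (\<lambda>j. q u j - v j) u) \<longlongrightarrow> 0) (at z)"
  proof (rule Lim_null_comparison[OF _ lim])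
    show "eventually (\<lambda>u. norm (pairing (\<lambda>j. q u j - v j) u) \<le> lp_dist p (q u) v) (at z)"
      using ev by eventually_elim (auto simp: lp_dist_def intro!: pairing_norm lp_diff_mem[OF p _ v])
  qed
  have lim': "((\<lambda>u. pairing (\<lambda>j. q u j - v j) u + pairing v u + (pairing (\<psi> z) u - pairing (\<psi> z) z) / (u - z))
      \<longlongrightarrow> 0 + pairing v z + deriv (pairing (\<psi> z)) z) (at z)"
    by (intro tendsto_add d1 d2 d3)
  have "((\<lambda>u. (pairing (\<psi> u) u - pairing (\<psi> z) z) / (u - z)) \<longlongrightarrow> 0 + pairing v z + deriv (pairing (\<psi> z)) z) (at z)"
  proof (rule Lim_transform_eventually[OF lim'])
    show "eventually (\<lambda>u. pairing (\<lambda>j. q u j - v j) u + pairing v u + (pairing (\<psi> z) u - pairing (\<psi> z) z) / (u - z) =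
        (pairing (\<psi> u) u - pairing (\<psi> z) z) / (u - z)) (at z)"
      using ev
    proof eventually_elim
      case (elim u)
      then have u: "cmod u < 1" "u \<noteq> z" "q u \<in> lp_space p" "\<psi> u \<in> lp_space p" using D by auto
      have eq: "(\<lambda>j. \<psi> u j - \<psi> z j) = (\<lambda>j. (u - z) * q u j)" using u by (simp add: q_def)
      have "pairing (\<psi> u) u - pairing (\<psi> z) u = (u - z) * pairing (q u) u"
        using pairing_diff[OF u(4) \<psi>z u(1)] pairing_scale[OF u(3,1), of "u - z"] by (simp add: eq)
      then have "pairing (\<psi> u) u = (u - z) * pairing (q u) u + pairing (\<psi> z) u" by (simp add: algebra_simps)
      then show ?case using u pairing_diff[OF u(3) v u(1)] by (simp add: field_simps)
    qed
  qed
  then show "\<exists>d. ((\<lambda>z. pairing (\<psi> z) z) has_field_derivative d) (at z)"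
    unfolding has_field_derivative_iff by blast
qed

end

section \<open>Geodesics from dual discs\<close>

lemma mob_near_boundary:
  assumes a: "cmod a < 1" and t: "t < 1"
  obtains r where "r < 1" "\<And>z. r < cmod z \<Longrightarrow> cmod z < 1 \<Longrightarrow> t < cmod (mob a z)"
proof -
  define t' where "t' = max t 0"
  have t': "0 \<le> t'" "t' < 1" "t \<le> t'" using t by (auto simp: t'_def)
  \<comment> \<open>From \<open>mob_norm_sq\<close> with 1 - |z|^2 \<le> 2 (1 - |z|) and |1 -
    \<open>cnj a * z\<close>| \<ge> 1 - |a|.\<close>
  define r where "r = 1 - (1 - t'\<^sup>2) * (1 - cmod a)\<^sup>2 / 2"
  have t2: "t'\<^sup>2 < 1" using t' by (simp add: power_less_one_iff)
  have "t < cmod (mob a z)" if z: "r < cmod z" "cmod z < 1" for z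
  proof -
    have az: "cmod a * cmod z < 1" using a z by (intro norm_mult_less_1) auto
    have "cmod a * cmod z \<le> cmod a * 1" using z by (intro mult_left_mono) auto
    then have d: "1 - cmod a \<le> cmod (1 - cnj a * z)"
      using norm_triangle_ineq2[of 1 "cnj a * z"] by (simp add: norm_mult)
    have "1 - (cmod z)\<^sup>2 = (1 - cmod z) * (1 + cmod z)" by (simp add: power2_eq_square algebra_simps)
    also have "\<dots> \<le> (1 - cmod z) * 2" using z by (intro mult_left_mono) auto
    also have "\<dots> < (1 - t'\<^sup>2) * (1 - cmod a)\<^sup>2" using z by (simp add: r_def)
    finally have 1: "1 - (cmod z)\<^sup>2 < (1 - t'\<^sup>2) * (1 - cmod a)\<^sup>2" .
    have nz: "1 - cnj a * z \<noteq> 0" using one_minus_cnj_nonzero[OF az] .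
    have z2: "0 \<le> 1 - (cmod z)\<^sup>2" using z by (simp add: power_le_one)
    have "1 - (cmod (mob a z))\<^sup>2 = (1 - (cmod a)\<^sup>2) * (1 - (cmod z)\<^sup>2) / (cmod (1 - cnj a * z))\<^sup>2"
      by (rule mob_norm_sq[OF nz])
    also have "\<dots> \<le> 1 * (1 - (cmod z)\<^sup>2) / (1 - cmod a)\<^sup>2"
      using a z2 d by (intro frac_le mult_right_mono power_mono mult_nonneg_nonneg) (auto simp: power_le_one)
    also have "\<dots> < 1 - t'\<^sup>2" using 1 a by (simp add: pos_divide_less_eq)
    finally have "t'\<^sup>2 < (cmod (mob a z))\<^sup>2" by simp
    then have "t' < cmod (mob a z)" using power2_less_imp_less norm_ge_zero by blast
    then show ?thesis using t' by simp
  qed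
  moreover have "r < 1" using t2 a by (simp add: r_def)
  ultimately show thesis using that by blast
qed

text \<open>Stability in Re b \<le> |b|, from the factorization (Im b)^2 = (|b| - Re b) (|b| + Re
  b).\<close>

lemma abs_Im_le_sqrt:
  assumes "cmod b - Re b \<le> d" "cmod b \<le> 1"
  shows "\<bar>Im b\<bar> \<le> sqrt (2 * d)"
proof -
  have R: "0 \<le> cmod b - Re b" "cmod b + Re b \<le> 2"
    using complex_Re_le_cmod[of b] abs_Re_le_cmod[of b] assms by linarith+
  have R': "0 \<le> cmod b + Re b" using abs_Re_le_cmod[of b] by linarith
  have "(Im b)\<^sup>2 = (cmod b - Re b) * (cmod b + Re b)"
    using cmod_power2[of b] by (simp add: power2_eq_square algebra_simps)
  also have "\<dots> \<le> d * 2" using R R' assms by (intro mult_mono) auto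
  finally show ?thesis by (intro real_le_rsqrt) simp
qed

lemma lp_holomorphic_on_coordinate:
  assumes p: "1 \<le> p" and D: "D \<subseteq> lp_space p"
  shows "lp_holomorphic_on p D (\<lambda>x. x j)"
proof -
  have "lp_functional p (\<lambda>x. x j)"
    unfolding lp_functional_def using lp_norm_coordinate[OF p] by (auto intro!: exI[of _ 1])
  then show ?thesis
    unfolding lp_holomorphic_on_def
    by (intro ballI exI[of _ "\<lambda>x. x j"]) (auto simp: lp_dist_def lp_norm_nonneg intro: exI[of _ 1])
qed

lemma poincare_dist_mob: "poincare_dist z w = artanh (cmod (mob w z))"
  by (simp add: poincare_dist_def mob_def)

lemma artanh_real_le:
  fixes x y :: real
  assumes "0 \<le> x" "x \<le> y" "y < 1"
  shows "artanh x \<le> artanh y"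
proof -
  have "(1 + x) / (1 - x) \<le> (1 + y) / (1 - y)" using assms by (intro frac_le) auto
  moreover have "0 < (1 + x) / (1 - x)" using assms by (intro divide_pos_pos) auto
  ultimately show ?thesis by (simp add: artanh_def)
qed

section \<open>Discs with a dual disc are geodesics\<close>

locale dual_pair = disc_functionals +
  fixes \<phi> :: "complex \<Rightarrow> nat \<Rightarrow> complex" and \<gamma> :: complex
  assumes \<gamma>: "cmod \<gamma> < 1"
    and \<phi>: "\<phi> \<in> hol_from_disc p (lp_ball p)"
    and pairing_\<phi>: "\<And>z. cmod z < 1 \<Longrightarrow> pairing (\<phi> z) z = mob \<gamma> z"
begin

lemma ball_lp_norm: "x \<in> lp_ball p \<Longrightarrow> lp_norm p x < 1" "x \<in> lp_ball p \<Longrightarrow> x \<in> lp_space p"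
  by (auto simp: lp_ball_def)

definition step :: "(nat \<Rightarrow> complex) \<Rightarrow> complex \<Rightarrow> complex" where
  "step x z = mob (- \<gamma>) (pairing x z)"

lemma pairing_less_1:
  assumes "x \<in> lp_ball p" "cmod z < 1"
  shows "cmod (pairing x z) < 1"
  using pairing_norm[OF ball_lp_norm(2)[OF assms(1)] assms(2)] ball_lp_norm(1)[OF assms(1)] by linarith

lemma step_less_1:
  assumes "x \<in> lp_ball p" "cmod z < 1"
  shows "cmod (step x z) < 1"
  unfolding step_def using \<gamma> pairing_less_1[OF assms] by (intro mob_less_1) auto

text \<open>In each step the pairing is evaluated at the previous iterate, a point that itself
  depends on \<open>x\<close>; this is the reason for the joint chain rule.\<close>

lemma iterates_mem: "(\<lambda>x. (step x ^^ n) 0) \<in> hol_to_disc p (lp_ball p)"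
proof (induction n)
  case 0
  then show ?case by (auto simp: hol_to_disc_def lp_holomorphic_on_const)
next
  case (Suc n)
  define g where "g x = (step x ^^ n) 0" for x
  have g: "lp_holomorphic_on p (lp_ball p) g" "\<And>x. x \<in> lp_ball p \<Longrightarrow> cmod (g x) < 1"
    using Suc by (auto simp: hol_to_disc_def g_def[abs_def])
  have "lp_holomorphic_on p (lp_ball p) (\<lambda>x. pairing x (g x))"
    using g by (intro lp_holomorphic_on_pairing lp_ball_subset) auto
  then have "lp_holomorphic_on p (lp_ball p) (\<lambda>x. step x (g x))"
    unfolding step_def using \<gamma> g pairing_less_1
    by (intro lp_holomorphic_on_compose[OF p lp_ball_subset _ open_ball _ holomorphic_on_mob]) auto
  moreover have "(\<lambda>x. (step x ^^ Suc n) 0) = (\<lambda>x. step x (g x))" by (simp add: g_def)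
  ultimately show ?case using step_less_1 g(2) by (auto simp: hol_to_disc_def)
qed

text \<open>Since \<open>\<phi> u\<close> has norm below 1, its pairings stay in a smaller closed
  disc, and \<open>step (\<phi> u)\<close> maps the disc into one of radius less than 1. Hence the
  iterates converge to the fixed point \<open>u\<close>.\<close>

lemma iterates_tendsto:
  assumes u: "cmod u < 1"
  shows "(\<lambda>n. (step (\<phi> u) ^^ n) 0) \<longlonglongrightarrow> u"
proof -
  have x: "\<phi> u \<in> lp_ball p" using hol_from_disc_mem[OF \<phi> u] .
  obtain q where q: "0 < q" "q < 1" "\<And>z. cmod z \<le> lp_norm p (\<phi> u) \<Longrightarrow> cmod (mob (- \<gamma>) z) < q"
    using mob_norm_bound[of "- \<gamma>" "lp_norm p (\<phi> u)"] \<gamma> ball_lp_norm[OF x] by auto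
  show ?thesis
  proof (rule iterates_tendsto_fixed_point[OF _ _ q(2) u])
    show "step (\<phi> u) holomorphic_on ball 0 1"
      unfolding step_def[abs_def] using \<gamma> x pairing_less_1 ball_lp_norm
      by (intro holomorphic_on_mob_compose pairing_holomorphic) auto
    show "cmod (step (\<phi> u) z) \<le> q" if "cmod z < 1" for z
      unfolding step_def using q(3)[OF pairing_norm[OF ball_lp_norm(2)[OF x] that]] by simp
    show "step (\<phi> u) u = u" by (simp add: step_def pairing_\<phi> u mob_mob_uminus \<gamma>)
  qed
qed

text \<open>Schwarz-Pick along \<phi> gives the upper bound, and with it the boundedness without
  which the real supremum would mean nothing. For the lower bound the iterates serve as competitors,
  whose distances converge to the Poincare distance.\<close>

theorem complex_geodesic: "complex_geodesic p (lp_ball p) \<phi>"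
proof -
  have "poincare_dist u v = caratheodory_dist p (lp_ball p) (\<phi> u) (\<phi> v)"
    if u: "cmod u < 1" and v: "cmod v < 1" for u v
  proof -
    have le: "poincare_dist (f (\<phi> u)) (f (\<phi> v)) \<le> poincare_dist u v" if f: "f \<in> hol_to_disc p (lp_ball p)" for f
    proof -
      have 1: "cmod (f (\<phi> z)) < 1" if "cmod z < 1" for z
        using f hol_from_disc_mem[OF \<phi> that] by (auto simp: hol_to_disc_def)
      have "(\<lambda>z. f (\<phi> z)) holomorphic_on ball 0 1"
        using f by (intro holomorphic_on_lp_compose[OF p lp_ball_subset _ \<phi>]) (auto simp: hol_to_disc_def)
      then have "cmod (mob (f (\<phi> v)) (f (\<phi> u))) \<le> cmod (mob v u)"
        using 1 u v by (intro Schwarz_Pick[of "\<lambda>z. f (\<phi> z)"])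
      then show ?thesis unfolding poincare_dist_mob
        using mob_less_1[OF v u] by (intro artanh_real_le) auto
    qed
    have bdd: "bdd_above ((\<lambda>f. poincare_dist (f (\<phi> u)) (f (\<phi> v))) ` hol_to_disc p (lp_ball p))"
      using le by (intro bdd_aboveI2)
    define f where "f n x = (step x ^^ n) 0" for n x
    have f: "f n \<in> hol_to_disc p (lp_ball p)" for n
      using iterates_mem[of n] by (simp add: f_def[abs_def])
    have "cmod v * cmod u < 1" using u v by (intro norm_mult_less_1) auto
    then have nz: "1 - cnj v * u \<noteq> 0" by (rule one_minus_cnj_nonzero)
    have "(\<lambda>n. poincare_dist (f n (\<phi> u)) (f n (\<phi> v))) \<longlonglongrightarrow> poincare_dist u v"
      unfolding poincare_dist_def f_def using mob_less_1[OF v u] nz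
      by (intro tendsto_intros iterates_tendsto u v) (auto simp: mob_def intro: less_le_trans[OF _ norm_ge_zero])
    moreover have "poincare_dist (f n (\<phi> u)) (f n (\<phi> v)) \<le> caratheodory_dist p (lp_ball p) (\<phi> u) (\<phi> v)" for n
      unfolding caratheodory_dist_def by (rule cSUP_upper[OF f bdd])
    ultimately have "poincare_dist u v \<le> caratheodory_dist p (lp_ball p) (\<phi> u) (\<phi> v)"
      by (intro LIMSEQ_le_const2) auto
    moreover have "caratheodory_dist p (lp_ball p) (\<phi> u) (\<phi> v) \<le> poincare_dist u v"
      unfolding caratheodory_dist_def using f le by (intro cSUP_least) auto
    ultimately show ?thesis by simp
  qed
  then show ?thesis by (simp add: complex_geodesic_def \<phi>)
qed

section \<open>Uniqueness from near equality in Hoelder's inequality\<close>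

lemma Im_pairing_term:
  assumes x: "x \<in> lp_ball p" and z: "cmod z < 1" and m: "pairing x z = mob \<gamma> z"
  shows "\<bar>Im (x j * k j z * cnj (mob \<gamma> z))\<bar> \<le> sqrt (2 * (1 - cmod (mob \<gamma> z)))"
    and "cmod (x j * k j z) \<le> 1"
proof -
  have xl: "x \<in> lp_space p" using ball_lp_norm x by auto
  define a where "a i = x i * k i z" for i
  define \<mu> where "\<mu> = mob \<gamma> z"
  have \<mu>: "cmod \<mu> < 1" unfolding \<mu>_def by (rule mob_less_1[OF \<gamma> z])
  have sa: "summable (\<lambda>i. cmod (a i))" "(\<Sum>i. cmod (a i)) \<le> 1"
    using pairing_norm_le[OF xl z] ball_lp_norm(1)[OF x] by (auto simp: a_def)
  have "a sums \<mu>" unfolding a_def \<mu>_def m[symmetric] pairing_def by (intro summable_sums pairing_summable xl z)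
  then have "(\<lambda>i. Re (a i * cnj \<mu>)) sums Re (\<mu> * cnj \<mu>)"
    by (intro sums_Re sums_mult2)
  then have s2: "(\<lambda>i. Re (a i * cnj \<mu>)) sums (cmod \<mu>)\<^sup>2"
    by (simp add: complex_mult_cnj cmod_power2)
  \<comment> \<open>The deficits \<open>t i\<close> are non-negative and their sum is at most
    |\<mu>| (1 - |\<mu>|). So every single one is small when \<mu> is close to the circle, which
    almost aligns each term with \<mu>.\<close>
  define t where "t i = cmod (a i) * cmod \<mu> - Re (a i * cnj \<mu>)" for i
  have t: "t sums ((\<Sum>i. cmod (a i)) * cmod \<mu> - (cmod \<mu>)\<^sup>2)"
    unfolding t_def by (intro sums_diff s2 sums_mult2 summable_sums sa)
  have t0: "0 \<le> t i" for i
    using complex_Re_le_cmod[of "a i * cnj \<mu>"] by (simp add: t_def norm_mult)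
  have "t j \<le> (\<Sum>i. cmod (a i)) * cmod \<mu> - (cmod \<mu>)\<^sup>2"
    using sum_le_suminf[of t "{j}"] t t0 by (auto simp: sums_iff)
  also have "\<dots> \<le> 1 * cmod \<mu> - (cmod \<mu>)\<^sup>2" using sa by (intro diff_right_mono mult_right_mono) auto
  also have "\<dots> = cmod \<mu> * (1 - cmod \<mu>)" by (simp add: power2_eq_square algebra_simps)
  also have "\<dots> \<le> 1 * (1 - cmod \<mu>)" using \<mu> by (intro mult_right_mono) auto
  finally have tj: "t j \<le> 1 - cmod \<mu>" by simp
  have aj: "cmod (a j) \<le> 1"
    using sum_le_suminf[of "\<lambda>i. cmod (a i)" "{j}"] sa by auto
  then show "cmod (x j * k j z) \<le> 1" by (simp add: a_def)
  have "cmod (a j * cnj \<mu>) \<le> 1 * 1" unfolding norm_mult using aj \<mu> by (intro mult_mono) auto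
  then show "\<bar>Im (x j * k j z * cnj (mob \<gamma> z))\<bar> \<le> sqrt (2 * (1 - cmod (mob \<gamma> z)))"
    using tj by (intro abs_Im_le_sqrt) (auto simp: t_def norm_mult a_def \<mu>_def)
qed

context
  fixes \<psi> :: "complex \<Rightarrow> nat \<Rightarrow> complex" and s :: complex
  assumes \<psi>: "\<psi> \<in> hol_from_disc p (lp_ball p)" and s: "s \<noteq> 0" "cmod s < 1"
    and \<psi>_0: "\<psi> 0 = \<phi> 0" and \<psi>_s: "\<psi> s = \<phi> s"
begin

lemma pairing_\<psi>:
  assumes z: "cmod z < 1"
  shows "pairing (\<psi> z) z = mob \<gamma> z"
proof (rule Schwarz_Pick_unique[OF _ _ \<gamma> _ s(2,1) _ z])
  show "(\<lambda>z. pairing (\<psi> z) z) holomorphic_on ball 0 1"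
    by (rule pairing_along_disc_holomorphic[OF lp_ball_subset \<psi>])
  show "cmod (pairing (\<psi> z) z) < 1" if "cmod z < 1" for z
    using pairing_less_1[OF hol_from_disc_mem[OF \<psi> that] that] .
  show "pairing (\<psi> 0) 0 = mob \<gamma> 0" "pairing (\<psi> s) s = mob \<gamma> s"
    using pairing_\<phi>[of 0] pairing_\<phi>[OF s(2)] by (simp_all add: \<psi>_0 \<psi>_s)
qed

lemma coordinate_holomorphic:
  "(\<lambda>z. \<psi> z j) holomorphic_on ball 0 1" "(\<lambda>z. \<phi> z j) holomorphic_on ball 0 1"
  using holomorphic_on_lp_compose[OF p lp_ball_subset lp_holomorphic_on_coordinate[OF p lp_ball_subset]] \<psi> \<phi> by auto

text \<open>
  On the unit circle the terms \<open>\<psi>\<^sub>j k\<^sub>j\<close> of the pairing are non-negative multiples of the sum \<open>mob \<gamma>\<close>, and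
  there \<open>\<bar>1 - cnj \<gamma> * z\<bar>\<^sup>2 * cnj (mob \<gamma> z) = (1 - cnj \<gamma> * z)\<^sup>2 / z\<close>. So the holomorphic function
  \<open>(\<psi>\<^sub>j - \<phi>\<^sub>j) k\<^sub>j (1 - cnj \<gamma> * z)\<^sup>2 / z\<close> has real boundary values, hence it is constant.
\<close>

lemma difference_times_functional:
  assumes z: "cmod z < 1"
  shows "(\<psi> z j - \<phi> z j) * k j z = 0"
proof -
  define E where "E z = (\<psi> z j - \<phi> z j) * k j z * (1 - cnj \<gamma> * z)\<^sup>2" for z
  have holE: "E holomorphic_on ball 0 1"
    unfolding E_def by (intro holomorphic_intros coordinate_holomorphic k_holomorphic)
  have E0: "E 0 = 0" by (simp add: E_def \<psi>_0)
  \<comment> \<open>Agreement at 0 permits the division by \<open>z\<close>; agreement at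
    \<open>s\<close> later shows that the constant is 0.\<close>
  obtain F where F: "F holomorphic_on ball 0 1" "\<And>z. cmod z < 1 \<Longrightarrow> E z = z * F z"
    using Schwarz3[OF holE E0] by blast
  have "\<bar>Im (F z)\<bar> \<le> 8 * sqrt (2 * (1 - cmod (mob \<gamma> z))) + 16 * (1 - cmod z)"
    if z: "cmod z < 1" and z2: "1 / 2 < cmod z" for z
  proof -
    define d where "d = (\<psi> z j - \<phi> z j) * k j z"
    define \<sigma> where "\<sigma> = sqrt (2 * (1 - cmod (mob \<gamma> z)))"
    have \<sigma>: "0 \<le> \<sigma>" using mob_less_1[OF \<gamma> z] by (simp add: \<sigma>_def)
    note I\<psi> = Im_pairing_term[OF hol_from_disc_mem[OF \<psi> z] z pairing_\<psi>[OF z], of j]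
    note I\<phi> = Im_pairing_term[OF hol_from_disc_mem[OF \<phi> z] z pairing_\<phi>[OF z], of j]
    have dI: "\<bar>Im (d * cnj (mob \<gamma> z))\<bar> \<le> 2 * \<sigma>"
    proof -
      have "Im (d * cnj (mob \<gamma> z)) = Im (\<psi> z j * k j z * cnj (mob \<gamma> z)) - Im (\<phi> z j * k j z * cnj (mob \<gamma> z))"
        unfolding d_def by (simp only: left_diff_distrib minus_complex.sel)
      then show ?thesis using I\<psi>(1) I\<phi>(1) unfolding \<sigma>_def by linarith
    qed
    have d2: "cmod d \<le> 2"
      using norm_triangle_ineq4[of "\<psi> z j * k j z" "\<phi> z j * k j z"] I\<psi>(2) I\<phi>(2) by (simp add: d_def left_diff_distrib)
    have z0: "z \<noteq> 0" using z2 by auto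
    have gz: "cmod \<gamma> * cmod z < 1" using \<gamma> z by (intro norm_mult_less_1) auto
    have nz: "1 - cnj \<gamma> * z \<noteq> 0" using one_minus_cnj_nonzero[OF gz] .
    define n where "n = 1 - cnj \<gamma> * z"
    have n0: "n \<noteq> 0" using nz by (simp add: n_def)
    have n2: "cmod n \<le> 2"
      using norm_triangle_ineq4[of 1 "cnj \<gamma> * z"] gz by (simp add: n_def norm_mult)
    have cn: "cnj n = 1 - \<gamma> * cnj z" by (simp add: n_def)
    have "F z = d * n\<^sup>2 / z" using F(2)[OF z] z0 by (simp add: E_def d_def n_def)
    \<comment> \<open>On the circle 1 / z equals \<open>cnj z\<close>. The first summand is the part
      that becomes real in the limit, the second is the error made inside the disc.\<close>
    also have "\<dots> = d * n * (cnj z - cnj \<gamma>) + d * n * (1 / z - cnj z)"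
      using z0 by (simp add: n_def power2_eq_square field_simps)
    also have "d * n * (cnj z - cnj \<gamma>) = of_real ((cmod n)\<^sup>2) * (d * cnj (mob \<gamma> z))"
      unfolding complex_norm_square using n0 by (simp add: mob_def cn[symmetric] flip: n_def)
    finally have "Im (F z) = (cmod n)\<^sup>2 * Im (d * cnj (mob \<gamma> z)) + Im (d * n * (1 / z - cnj z))"
      by simp
    then have "\<bar>Im (F z)\<bar> \<le> (cmod n)\<^sup>2 * \<bar>Im (d * cnj (mob \<gamma> z))\<bar> + \<bar>Im (d * n * (1 / z - cnj z))\<bar>"
      by (metis abs_mult abs_power2 abs_triangle_ineq)
    also have "\<dots> \<le> 2\<^sup>2 * (2 * \<sigma>) + cmod (d * n * (1 / z - cnj z))"
      using dI n2 by (intro add_mono mult_mono power_mono abs_Im_le_cmod) auto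
    also have "cmod (d * n * (1 / z - cnj z)) \<le> 2 * 2 * (4 * (1 - cmod z))"
    proof -
      have "1 / z - cnj z = of_real (1 - (cmod z)\<^sup>2) / z"
        using z0 complex_norm_square[of z] by (simp add: field_simps)
      then have "cmod (1 / z - cnj z) = \<bar>1 - (cmod z)\<^sup>2\<bar> / cmod z"
        by (simp only: norm_divide norm_of_real)
      also have "\<dots> = (1 - cmod z) * (1 + cmod z) / cmod z"
        using z by (simp add: power2_eq_square algebra_simps abs_mult_less mult_le_one)
      also have "\<dots> \<le> (1 - cmod z) * 2 / (1 / 2)"
        using z z2 by (intro frac_le mult_left_mono) auto
      finally have "cmod (1 / z - cnj z) \<le> 4 * (1 - cmod z)" by simp
      then show ?thesis unfolding norm_mult using d2 n2 z by (intro mult_mono) auto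
    qed
    finally show ?thesis by (simp add: \<sigma>_def)
  qed
  note ImF = this
  have "F constant_on ball 0 1"
  proof (rule holomorphic_constant_if_boundary_real[OF F(1)])
    fix e :: real assume e: "e > 0"
    \<comment> \<open>Chosen so that 2 (1 - |\<open>mob \<gamma> z\<close>|) \<le> (e / 16)^2,
      whence the first term of \<open>ImF\<close> is at most \<open>e / 2\<close>; the entry
      \<open>1 - e / 32\<close> of \<open>R\<close> does the same for the second term.\<close>
    define t where "t = 1 - e\<^sup>2 / 512"
    have "t < 1" using e by (simp add: t_def)
    then obtain r where r: "r < 1" "\<And>z. r < cmod z \<Longrightarrow> cmod z < 1 \<Longrightarrow> t < cmod (mob \<gamma> z)"
      using mob_near_boundary[OF \<gamma>] by blast
    define R where "R = max r (max (1 / 2) (1 - e / 32))"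
    have "\<bar>Im (F z)\<bar> \<le> e" if z: "R < cmod z" "cmod z < 1" for z
    proof -
      have "t < cmod (mob \<gamma> z)" using r z by (auto simp: R_def)
      then have "2 * (1 - cmod (mob \<gamma> z)) \<le> (e / 16)\<^sup>2" by (simp add: t_def power_divide)
      then have "sqrt (2 * (1 - cmod (mob \<gamma> z))) \<le> e / 16" using e by (intro real_le_lsqrt) auto
      moreover have "\<bar>Im (F z)\<bar> \<le> 8 * sqrt (2 * (1 - cmod (mob \<gamma> z))) + 16 * (1 - cmod z)"
        using z by (intro ImF) (auto simp: R_def)
      moreover have "16 * (1 - cmod z) \<le> e / 2" using z by (auto simp: R_def)
      ultimately show ?thesis by linarith
    qed
    moreover have "R < 1" using r e by (simp add: R_def)
    ultimately show "\<exists>r<1. \<forall>z. r < cmod z \<and> cmod z < 1 \<longrightarrow> \<bar>Im (F z)\<bar> \<le> e" by blast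
  qed
  moreover have "F s = 0"
  proof -
    have "E s = 0" by (simp add: E_def \<psi>_s)
    then show ?thesis using F(2)[OF s(2)] s by simp
  qed
  ultimately have "F z = 0" using z s unfolding constant_on_def by (metis mem_ball_0)
  then have "E z = 0" using F(2)[OF z] by simp
  moreover have "1 - cnj \<gamma> * z \<noteq> 0" using \<gamma> z by (intro one_minus_cnj_nonzero norm_mult_less_1) auto
  ultimately show ?thesis by (simp add: E_def)
qed

text \<open>The functional may vanish at one point, the zero of its Moebius factor; continuity of
  the difference fills in that value.\<close>

lemma unique_coordinate:
  assumes a: "\<And>z. cmod z < 1 \<Longrightarrow> z \<noteq> a \<Longrightarrow> k j z \<noteq> 0" and z: "cmod z < 1"
  shows "\<psi> z j = \<phi> z j"
proof (cases "z = a")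
  case False
  then show ?thesis using difference_times_functional[OF z, of j] a[OF z] by simp
next
  case True
  define g where "g z = \<psi> z j - \<phi> z j" for z
  have "g holomorphic_on ball 0 1" unfolding g_def by (intro holomorphic_intros coordinate_holomorphic)
  then have "isCont g a" using z True holomorphic_on_imp_continuous_on[of g "ball 0 1"]
    by (auto simp: continuous_on_eq_continuous_at)
  then have "(g \<longlongrightarrow> g a) (at a)" by (simp add: isCont_def)
  moreover have "(g \<longlongrightarrow> 0) (at a)"
  proof (rule tendsto_eventually)
    have "eventually (\<lambda>u. u \<in> ball 0 1 - {a}) (at a)"
      using eventually_at_in_open[of "ball 0 1" a] z True by simp
    then show "eventually (\<lambda>u. g u = 0) (at a)"
    proof eventually_elim
      case (elim u)
      then have "cmod u < 1" "u \<noteq> a" by auto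
      then show ?case using difference_times_functional[of u j] a[of u] by (simp add: g_def)
    qed
  qed
  ultimately have "g a = 0" by (rule tendsto_unique[rotated]) simp
  then show ?thesis using True by (simp add: g_def)
qed

text \<open>Coordinates whose functional vanishes are invisible to the pairing. There \<phi> is 0,
  so a non-zero coordinate of \<psi> would add to the norm of \<phi>, which is at least
  |\<open>mob \<gamma> u\<close>| and tends to 1 at the circle. Hence that coordinate of \<psi> has
  null boundary values.\<close>

theorem unique:
  assumes k: "\<And>j. (\<forall>z. cmod z < 1 \<longrightarrow> \<phi> z j = 0) \<or> (\<exists>a. \<forall>z. cmod z < 1 \<longrightarrow> z \<noteq> a \<longrightarrow> k j z \<noteq> 0)"
    and z: "cmod z < 1"
  shows "\<psi> z = \<phi> z"
proof
  fix j
  show "\<psi> z j = \<phi> z j"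
  proof (cases "\<exists>a. \<forall>z. cmod z < 1 \<longrightarrow> z \<noteq> a \<longrightarrow> k j z \<noteq> 0")
    case True
    then show ?thesis using unique_coordinate z by blast
  next
    case False
    then have \<phi>j: "\<phi> u j = 0" if "cmod u < 1" for u using k that by blast
    have le: "cmod (\<psi> u j) powr p + cmod (mob \<gamma> u) powr p \<le> 1" if u: "cmod u < 1" for u
    proof -
      have \<psi>u: "\<psi> u \<in> lp_ball p" and \<phi>u: "\<phi> u \<in> lp_ball p" using hol_from_disc_mem \<psi> \<phi> u by auto
      \<comment> \<open>Wherever the functional is non-zero the two coordinates agree, and elsewhere
        \<phi> vanishes; thus \<psi> dominates \<phi> and has its j-th coordinate to spare.\<close>
      have tm: "cmod (\<phi> u i) powr p + (if i = j then cmod (\<psi> u j) powr p else 0) \<le> cmod (\<psi> u i) powr p" for i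
      proof (cases "\<exists>a. \<forall>z. cmod z < 1 \<longrightarrow> z \<noteq> a \<longrightarrow> k i z \<noteq> 0")
        case True
        then have "\<psi> u i = \<phi> u i" using unique_coordinate u by blast
        then show ?thesis using \<phi>j[OF u] by auto
      next
        case False
        then have "\<phi> u i = 0" using k u by blast
        then show ?thesis by simp
      qed
      have s\<phi>: "(\<lambda>i. cmod (\<phi> u i) powr p) sums (lp_norm p (\<phi> u) powr p)"
        using ball_lp_norm[OF \<phi>u] lp_norm_powr[OF p] by (simp add: lp_space_def summable_sums)
      have s\<psi>: "(\<lambda>i. cmod (\<psi> u i) powr p) sums (lp_norm p (\<psi> u) powr p)"
        using ball_lp_norm[OF \<psi>u] lp_norm_powr[OF p] by (simp add: lp_space_def summable_sums)
      have "lp_norm p (\<phi> u) powr p + cmod (\<psi> u j) powr p \<le> lp_norm p (\<psi> u) powr p"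
        by (rule sums_le[OF tm sums_add[OF s\<phi> sums_single] s\<psi>])
      also have "\<dots> \<le> 1 powr p"
        using ball_lp_norm(1)[OF \<psi>u] p by (intro powr_mono2) (auto simp: lp_norm_nonneg)
      finally have 1: "lp_norm p (\<phi> u) powr p + cmod (\<psi> u j) powr p \<le> 1" by simp
      have "cmod (mob \<gamma> u) \<le> lp_norm p (\<phi> u)"
        using pairing_norm[OF ball_lp_norm(2)[OF \<phi>u] u] pairing_\<phi>[OF u] by simp
      then have "cmod (mob \<gamma> u) powr p \<le> lp_norm p (\<phi> u) powr p" using p by (intro powr_mono2) auto
      with 1 show ?thesis by linarith
    qed
    have "\<psi> z j = 0"
    proof (rule holomorphic_eq_0_if_boundary_null[OF coordinate_holomorphic(1) z])
      fix e' :: real assume "e' > 0"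
      \<comment> \<open>The cap 1/2 keeps \<open>e powr p\<close> below 1, so that there is
        \<open>t\<close> with \<open>t powr p + e powr p = 1\<close>.\<close>
      define e where "e = min e' (1 / 2)"
      have e: "0 < e" "e < 1" "e \<le> e'" using \<open>e' > 0\<close> by (auto simp: e_def)
      have ep: "0 < e powr p" "e powr p < 1" using e p powr_less_mono2[of p e 1] by auto
      define t where "t = (1 - e powr p) powr (1 / p)"
      have tp: "t powr p = 1 - e powr p" using ep p by (simp add: t_def powr_powr)
      have "t < 1" using ep p powr_less_mono2[of "1 / p" "1 - e powr p" 1] by (simp add: t_def)
      then obtain r where r: "r < 1" "\<And>z. r < cmod z \<Longrightarrow> cmod z < 1 \<Longrightarrow> t < cmod (mob \<gamma> z)"
        using mob_near_boundary[OF \<gamma>] by blast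
      have "cmod (\<psi> u j) \<le> e'" if "r < cmod u" "cmod u < 1" for u
      proof -
        have "t powr p \<le> cmod (mob \<gamma> u) powr p"
          using r(2)[OF that] p by (intro powr_mono2) (auto simp: t_def)
        then have "cmod (\<psi> u j) powr p \<le> e powr p" using le[OF that(2)] tp by linarith
        then show ?thesis using e p by (simp add: powr_le_powr_iff)
      qed
      with r(1) show "\<exists>r<1. \<forall>u. r < cmod u \<and> cmod u < 1 \<longrightarrow> cmod (\<psi> u j) \<le> e'" by blast
    qed
    then show ?thesis using \<phi>j[OF z] by simp
  qed
qed

end

end

section \<open>Extremal discs\<close>

lemma norm_powr_of_real: "cmod (z powr of_real r) = cmod z powr r"
  by (simp add: norm_powr_complex)

lemma not_nonpos_Reals_if_Re_pos: "0 < Re u \<Longrightarrow> u \<notin> \<real>\<^sub>\<le>\<^sub>0"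
  by (auto simp: complex_nonpos_Reals_iff)

lemma artanh_real_eq_iff:
  fixes x y :: real
  assumes "0 \<le> x" "x < 1" "0 \<le> y" "y < 1"
  shows "artanh x = artanh y \<longleftrightarrow> x = y"
proof
  assume "artanh x = artanh y"
  moreover have "0 < (1 + x) / (1 - x)" "0 < (1 + y) / (1 - y)" using assms by (intro divide_pos_pos; simp)+
  ultimately have "(1 + x) / (1 - x) = (1 + y) / (1 - y)" by (simp add: artanh_def)
  then show "x = y" using assms by (simp add: field_simps)
qed simp

definition extremal_disc ::
    "real \<Rightarrow> complex \<Rightarrow> (nat \<Rightarrow> complex) \<Rightarrow> (nat \<Rightarrow> complex) \<Rightarrow> (nat \<Rightarrow> nat) \<Rightarrow> complex \<Rightarrow> nat \<Rightarrow> complex" where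
  "extremal_disc p \<gamma> \<alpha> c \<beta> \<zeta> j =
     c j * ((\<zeta> - \<alpha> j) / (1 - cnj (\<alpha> j) * \<zeta>)) ^ \<beta> j *
     ((1 - cnj (\<alpha> j) * \<zeta>) powr complex_of_real (2 / p) / (1 - cnj \<gamma> * \<zeta>) powr complex_of_real (2 / p))"

text \<open>The boundary values are the functionals supporting the ball at the boundary values of the disc, up to a scalar.\<close>

definition dual_disc ::
    "real \<Rightarrow> complex \<Rightarrow> (nat \<Rightarrow> complex) \<Rightarrow> (nat \<Rightarrow> complex) \<Rightarrow> (nat \<Rightarrow> nat) \<Rightarrow> nat \<Rightarrow> complex \<Rightarrow> complex" where
  "dual_disc p \<gamma> \<alpha> c \<beta> j \<zeta> =
     complex_of_real (cmod (c j) powr p) / c j * mob (\<alpha> j) \<zeta> ^ (1 - \<beta> j) *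
     ((1 - cnj (\<alpha> j) * \<zeta>) powr complex_of_real (2 - 2 / p) / (1 - cnj \<gamma> * \<zeta>) powr complex_of_real (2 - 2 / p))"

text \<open>The p-th power of the modulus of the j-th coordinate when \<open>\<beta> j = 0\<close>.
  For \<open>p > 1\<close> its power \<open>1 - 1 / p\<close> also bounds the dual coordinate, so
  the weights link both sides of Hoelder's inequality.\<close>

definition disc_weight ::
    "real \<Rightarrow> complex \<Rightarrow> (nat \<Rightarrow> complex) \<Rightarrow> (nat \<Rightarrow> complex) \<Rightarrow> nat \<Rightarrow> complex \<Rightarrow> real" where
  "disc_weight p \<gamma> \<alpha> c j \<zeta> = cmod (c j) powr p * (cmod (1 - cnj (\<alpha> j) * \<zeta>) / cmod (1 - cnj \<gamma> * \<zeta>))\<^sup>2"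

definition disc_bound :: "real \<Rightarrow> complex \<Rightarrow> (nat \<Rightarrow> complex) \<Rightarrow> nat \<Rightarrow> real" where
  "disc_bound p \<gamma> c j = cmod (c j) powr p * (2 / (1 - cmod \<gamma>))\<^sup>2"

section \<open>Consequences of the two sum conditions\<close>

locale extremal_data =
  fixes p :: real and \<gamma> :: complex and \<alpha> c :: "nat \<Rightarrow> complex" and \<beta> :: "nat \<Rightarrow> nat"
  assumes p1: "1 \<le> p" and \<gamma>1: "cmod \<gamma> < 1" and \<alpha>1: "\<And>j. cmod (\<alpha> j) \<le> 1" and \<beta>01: "\<And>j. \<beta> j \<in> {0, 1}"
    and sum_norm: "(\<lambda>j. cmod (c j) powr p * (1 + (cmod (\<alpha> j))\<^sup>2)) sums (1 + (cmod \<gamma>)\<^sup>2)"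
    and sum_alpha: "(\<lambda>j. complex_of_real (cmod (c j) powr p) * \<alpha> j) sums \<gamma>"
begin

abbreviation "disc \<equiv> extremal_disc p \<gamma> \<alpha> c \<beta>"
abbreviation "dual \<equiv> dual_disc p \<gamma> \<alpha> c \<beta>"
abbreviation "wt \<equiv> disc_weight p \<gamma> \<alpha> c"
abbreviation "bd \<equiv> disc_bound p \<gamma> c"

definition A :: real where "A = (\<Sum>j. cmod (c j) powr p)"

lemma sums_A: "(\<lambda>j. cmod (c j) powr p) sums A"
proof -
  have "summable (\<lambda>j. cmod (c j) powr p)"
    by (rule summable_comparison_test'[OF sums_summable[OF sum_norm], of 0]) (simp add: mult_le_cancel_left1)
  then show ?thesis by (simp add: A_def summable_sums)
qed

lemma sums_norm_alpha: "(\<lambda>j. cmod (c j) powr p * (cmod (\<alpha> j))\<^sup>2) sums (1 + (cmod \<gamma>)\<^sup>2 - A)"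
  using sums_diff[OF sum_norm sums_A] by (simp add: algebra_simps)

lemma sums_Re_alpha: "(\<lambda>j. cmod (c j) powr p * Re (cnj (\<alpha> j) * z)) sums Re (cnj \<gamma> * z)"
proof -
  have "(\<lambda>j. cnj (complex_of_real (cmod (c j) powr p) * \<alpha> j) * z) sums (cnj \<gamma> * z)"
    using sum_alpha by (intro sums_mult2) (simp only: sums_cnj)
  then have "(\<lambda>j. Re (cnj (complex_of_real (cmod (c j) powr p) * \<alpha> j) * z)) sums Re (cnj \<gamma> * z)"
    by (rule sums_Re)
  then show ?thesis by (simp add: algebra_simps)
qed

text \<open>The variance of the \<open>\<alpha> j\<close> about \<gamma> for the weights
  |\<open>c j\<close>|^p. Its sign yields \<open>A \<le> 1\<close>; in the extreme case
  \<open>A = 1\<close> every \<open>\<alpha> j\<close> with \<open>c j \<noteq> 0\<close> equals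
  \<gamma>.\<close>

lemma sums_variance: "(\<lambda>j. cmod (c j) powr p * (cmod (\<alpha> j - \<gamma>))\<^sup>2) sums ((1 - A) * (1 - (cmod \<gamma>)\<^sup>2))"
proof -
  have "(\<lambda>j. cmod (c j) powr p * (cmod (\<alpha> j))\<^sup>2 - 2 * (cmod (c j) powr p * Re (cnj (\<alpha> j) * \<gamma>)) + (cmod \<gamma>)\<^sup>2 * cmod (c j) powr p)
     sums (1 + (cmod \<gamma>)\<^sup>2 - A - 2 * Re (cnj \<gamma> * \<gamma>) + (cmod \<gamma>)\<^sup>2 * A)"
    by (intro sums_add sums_diff sums_mult sums_norm_alpha sums_A sums_Re_alpha)
  moreover have "cmod (c j) powr p * (cmod (\<alpha> j))\<^sup>2 - 2 * (cmod (c j) powr p * Re (cnj (\<alpha> j) * \<gamma>)) + (cmod \<gamma>)\<^sup>2 * cmod (c j) powr p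
      = cmod (c j) powr p * (cmod (\<alpha> j - \<gamma>))\<^sup>2" for j
    unfolding cmod_power2 by (simp add: power2_eq_square algebra_simps)
  moreover have "1 + (cmod \<gamma>)\<^sup>2 - A - 2 * Re (cnj \<gamma> * \<gamma>) + (cmod \<gamma>)\<^sup>2 * A = (1 - A) * (1 - (cmod \<gamma>)\<^sup>2)"
    unfolding cmod_power2 by (simp add: power2_eq_square algebra_simps)
  ultimately show ?thesis by simp
qed

lemma A_le_1: "A \<le> 1"
proof -
  have "0 \<le> (1 - A) * (1 - (cmod \<gamma>)\<^sup>2)"
    by (rule sums_le[OF _ sums_zero sums_variance]) simp
  moreover have "0 < 1 - (cmod \<gamma>)\<^sup>2" using \<gamma>1 by (simp add: power_less_one_iff)
  ultimately show ?thesis by (simp add: zero_le_mult_iff)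
qed

lemma denominator_pos:
  assumes "cmod z < 1"
  shows "0 < Re (1 - cnj (\<alpha> j) * z)" "0 < Re (1 - cnj \<gamma> * z)"
    "1 - cnj (\<alpha> j) * z \<noteq> 0" "1 - cnj \<gamma> * z \<noteq> 0"
proof -
  have "cmod (\<alpha> j) * cmod z < 1" "cmod \<gamma> * cmod z < 1"
    using \<alpha>1[of j] \<gamma>1 assms by (auto intro!: norm_mult_less_1)
  then show "0 < Re (1 - cnj (\<alpha> j) * z)" "0 < Re (1 - cnj \<gamma> * z)"
    "1 - cnj (\<alpha> j) * z \<noteq> 0" "1 - cnj \<gamma> * z \<noteq> 0"
    using Re_one_minus_cnj_pos one_minus_cnj_nonzero by blast+
qed

lemma denominator_bound:
  assumes "cmod z \<le> 1"
  shows "1 - cmod \<gamma> \<le> cmod (1 - cnj \<gamma> * z)"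
proof -
  have "cmod (cnj \<gamma> * z) \<le> cmod \<gamma> * 1" unfolding norm_mult complex_mod_cnj using assms by (intro mult_left_mono) auto
  then show ?thesis using norm_triangle_ineq2[of 1 "cnj \<gamma> * z"] by simp
qed

text \<open>Expanding the squares leaves only the sums that the data prescribe, and
  \<open>A\<close>. The deficit from 1 vanishes on the unit circle, which is the reason why the
  boundary values are unit vectors.\<close>

lemma wt_sums:
  assumes z: "cmod z < 1"
  shows "(\<lambda>j. wt j z) sums (1 - (1 - A) * (1 - (cmod z)\<^sup>2) / (cmod (1 - cnj \<gamma> * z))\<^sup>2)"
proof -
  define N where "N = (cmod (1 - cnj \<gamma> * z))\<^sup>2"
  have N: "N \<noteq> 0" using denominator_pos(4)[OF z] by (simp add: N_def)
  have exp: "(cmod (1 - cnj a * z))\<^sup>2 = 1 - 2 * Re (cnj a * z) + (cmod a)\<^sup>2 * (cmod z)\<^sup>2" for a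
    unfolding cmod_power2 by (simp add: power2_eq_square algebra_simps)
  have "(\<lambda>j. (cmod (c j) powr p - 2 * (cmod (c j) powr p * Re (cnj (\<alpha> j) * z)) + cmod (c j) powr p * (cmod (\<alpha> j))\<^sup>2 * (cmod z)\<^sup>2) / N)
     sums ((A - 2 * Re (cnj \<gamma> * z) + (1 + (cmod \<gamma>)\<^sup>2 - A) * (cmod z)\<^sup>2) / N)"
    by (intro sums_add sums_diff sums_mult sums_mult2 sums_divide sums_norm_alpha sums_A sums_Re_alpha)
  moreover have "(cmod (c j) powr p - 2 * (cmod (c j) powr p * Re (cnj (\<alpha> j) * z)) + cmod (c j) powr p * (cmod (\<alpha> j))\<^sup>2 * (cmod z)\<^sup>2) / N
      = wt j z" for j
  proof -
    have "wt j z = cmod (c j) powr p * (cmod (1 - cnj (\<alpha> j) * z))\<^sup>2 / N"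
      by (simp add: disc_weight_def power_divide N_def)
    then show ?thesis unfolding exp by (simp only: algebra_simps mult_1_left)
  qed
  moreover have "(A - 2 * Re (cnj \<gamma> * z) + (1 + (cmod \<gamma>)\<^sup>2 - A) * (cmod z)\<^sup>2) / N = 1 - (1 - A) * (1 - (cmod z)\<^sup>2) / N"
  proof -
    have "A - 2 * Re (cnj \<gamma> * z) + (1 + (cmod \<gamma>)\<^sup>2 - A) * (cmod z)\<^sup>2 = N - (1 - A) * (1 - (cmod z)\<^sup>2)"
      unfolding N_def exp by (simp add: algebra_simps)
    then show ?thesis using N by (simp add: diff_divide_distrib)
  qed
  ultimately show ?thesis by (simp add: N_def)
qed

lemma wt_nonneg: "0 \<le> wt j z"
  by (simp add: disc_weight_def)

lemma wt_suminf_le_1: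
  assumes z: "cmod z < 1"
  shows "(\<Sum>j. wt j z) \<le> 1"
proof -
  have "0 \<le> (1 - A) * (1 - (cmod z)\<^sup>2) / (cmod (1 - cnj \<gamma> * z))\<^sup>2"
    using z A_le_1 by (intro divide_nonneg_nonneg mult_nonneg_nonneg) (auto simp: power_le_one)
  then show ?thesis using sums_unique[OF wt_sums[OF z]] by linarith
qed

lemma wt_le_bd:
  assumes z: "cmod z \<le> 1"
  shows "wt j z \<le> bd j"
proof -
  have "cmod (cnj (\<alpha> j) * z) \<le> 1 * 1" unfolding norm_mult complex_mod_cnj using z \<alpha>1 by (intro mult_mono) auto
  then have "cmod (1 - cnj (\<alpha> j) * z) \<le> 2" using norm_triangle_ineq4[of 1 "cnj (\<alpha> j) * z"] by simp
  then have "cmod (1 - cnj (\<alpha> j) * z) / cmod (1 - cnj \<gamma> * z) \<le> 2 / (1 - cmod \<gamma>)"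
    using denominator_bound[OF z] \<gamma>1 by (intro frac_le) auto
  then show ?thesis unfolding disc_weight_def disc_bound_def by (intro mult_left_mono power_mono) auto
qed

lemma bd_summable: "summable bd"
  unfolding disc_bound_def[abs_def] by (intro summable_mult2 sums_summable[OF sums_A])

lemma powr_quotient:
  assumes z: "cmod z < 1"
  shows "cmod ((1 - cnj (\<alpha> j) * z) powr complex_of_real r / (1 - cnj \<gamma> * z) powr complex_of_real r) =
    (cmod (1 - cnj (\<alpha> j) * z) / cmod (1 - cnj \<gamma> * z)) powr r"
  using z by (simp only: norm_divide norm_powr_of_real powr_divide norm_ge_zero)

lemma disc_norm_powr:
  assumes z: "cmod z < 1"
  shows "cmod (disc z j) powr p = (cmod (mob (\<alpha> j) z) ^ \<beta> j) powr p * wt j z"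
proof -
  define q where "q = cmod (1 - cnj (\<alpha> j) * z) / cmod (1 - cnj \<gamma> * z)"
  have q: "0 < q" using denominator_pos[OF z] by (simp add: q_def)
  have "cmod (disc z j) = cmod (c j) * cmod (mob (\<alpha> j) z) ^ \<beta> j * q powr (2 / p)"
    unfolding extremal_disc_def q_def
    by (simp only: norm_mult norm_power powr_quotient[OF z] flip: mob_def)
  then have "cmod (disc z j) powr p = (cmod (mob (\<alpha> j) z) ^ \<beta> j) powr p * (cmod (c j) powr p * (q powr (2 / p)) powr p)"
    by (simp add: powr_mult)
  also have "(q powr (2 / p)) powr p = q\<^sup>2" using p1 q by (simp add: powr_powr)
  finally show ?thesis by (simp add: disc_weight_def q_def)
qed

lemma disc_norm_powr_le:
  assumes z: "cmod z < 1"
  shows "cmod (disc z j) powr p \<le> wt j z"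
proof -
  have "cmod (mob (\<alpha> j) z) ^ \<beta> j \<le> 1" using mob_le_1[OF \<alpha>1 z] by (intro power_le_one) auto
  then have "(cmod (mob (\<alpha> j) z) ^ \<beta> j) powr p \<le> 1 powr p" using p1 by (intro powr_mono2) auto
  then show ?thesis unfolding disc_norm_powr[OF z] using wt_nonneg[of j z]
    mult_right_mono[of "(cmod (mob (\<alpha> j) z) ^ \<beta> j) powr p" 1 "wt j z"] by simp
qed

lemma disc_norm_powr_le_bd:
  assumes "cmod z < 1"
  shows "cmod (disc z j) powr p \<le> bd j"
  using disc_norm_powr_le[OF assms, of j] wt_le_bd[of z j] assms by simp

text \<open>The exponents match because p - 1 = p (1 - 1/p) and 2 - 2/p = 2 (1 - 1/p). The case
  \<open>c j = 0\<close> is separate: there both sides are 0 by the conventions for division by 0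
  and for powers of 0.\<close>

lemma dual_norm_le:
  assumes z: "cmod z < 1"
  shows "cmod (dual j z) \<le> wt j z powr (1 - 1 / p)"
proof (cases "c j = 0")
  case True
  then show ?thesis by (simp add: dual_disc_def)
next
  case False
  define q where "q = cmod (1 - cnj (\<alpha> j) * z) / cmod (1 - cnj \<gamma> * z)"
  have q: "0 < q" using denominator_pos[OF z] by (simp add: q_def)
  have "cmod (dual j z) = cmod (c j) powr p / cmod (c j) * cmod (mob (\<alpha> j) z) ^ (1 - \<beta> j) * q powr (2 - 2 / p)"
    unfolding dual_disc_def q_def
    by (simp only: norm_mult norm_power norm_divide powr_quotient[OF z, unfolded norm_divide] norm_of_real abs_of_nonneg powr_ge_zero)
  also have "cmod (c j) powr p / cmod (c j) = (cmod (c j) powr p) powr (1 - 1 / p)"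
  proof -
    have "p * (1 - 1 / p) = p - 1" using p1 by (simp add: field_simps)
    then show ?thesis using False p1 by (simp add: powr_powr powr_diff)
  qed
  also have "q powr (2 - 2 / p) = (q\<^sup>2) powr (1 - 1 / p)"
  proof -
    have "2 - 2 / p = 2 * (1 - 1 / p)" by simp
    then show ?thesis using q by (metis powr_powr powr_numeral zero_le_numeral less_imp_le)
  qed
  also have "(cmod (c j) powr p) powr (1 - 1 / p) * cmod (mob (\<alpha> j) z) ^ (1 - \<beta> j) * (q\<^sup>2) powr (1 - 1 / p) \<le>
      (cmod (c j) powr p) powr (1 - 1 / p) * 1 * (q\<^sup>2) powr (1 - 1 / p)"
    using mob_le_1[OF \<alpha>1 z] by (intro mult_right_mono mult_left_mono power_le_one) auto
  also have "\<dots> = wt j z powr (1 - 1 / p)"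
    by (simp add: disc_weight_def powr_mult flip: q_def)
  finally show ?thesis .
qed

lemma disc_holomorphic: "(\<lambda>z. disc z j) holomorphic_on ball 0 1"
  unfolding extremal_disc_def
  by (intro holomorphic_intros not_nonpos_Reals_if_Re_pos) (use denominator_pos in auto)

lemma dual_holomorphic: "dual j holomorphic_on ball 0 1"
  unfolding dual_disc_def[abs_def]
  by (intro holomorphic_intros not_nonpos_Reals_if_Re_pos holomorphic_on_mob[OF \<alpha>1]) (use denominator_pos in auto)

sublocale disc_functionals p dual wt bd
proof
  show "1 \<le> p" by (rule p1)
  show "dual j holomorphic_on ball 0 1" for j by (rule dual_holomorphic)
  show "summable bd" by (rule bd_summable)
  fix z :: complex assume z: "cmod z < 1"
  show "cmod (dual j z) \<le> wt j z powr (1 - 1 / p)" for j by (rule dual_norm_le[OF z])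
  show "0 \<le> wt j z" for j by (rule wt_nonneg)
  show "wt j z \<le> bd j" for j using z by (intro wt_le_bd) simp
  show "(\<Sum>j. wt j z) \<le> 1" by (rule wt_suminf_le_1[OF z])
qed

text \<open>The Moebius factor sits in the disc if \<open>\<beta> j = 1\<close> and in the
  functional if \<open>\<beta> j = 0\<close>, hence exactly once in the product, and the exponents
  2/p and 2 - 2/p add up to 2. So neither \<open>\<beta> j\<close> nor fractional powers
  survive.\<close>

lemma disc_times_dual:
  assumes z: "cmod z < 1"
  shows "disc z j * dual j z = complex_of_real (cmod (c j) powr p) * (z - \<alpha> j) * (1 - cnj (\<alpha> j) * z) / (1 - cnj \<gamma> * z)\<^sup>2"
proof (cases "c j = 0")
  case True
  then show ?thesis using p1 by (simp add: extremal_disc_def)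
next
  case False
  define a where "a = 1 - cnj (\<alpha> j) * z"
  define g where "g = 1 - cnj \<gamma> * z"
  have ag: "a \<noteq> 0" "g \<noteq> 0" using denominator_pos[OF z] by (auto simp: a_def g_def)
  have P: "u powr complex_of_real (2 / p) * u powr complex_of_real (2 - 2 / p) = u\<^sup>2" if "u \<noteq> 0" for u :: complex
  proof -
    have "complex_of_real (2 / p) + complex_of_real (2 - 2 / p) = 2" by simp
    then show ?thesis using that powr_complexnumeral[of u "num.Bit0 num.One"] by (metis powr_add)
  qed
  have M: "((z - \<alpha> j) / a) ^ \<beta> j * ((z - \<alpha> j) / a) ^ (1 - \<beta> j) = (z - \<alpha> j) / a"
    using \<beta>01[of j] by auto
  have "disc z j * dual j z = complex_of_real (cmod (c j) powr p) * (((z - \<alpha> j) / a) ^ \<beta> j * ((z - \<alpha> j) / a) ^ (1 - \<beta> j)) *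
     ((a powr complex_of_real (2 / p) * a powr complex_of_real (2 - 2 / p)) / (g powr complex_of_real (2 / p) * g powr complex_of_real (2 - 2 / p)))"
    unfolding extremal_disc_def dual_disc_def mob_def a_def[symmetric] g_def[symmetric] using False by simp
  also have "\<dots> = complex_of_real (cmod (c j) powr p) * ((z - \<alpha> j) / a) * (a\<^sup>2 / g\<^sup>2)"
    unfolding M P[OF ag(1)] P[OF ag(2)] ..
  also have "\<dots> = complex_of_real (cmod (c j) powr p) * (z - \<alpha> j) * a / g\<^sup>2"
    using ag by (simp add: power2_eq_square)
  finally show ?thesis by (simp add: a_def g_def)
qed

text \<open>Here the sum conditions find their meaning. The numerator of each term is a quadratic
  polynomial in \<open>z\<close> with coefficients -\<alpha>, 1 + |\<alpha>|^2 and
  -\<open>cnj \<alpha>\<close>; the conditions make the sum the same polynomial for \<gamma>, namely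
  (z - \<gamma>) (1 - \<open>cnj \<gamma> * z\<close>).\<close>

lemma pairing_disc:
  assumes z: "cmod z < 1"
  shows "pairing (disc z) z = mob \<gamma> z"
proof -
  have g: "1 - cnj \<gamma> * z \<noteq> 0" using denominator_pos(4)[OF z] .
  have sq: "complex_of_real (cmod a) * complex_of_real (cmod a) = a * cnj a" for a
    using complex_norm_square[of a] by (simp add: power2_eq_square)
  have 1: "(\<lambda>j. complex_of_real (cmod (c j) powr p * (1 + (cmod (\<alpha> j))\<^sup>2))) sums complex_of_real (1 + (cmod \<gamma>)\<^sup>2)"
    using sum_norm by (simp only: sums_of_real_iff)
  have 2: "(\<lambda>j. cnj (complex_of_real (cmod (c j) powr p) * \<alpha> j)) sums cnj \<gamma>"
    using sum_alpha by (simp only: sums_cnj)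
  have "(\<lambda>j. (complex_of_real (cmod (c j) powr p * (1 + (cmod (\<alpha> j))\<^sup>2)) * z - complex_of_real (cmod (c j) powr p) * \<alpha> j
       - cnj (complex_of_real (cmod (c j) powr p) * \<alpha> j) * z\<^sup>2) / (1 - cnj \<gamma> * z)\<^sup>2)
     sums ((complex_of_real (1 + (cmod \<gamma>)\<^sup>2) * z - \<gamma> - cnj \<gamma> * z\<^sup>2) / (1 - cnj \<gamma> * z)\<^sup>2)"
    by (intro sums_divide sums_diff sums_mult2 1 2 sum_alpha)
  moreover have "(complex_of_real (cmod (c j) powr p * (1 + (cmod (\<alpha> j))\<^sup>2)) * z - complex_of_real (cmod (c j) powr p) * \<alpha> j
       - cnj (complex_of_real (cmod (c j) powr p) * \<alpha> j) * z\<^sup>2) / (1 - cnj \<gamma> * z)\<^sup>2 = disc z j * dual j z" for j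
    unfolding disc_times_dual[OF z]
    by (rule arg_cong2[where f = "(/)"])
       (simp_all add: sq power2_eq_square algebra_simps)
  moreover have "complex_of_real (1 + (cmod \<gamma>)\<^sup>2) * z - \<gamma> - cnj \<gamma> * z\<^sup>2 = (z - \<gamma>) * (1 - cnj \<gamma> * z)"
    by (simp add: sq power2_eq_square algebra_simps)
  ultimately have "(\<lambda>j. disc z j * dual j z) sums ((z - \<gamma>) * (1 - cnj \<gamma> * z) / (1 - cnj \<gamma> * z)\<^sup>2)" by simp
  then show ?thesis using g by (simp add: pairing_def mob_def sums_iff power2_eq_square)
qed

lemma disc_lp:
  assumes z: "cmod z < 1"
  shows "disc z \<in> lp_space p" "(\<Sum>j. cmod (disc z j) powr p) \<le> (\<Sum>j. wt j z)"
proof -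
  have s: "summable (\<lambda>j. cmod (disc z j) powr p)"
    by (rule summable_comparison_test'[OF w_summable[OF z], of 0]) (use disc_norm_powr_le[OF z] in auto)
  then show "disc z \<in> lp_space p" by (simp add: lp_space_def)
  show "(\<Sum>j. cmod (disc z j) powr p) \<le> (\<Sum>j. wt j z)"
    by (rule suminf_le[OF disc_norm_powr_le[OF z] s w_summable[OF z]])
qed

text \<open>Norm 1 at a single interior point forces equality in all estimates:
  \<open>A = 1\<close>, so each relevant \<open>\<alpha> j\<close> is \<gamma>, and no Moebius
  factor occurs, since it would be strictly smaller than 1. What remains is a constant map.\<close>

lemma disc_mem_ball:
  assumes nc: "disc u \<noteq> disc v" and u: "cmod u < 1" and v: "cmod v < 1" and z: "cmod z < 1"
  shows "disc z \<in> lp_ball p"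
proof (rule ccontr)
  assume "disc z \<notin> lp_ball p"
  then have ge: "1 \<le> (\<Sum>j. cmod (disc z j) powr p)"
    using lp_norm_less_1_iff[OF p1 disc_lp(1)[OF z]] disc_lp(1)[OF z] by (auto simp: lp_ball_def)
  with disc_lp(2)[OF z] wt_suminf_le_1[OF z] have eq: "(\<Sum>j. wt j z) = 1" "(\<Sum>j. cmod (disc z j) powr p) = 1" by auto
  have "(1 - A) * (1 - (cmod z)\<^sup>2) / (cmod (1 - cnj \<gamma> * z))\<^sup>2 = 0"
    using eq(1) sums_unique[OF wt_sums[OF z]] by simp
  moreover have "0 < 1 - (cmod z)\<^sup>2" using z by (simp add: power_less_one_iff)
  ultimately have "A = 1" using denominator_pos(4)[OF z] by auto
  then have "(\<lambda>j. cmod (c j) powr p * (cmod (\<alpha> j - \<gamma>))\<^sup>2) sums 0" using sums_variance by simp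
  then have v0: "cmod (c j) powr p * (cmod (\<alpha> j - \<gamma>))\<^sup>2 = 0" for j
    using suminf_eq_zero_iff[of "\<lambda>j. cmod (c j) powr p * (cmod (\<alpha> j - \<gamma>))\<^sup>2"] by (auto simp: sums_iff)
  have \<alpha>\<gamma>: "\<alpha> j = \<gamma>" if "c j \<noteq> 0" for j using v0[of j] that p1 by auto
  have "(\<lambda>j. wt j z - cmod (disc z j) powr p) sums (1 - 1)"
    using disc_lp(1)[OF z] w_summable[OF z] eq unfolding lp_space_def
    by (intro sums_diff) (auto simp: sums_iff)
  then have "(\<lambda>j. wt j z - cmod (disc z j) powr p) sums 0" by simp
  then have w0: "wt j z - cmod (disc z j) powr p = 0" for j
    using suminf_eq_zero_iff[of "\<lambda>j. wt j z - cmod (disc z j) powr p"] disc_norm_powr_le[OF z] by (auto simp: sums_iff)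
  have \<beta>0: "\<beta> j = 0" if cj: "c j \<noteq> 0" for j
  proof (rule ccontr)
    assume "\<beta> j \<noteq> 0"
    then have "\<beta> j = 1" using \<beta>01[of j] by auto
    then have "wt j z * (1 - cmod (mob \<gamma> z) powr p) = 0"
      using w0[of j] unfolding disc_norm_powr[OF z] by (simp add: \<alpha>\<gamma>[OF cj] algebra_simps)
    moreover have "wt j z \<noteq> 0"
      using cj denominator_pos[OF z] p1 by (simp add: disc_weight_def)
    ultimately have "cmod (mob \<gamma> z) powr p = 1" by simp
    moreover have "cmod (mob \<gamma> z) powr p < 1 powr p"
      using mob_less_1[OF \<gamma>1 z] p1 by (intro powr_less_mono2) auto
    ultimately show False by simp
  qed
  have const: "disc t j = c j" if t: "cmod t < 1" for t j
  proof (cases "c j = 0")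
    case True then show ?thesis by (simp add: extremal_disc_def)
  next
    case False
    then show ?thesis using denominator_pos(4)[OF t] by (simp add: extremal_disc_def \<alpha>\<gamma> \<beta>0)
  qed
  show False using nc const[OF u] const[OF v] by auto
qed

context
  assumes ball: "\<And>z. cmod z < 1 \<Longrightarrow> disc z \<in> lp_ball p"
begin

lemma disc_hol: "disc \<in> hol_from_disc p (lp_ball p)"
  using ball by (intro hol_from_disc_dominated[OF p1 disc_holomorphic bd_summable disc_norm_powr_le_bd]) auto

lemma dual_pair: "dual_pair p dual wt bd disc \<gamma>"
  by unfold_locales (use \<gamma>1 disc_hol pairing_disc in auto)

lemma disc_geodesic: "complex_geodesic p (lp_ball p) disc"
  using dual_pair.complex_geodesic[OF dual_pair] .

text \<open>A competitor might reach \<open>y\<close> at another parameter \<open>s'\<close>, but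
  both parameters measure the same Caratheodory distance from \<open>x\<close>, and
  \<open>artanh\<close> is injective.\<close>

lemma disc_unique:
  assumes \<psi>: "normalized_geodesic_joining p (lp_ball p) x y \<psi>"
    and x: "disc 0 = x" and s: "0 < s" "s < 1" and y: "disc (complex_of_real s) = y" and z: "cmod z < 1"
  shows "\<psi> z = disc z"
proof -
  obtain s' where s': "0 < s'" "s' < 1" "\<psi> (complex_of_real s') = y" and \<psi>0: "\<psi> 0 = x"
    and \<psi>g: "complex_geodesic p (lp_ball p) \<psi>"
    using \<psi> by (auto simp: normalized_geodesic_joining_def)
  have "poincare_dist 0 (complex_of_real s') = caratheodory_dist p (lp_ball p) x y"
    using \<psi>g s' \<psi>0 by (auto simp: complex_geodesic_def)
  moreover have "poincare_dist 0 (complex_of_real s) = caratheodory_dist p (lp_ball p) x y"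
    using disc_geodesic s x y by (auto simp: complex_geodesic_def)
  ultimately have "artanh s = artanh s'" using s s' by (simp add: poincare_dist_def)
  then have "s = s'" using s s' by (simp add: artanh_real_eq_iff)
  then have \<psi>s: "\<psi> (complex_of_real s) = disc (complex_of_real s)" using s' y by simp
  show ?thesis
  proof (rule dual_pair.unique[where \<psi> = \<psi> and s = "complex_of_real s" and z = z, OF dual_pair _ _ _ _ \<psi>s _ z])
    show "\<psi> \<in> hol_from_disc p (lp_ball p)" using \<psi>g by (simp add: complex_geodesic_def)
    show "complex_of_real s \<noteq> 0" "cmod (complex_of_real s) < 1" using s by auto
    show "\<psi> 0 = disc 0" using \<psi>0 x by simp
    fix j
    show "(\<forall>z. cmod z < 1 \<longrightarrow> disc z j = 0) \<or> (\<exists>a. \<forall>z. cmod z < 1 \<longrightarrow> z \<noteq> a \<longrightarrow> dual j z \<noteq> 0)"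
    proof (cases "c j = 0")
      case True
      then show ?thesis by (simp add: extremal_disc_def)
    next
      case False
      have "dual j z \<noteq> 0" if "cmod z < 1" "z \<noteq> \<alpha> j" for z
        unfolding dual_disc_def using False that denominator_pos[OF that(1)] p1 by (simp add: mob_def)
      then show ?thesis by blast
    qed
  qed
qed

end

section \<open>Extension of extremal discs to the closed disc\<close>

lemma disc_continuous:
  assumes \<beta>: "\<And>j. cmod (\<alpha> j) = 1 \<Longrightarrow> \<beta> j = 0"
  shows "continuous_on (cball 0 1) (\<lambda>z. disc z j)"
proof -
  have a: "cmod (cnj (\<alpha> j) * z) \<le> 1" if "cmod z \<le> 1" for z
    unfolding norm_mult complex_mod_cnj using that \<alpha>1[of j] mult_mono[of "cmod (\<alpha> j)" 1 "cmod z" 1] by simp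
  have re: "0 \<le> Re (1 - cnj (\<alpha> j) * z)" if "cmod z \<le> 1" for z
    using complex_Re_le_cmod[of "cnj (\<alpha> j) * z"] a[OF that] by simp
  have g: "0 < Re (1 - cnj \<gamma> * z)" if "cmod z \<le> 1" for z
    using that \<gamma>1 norm_mult_less_1[of z \<gamma>] by (intro Re_one_minus_cnj_pos) (simp add: mult.commute)
  have g0: "1 - cnj \<gamma> * z \<noteq> 0" if "cmod z \<le> 1" for z using g[OF that] by (metis less_irrefl zero_complex.sel(1))
  \<comment> \<open>If |\<open>\<alpha> j\<close>| = 1 the base vanishes at the boundary point
    \<open>\<alpha> j\<close>; the power is still continuous there because its exponent is
    positive.\<close>
  have c1: "continuous_on (cball 0 1) (\<lambda>z. (1 - cnj (\<alpha> j) * z) powr complex_of_real (2 / p))"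
    using re p1 by (intro continuous_intros) (auto simp: subset_iff)
  have c2: "continuous_on (cball 0 1) (\<lambda>z. (1 - cnj \<gamma> * z) powr complex_of_real (2 / p))"
    using g p1 by (intro continuous_intros) (auto simp: subset_iff less_imp_le)
  \<comment> \<open>For |\<open>\<alpha> j\<close>| = 1 the quotient would be 0 / 0 at
    \<open>\<alpha> j\<close>, and the default value 0 would break continuity; the condition on
    \<beta> removes the factor in this case.\<close>
  have c3: "continuous_on (cball 0 1) (\<lambda>z. ((z - \<alpha> j) / (1 - cnj (\<alpha> j) * z)) ^ \<beta> j)"
  proof (cases "\<beta> j = 0")
    case False
    then have "cmod (\<alpha> j) < 1" using \<beta>[of j] \<alpha>1[of j] by fastforce
    then have "1 - cnj (\<alpha> j) * z \<noteq> 0" if "cmod z \<le> 1" for z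
      using that norm_mult_less_1[of z "\<alpha> j"] by (intro one_minus_cnj_nonzero) (simp add: mult.commute)
    then show ?thesis by (intro continuous_intros) auto
  qed simp
  show ?thesis unfolding extremal_disc_def
    by (intro continuous_on_mult continuous_on_divide c1 c2 c3 continuous_on_const)
       (use g0 in auto)
qed

lemma disc_norm_powr_le_bd_closed:
  assumes \<beta>: "\<And>j. cmod (\<alpha> j) = 1 \<Longrightarrow> \<beta> j = 0" and z: "cmod z \<le> 1"
  shows "cmod (disc z j) \<le> bd j powr (1 / p)"
proof -
  have cont: "continuous_on (closure (ball 0 1)) (\<lambda>z. disc z j)" using disc_continuous[OF \<beta>] by simp
  have mem: "z \<in> closure (ball 0 1)" using z by simp
  have "cmod (disc u j) \<le> bd j powr (1 / p)" if "cmod u < 1" for u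
  proof -
    have "(cmod (disc u j) powr p) powr (1 / p) \<le> bd j powr (1 / p)"
      using disc_norm_powr_le_bd[OF that, of j] p1 by (intro powr_mono2) auto
    then show ?thesis using p1 by (simp add: powr_powr)
  qed
  then have "\<forall>u\<in>ball 0 1. cmod (disc u j) \<le> bd j powr (1 / p)" by simp
  from continuous_on_closure_norm_le[OF cont this mem] show ?thesis .
qed

lemma disc_continuous_map:
  assumes \<beta>: "\<And>j. cmod (\<alpha> j) = 1 \<Longrightarrow> \<beta> j = 0" and ball: "\<And>z. cmod z < 1 \<Longrightarrow> disc z \<in> lp_ball p"
  shows "continuous_map (top_of_set (closure unit_disc))
           (subtopology (lp_topology p) (lp_topology p closure_of lp_ball p)) disc"
proof -
  interpret Metric_space "lp_space p" "lp_dist p" by (rule Metric_space_lp[OF p1])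
  have bd0: "0 \<le> bd j" for j by (simp add: disc_bound_def)
  have bdp: "(bd j powr (1 / p)) powr p = bd j" for j using p1 bd0[of j] by (simp add: powr_powr)
  have mem: "disc z \<in> lp_space p" if z: "cmod z \<le> 1" for z
  proof (rule lp_norm_bound(1)[OF p1 bd_summable zero_le_one])
    show "cmod (disc z j) powr p \<le> 1 powr p * bd j" for j
      using powr_mono2[OF _ _ disc_norm_powr_le_bd_closed[OF \<beta> z], of p j] p1 by (simp add: bdp)
  qed
  have cm: "continuous_map (top_of_set (closure unit_disc)) (lp_topology p) disc"
    unfolding lp_topology_def continuous_map_to_metric
  proof (intro ballI allI impI)
    fix x and e :: real assume "x \<in> topspace (top_of_set (closure unit_disc))" and e: "e > 0"
    then have x: "cmod x \<le> 1" by simp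
    \<comment> \<open>The p-th power of the distance from \<open>disc x\<close>, continuous as a
      uniform limit of its partial sums.\<close>
    define h where "h y = (\<Sum>j. cmod (disc x j - disc y j) powr p)" for y
    have le: "cmod (disc x j - disc y j) powr p \<le> 2 powr p * bd j" if y: "cmod y \<le> 1" for y j
    proof -
      have "cmod (disc x j - disc y j) \<le> 2 * bd j powr (1 / p)"
        using norm_triangle_ineq4[of "disc x j" "disc y j"]
          disc_norm_powr_le_bd_closed[OF \<beta> x, of j] disc_norm_powr_le_bd_closed[OF \<beta> y, of j] by linarith
      then have "cmod (disc x j - disc y j) powr p \<le> (2 * bd j powr (1 / p)) powr p"
        using p1 by (intro powr_mono2) auto
      then show ?thesis by (simp add: powr_mult bdp)
    qed
    have "uniform_limit (cball 0 1) (\<lambda>n y. \<Sum>j<n. cmod (disc x j - disc y j) powr p) h sequentially"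
      unfolding h_def
      by (rule Weierstrass_m_test[where M = "\<lambda>j. 2 powr p * bd j"]) (use le in \<open>auto intro: summable_mult bd_summable\<close>)
    moreover have "continuous_on (cball 0 1) (\<lambda>y. \<Sum>j<n. cmod (disc x j - disc y j) powr p)" for n
      using p1 by (intro continuous_intros continuous_on_powr' disc_continuous \<beta>) auto
    ultimately have conth: "continuous_on (cball 0 1) h"
      by (intro uniform_limit_theorem) auto
    define U where "U = cball 0 1 \<inter> h -` {..< e powr p}"
    have "openin (top_of_set (cball 0 1)) U"
      unfolding U_def by (rule continuous_openin_preimage_gen[OF conth]) simp
    moreover have "x \<in> U" using x e p1 by (simp add: U_def h_def)
    moreover have "disc y \<in> mball (disc x) e" if "y \<in> U" for y
    proof -
      have y: "cmod y \<le> 1" "h y < e powr p" using that by (auto simp: U_def)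
      have d: "(\<lambda>j. disc x j - disc y j) \<in> lp_space p" using lp_diff_mem[OF p1 mem[OF x] mem[OF y(1)]] .
      have "lp_dist p (disc x) (disc y) powr p = h y"
        unfolding lp_dist_def h_def using lp_norm_powr[OF p1 d] .
      then have "\<not> e \<le> lp_dist p (disc x) (disc y)"
        using y(2) e p1 powr_le_powr_iff[of p e "lp_dist p (disc x) (disc y)"] by simp
      then show ?thesis using mem x y by simp
    qed
    ultimately show "\<exists>U. openin (top_of_set (closure unit_disc)) U \<and> x \<in> U \<and> (\<forall>y\<in>U. disc y \<in> mball (disc x) e)"
      by auto
  qed
  \<comment> \<open>A continuous map sends the closure of the open disc into the closure of its
    image, so the boundary values need no estimate of their own.\<close>
  have "disc ` (top_of_set (closure unit_disc) closure_of unit_disc) \<subseteq> lp_topology p closure_of (disc ` unit_disc)"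
    by (rule continuous_map_image_closure_subset[OF cm])
  also have "\<dots> \<subseteq> lp_topology p closure_of lp_ball p" using ball by (intro closure_of_mono) auto
  finally have "disc ` (top_of_set (closure unit_disc) closure_of unit_disc) \<subseteq> lp_topology p closure_of lp_ball p" .
  moreover have "top_of_set (closure unit_disc) closure_of unit_disc = closure unit_disc"
    by (simp add: closure_of_subtopology Int_absorb1)
  ultimately show ?thesis using cm by (auto simp: continuous_map_in_subtopology)
qed

end

section \<open>The two-point problem in one coordinate\<close>

text \<open>
  For \<open>\<beta>\<^sub>j = 0\<close> put \<open>w = cnj \<alpha>\<^sub>j\<close>, for \<open>\<beta>\<^sub>j = 1\<close> put \<open>w = 1 / \<alpha>\<^sub>j\<close>. Up to the factor \<open>(1 - cnj \<gamma> * s) powr (2 / p)\<close>,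
  \<open>coordinate_ratio (2 / p) s w\<close> is the ratio of the \<open>j\<close>-th coordinates of the disc at \<open>s\<close> and at \<open>0\<close>.
\<close>

definition coordinate_ratio :: "real \<Rightarrow> real \<Rightarrow> complex \<Rightarrow> complex" where
  "coordinate_ratio e s w =
     (if cmod w \<le> 1 then (1 - of_real s * w) powr of_real e
      else (1 - of_real s * w) * (1 - of_real s / cnj w) powr of_real (e - 1))"

lemma nonzero_if_Re_pos: "0 < Re u \<Longrightarrow> u \<noteq> 0"
  by auto

lemma reflected_base_pos:
  assumes s: "0 < s" "s < 1" and w: "1 \<le> cmod w"
  shows "0 < Re (1 - of_real s / w)"
proof -
  have "cmod (of_real s / w) \<le> s / 1" unfolding norm_divide using s w by (intro frac_le) auto
  then have "Re (of_real s / w) \<le> s" using complex_Re_le_cmod[of "of_real s / w"] by simp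
  then show ?thesis using s by simp
qed

lemma base_pos:
  assumes s: "0 < s" "s < 1" and w: "cmod w \<le> 1"
  shows "0 < Re (1 - of_real s * w)"
proof -
  have "cmod (of_real s * w) \<le> s * 1" unfolding norm_mult using s w by (intro mult_mono) auto
  then have "Re (of_real s * w) \<le> s" using complex_Re_le_cmod[of "of_real s * w"] by linarith
  then show ?thesis using s by (simp only: minus_complex.sel one_complex.sel)
qed

text \<open>On the unit circle reflection is the identity; this is where the two branches of
  \<open>coordinate_ratio\<close> are pasted.\<close>

lemma inverse_cnj_unit: "cmod w = 1 \<Longrightarrow> of_real s / cnj w = of_real s * w"
  using complex_norm_square[of w] inverse_unique[of "cnj w" w]
  by (simp add: divide_inverse mult.commute)

section \<open>Injectivity of the ratio by comparing logarithms\<close>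

context
  fixes s :: real
  assumes s: "0 < s" "s < 1"
begin

text \<open>
  In terms of \<open>X = Ln (1 - s * w)\<close> the logarithm of \<open>coordinate_ratio e s w\<close> is \<open>X + (e - 1) * reflect_log X\<close>. Since
  \<open>reflect_log\<close> does not increase distances and \<open>-1 < e - 1 \<le> 1\<close>, this is injective in \<open>X\<close>. The logarithm is only
  available on a half plane of points \<open>w\<close>; the other one is its mirror image.
\<close>

definition from_log :: "complex \<Rightarrow> complex" where "from_log X = (1 - exp X) / of_real s"

text \<open>The logarithm of 1 - s w', where w' is \<open>w = from_log X\<close> inside the closed
  disc and its mirror image 1 / \<open>cnj w\<close> outside.\<close>

definition reflect_log :: "complex \<Rightarrow> complex" where
  "reflect_log X = (if cmod (from_log X) \<le> 1 then X else Ln (1 - of_real s / cnj (from_log X)))"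

lemma exp_from_log: "exp X = 1 - of_real s * from_log X"
  using s by (simp add: from_log_def)

text \<open>Outside the disc the reflection is antiholomorphic. Pulling out a conjugation leaves a
  holomorphic function to differentiate, and the formula persists on the circle.\<close>

lemma reflect_log_outer:
  assumes X: "0 \<le> Im X" "Im X \<le> pi" and w: "1 \<le> cmod (from_log X)"
  shows "reflect_log X = cnj (Ln (1 - of_real s / from_log X))"
proof -
  have "cnj (Ln (1 - of_real s / from_log X)) = Ln (1 - of_real s / cnj (from_log X))"
    using reflected_base_pos[OF s w] by (subst cnj_Ln) (auto simp: complex_nonpos_Reals_iff)
  moreover have "Ln (1 - of_real s / cnj (from_log X)) = X" if "cmod (from_log X) = 1"
  proof -
    have "1 - of_real s / cnj (from_log X) = exp X" using inverse_cnj_unit[OF that] by (simp add: exp_from_log)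
    then show ?thesis using X pi_gt_zero by (simp add: less_le_trans[of "- pi" 0])
  qed
  ultimately show ?thesis using w by (auto simp: reflect_log_def)
qed

text \<open>With \<open>u = from_log X\<close> the modulus is |1 - s u| / (|u| |u - s|), and |1 - s
  u| < |u - s| outside the closed disc.\<close>

lemma reflected_derivative:
  assumes w: "1 < cmod (from_log X)"
  shows "((\<lambda>X. Ln (1 - of_real s / from_log X)) has_field_derivative
      - (exp X / (from_log X * (from_log X - of_real s)))) (at X)"
    and "cmod (exp X / (from_log X * (from_log X - of_real s))) < 1"
proof -
  define u where "u = from_log X"
  have u0: "u \<noteq> 0" using w by (auto simp: u_def)
  have us: "u - of_real s \<noteq> 0" using w s unfolding u_def[symmetric] by auto
  have b: "0 < Re (1 - of_real s / u)" using reflected_base_pos[OF s] w by (simp add: u_def)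
  have du: "(from_log has_field_derivative (- exp X / of_real s)) (at X)"
    unfolding from_log_def[abs_def] using s by (auto intro!: derivative_eq_intros)
  have dI: "((\<lambda>X. 1 - of_real s / from_log X) has_field_derivative (- exp X / u\<^sup>2)) (at X)"
    using s u0 by (auto intro!: derivative_eq_intros du simp: u_def power2_eq_square)
  have "((\<lambda>X. Ln (1 - of_real s / from_log X)) has_field_derivative (inverse (1 - of_real s / u) * (- exp X / u\<^sup>2))) (at X)"
    unfolding u_def by (rule DERIV_chain2[OF has_field_derivative_Ln dI[unfolded u_def]])
      (use b in \<open>auto simp: u_def complex_nonpos_Reals_iff\<close>)
  moreover have "inverse (1 - of_real s / u) * (- exp X / u\<^sup>2) = - (exp X / (u * (u - of_real s)))"
    using u0 us by (simp add: field_simps power2_eq_square)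
  ultimately show "((\<lambda>X. Ln (1 - of_real s / from_log X)) has_field_derivative
      - (exp X / (from_log X * (from_log X - of_real s)))) (at X)"
    by (simp add: u_def)
  have "(cmod (u - of_real s))\<^sup>2 - (cmod (1 - of_real s * u))\<^sup>2 = ((cmod u)\<^sup>2 - 1) * (1 - s\<^sup>2)"
    unfolding cmod_power2 by (simp add: power2_eq_square algebra_simps)
  moreover have "0 < ((cmod u)\<^sup>2 - 1) * (1 - s\<^sup>2)"
    using w s by (intro mult_pos_pos) (auto simp: u_def power_less_one_iff one_less_power)
  ultimately have "(cmod (1 - of_real s * u))\<^sup>2 < (cmod (u - of_real s))\<^sup>2" by linarith
  then have lt: "cmod (1 - of_real s * u) < cmod (u - of_real s)"
    using power2_less_imp_less norm_ge_zero by blast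
  also have "\<dots> \<le> cmod u * cmod (u - of_real s)" using w by (simp add: u_def mult_le_cancel_right1)
  finally show "cmod (exp X / (from_log X * (from_log X - of_real s))) < 1"
    using u0 us by (simp add: norm_divide norm_mult exp_from_log flip: u_def)
qed

context
  fixes X1 X2 :: complex
  assumes strip: "0 \<le> Im X1" "Im X1 \<le> pi" "0 \<le> Im X2" "Im X2 \<le> pi" and ne: "X1 \<noteq> X2"
begin

definition log_path :: "real \<Rightarrow> complex" where "log_path t = X1 + of_real t * (X2 - X1)"

lemma log_path_strip:
  assumes "0 \<le> t" "t \<le> 1"
  shows "0 \<le> Im (log_path t)" "Im (log_path t) \<le> pi"
proof -
  have eq: "Im (log_path t) = (1 - t) * Im X1 + t * Im X2" by (simp add: log_path_def algebra_simps)
  show "0 \<le> Im (log_path t)" unfolding eq using assms strip by simp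
  show "Im (log_path t) \<le> pi" unfolding eq using assms strip by (intro convex_bound_le) auto
qed

lemma from_log_path_continuous: "continuous_on A (\<lambda>t. from_log (log_path t))"
  unfolding from_log_def log_path_def using s by (intro continuous_intros) auto

text \<open>The mean value theorem asks for the derivative only in the interior of the piece, so its
  ends may lie on the circle.\<close>

lemma reflect_log_segment:
  assumes t: "0 \<le> t1" "t1 < t2" "t2 \<le> 1" and out: "\<And>t. t1 < t \<Longrightarrow> t < t2 \<Longrightarrow> 1 < cmod (from_log (log_path t))"
  shows "cmod (reflect_log (log_path t2) - reflect_log (log_path t1)) < (t2 - t1) * cmod (X2 - X1)"
proof -
  have ge: "1 \<le> cmod (from_log (log_path t))" if "t \<in> {t1..t2}" for t
  proof (rule continuous_ge_on_closure[of "{t1<..<t2}" "\<lambda>t. cmod (from_log (log_path t))"])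
    show "continuous_on (closure {t1<..<t2}) (\<lambda>t. cmod (from_log (log_path t)))"
      by (intro continuous_on_norm from_log_path_continuous)
    show "t \<in> closure {t1<..<t2}" using t that by simp
  qed (use out in \<open>auto intro: less_imp_le\<close>)
  define Y where "Y t = Ln (1 - of_real s / from_log (log_path t))" for t
  define Y' where "Y' t = - (exp (log_path t) / (from_log (log_path t) * (from_log (log_path t) - of_real s)))" for t
  have T: "reflect_log (log_path t) = cnj (Y t)" if "t \<in> {t1..t2}" for t
    unfolding Y_def using t that by (intro reflect_log_outer log_path_strip ge) auto
  have cont: "continuous_on {t1..t2} Y"
  proof -
    have "from_log (log_path t) \<noteq> 0" if "t \<in> {t1..t2}" for t using ge[OF that] by auto
    moreover have "1 - of_real s / from_log (log_path t) \<notin> \<real>\<^sub>\<le>\<^sub>0" if "t \<in> {t1..t2}" for t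
      using reflected_base_pos[OF s ge[OF that]] by (auto simp: complex_nonpos_Reals_iff)
    ultimately show ?thesis unfolding Y_def
      by (intro continuous_on_Ln' continuous_on_diff continuous_on_divide continuous_on_const from_log_path_continuous) auto
  qed
  have der: "(Y has_derivative (\<lambda>h. h *\<^sub>R ((X2 - X1) * Y' t))) (at t)" if "t1 < t" "t < t2" for t
  proof -
    have "(log_path has_vector_derivative (X2 - X1)) (at t)"
      unfolding log_path_def[abs_def] has_vector_derivative_def
      by (auto intro!: derivative_eq_intros simp: scaleR_conv_of_real)
    from field_vector_diff_chain_at[OF this reflected_derivative(1)[OF out[OF that]]]
    show ?thesis by (simp add: o_def Y_def[abs_def] Y'_def has_vector_derivative_def)
  qed
  obtain t where tt: "t \<in> {t1<..<t2}" "norm (Y t2 - Y t1) \<le> norm ((t2 - t1) *\<^sub>R ((X2 - X1) * Y' t))"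
    using mvt_general[OF t(2) cont der] by blast
  have "norm ((t2 - t1) *\<^sub>R ((X2 - X1) * Y' t)) = (t2 - t1) * cmod (X2 - X1) * cmod (Y' t)"
    using t by (simp add: norm_mult)
  also have "\<dots> < (t2 - t1) * cmod (X2 - X1) * 1"
    using tt t ne reflected_derivative(2)[OF out[of t]] unfolding Y'_def norm_minus_cancel
    by (intro mult_strict_left_mono) auto
  finally have "norm (Y t2 - Y t1) < (t2 - t1) * cmod (X2 - X1)" using tt(2) by linarith
  moreover have "cmod (reflect_log (log_path t2) - reflect_log (log_path t1)) = norm (Y t2 - Y t1)"
    using T[of t1] T[of t2] t by (simp flip: complex_cnj_diff)
  ultimately show ?thesis by simp
qed

text \<open>The segment is cut at the first and the last parameter whose point belongs to the closed
  disc. Both of these points are fixed by \<open>reflect_log\<close>, so nothing has to be known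
  about the middle piece, however often it crosses the circle. The outer pieces contract strictly,
  and at least one of them is non-trivial.\<close>

lemma reflect_log_contraction:
  assumes "\<not> (cmod (from_log X1) \<le> 1 \<and> cmod (from_log X2) \<le> 1)"
  shows "cmod (reflect_log X2 - reflect_log X1) < cmod (X2 - X1)"
proof -
  define C where "C = {t \<in> {0..1}. cmod (from_log (log_path t)) \<le> 1}"
  have ends: "log_path 0 = X1" "log_path 1 = X2" by (simp_all add: log_path_def)
  show ?thesis
  proof (cases "C = {}")
    case True
    then have "1 < cmod (from_log (log_path t))" if "0 < t" "t < 1" for t
    proof -
      have "t \<notin> C" using True by simp
      then show ?thesis using that by (simp add: C_def not_le)
    qed
    from reflect_log_segment[OF _ _ _ this, of 0 1] show ?thesis by (simp add: ends)
  next
    case False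
    have "closed C"
    proof -
      have "closed ({0..1} \<inter> (\<lambda>t. cmod (from_log (log_path t))) -` {..1})"
        by (intro continuous_closed_preimage continuous_on_norm from_log_path_continuous) auto
      moreover have "C = {0..1} \<inter> (\<lambda>t. cmod (from_log (log_path t))) -` {..1}" by (auto simp: C_def)
      ultimately show ?thesis by simp
    qed
    moreover have bdd: "bdd_below C" "bdd_above C" by (auto simp: C_def intro: bdd_belowI[of _ 0] bdd_aboveI[of _ 1])
    ultimately have cd: "Inf C \<in> C" "Sup C \<in> C"
      using closed_contains_Inf[OF False] closed_contains_Sup[OF False] by simp_all
    define a where "a = Inf C"
    define b where "b = Sup C"
    have ab: "0 \<le> a" "a \<le> 1" "0 \<le> b" "b \<le> 1" using cd by (auto simp: C_def a_def b_def)
    have "a \<le> b" unfolding a_def using cd bdd by (intro cInf_lower) (auto simp: b_def)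
    have lo: "1 < cmod (from_log (log_path t))" if "0 < t" "t < a" for t
    proof -
      have "t \<notin> C" using cInf_lower[OF _ bdd(1), of t] that unfolding a_def by linarith
      then show ?thesis using that ab by (simp add: C_def not_le)
    qed
    have hi: "1 < cmod (from_log (log_path t))" if "b < t" "t < 1" for t
    proof -
      have "t \<notin> C" using cSup_upper[OF _ bdd(2), of t] that unfolding b_def by linarith
      then show ?thesis using that ab by (simp add: C_def not_le)
    qed
    define \<Delta> where "\<Delta> = cmod (X2 - X1)"
    have D: "\<Delta> > 0" using ne by (simp add: \<Delta>_def)
    have A1: "cmod (reflect_log (log_path a) - reflect_log (log_path 0)) < a * \<Delta>" if "a > 0"
      using reflect_log_segment[OF order_refl that ab(2) lo] by (simp add: \<Delta>_def)
    then have A2: "cmod (reflect_log (log_path a) - reflect_log (log_path 0)) \<le> a * \<Delta>"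
      using ab(1) by (cases "a = 0") auto
    have B1: "cmod (reflect_log (log_path 1) - reflect_log (log_path b)) < (1 - b) * \<Delta>" if "b < 1"
      using reflect_log_segment[OF ab(3) that order_refl hi] by (simp add: \<Delta>_def)
    then have B2: "cmod (reflect_log (log_path 1) - reflect_log (log_path b)) \<le> (1 - b) * \<Delta>"
      using ab(4) by (cases "b = 1") auto
    have r: "reflect_log (log_path a) = log_path a" "reflect_log (log_path b) = log_path b"
      using cd by (auto simp: reflect_log_def C_def a_def b_def)
    have diff: "reflect_log (log_path b) - reflect_log (log_path a) = of_real (b - a) * (X2 - X1)"
      unfolding r by (simp add: log_path_def algebra_simps)
    have 3: "cmod (reflect_log (log_path b) - reflect_log (log_path a)) = (b - a) * \<Delta>"
      using \<open>a \<le> b\<close> unfolding diff \<Delta>_def norm_mult norm_of_real by simp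
    have tri: "cmod (reflect_log X2 - reflect_log X1) \<le> cmod (reflect_log (log_path a) - reflect_log (log_path 0))
        + (b - a) * \<Delta> + cmod (reflect_log (log_path 1) - reflect_log (log_path b))"
      unfolding 3[symmetric] ends
      using norm_triangle_ineq[of "reflect_log (log_path a) - reflect_log X1" "reflect_log (log_path b) - reflect_log (log_path a)"]
        norm_triangle_ineq[of "reflect_log (log_path b) - reflect_log X1" "reflect_log X2 - reflect_log (log_path b)"]
      by simp
    have sum: "a * \<Delta> + (b - a) * \<Delta> + (1 - b) * \<Delta> = \<Delta>" by (simp add: algebra_simps)
    have "a > 0 \<or> b < 1"
    proof (rule ccontr)
      assume "\<not> (a > 0 \<or> b < 1)"
      then have "a = 0" "b = 1" using ab by auto
      then have "0 \<in> C" "1 \<in> C" using cd by (auto simp: a_def b_def)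
      then show False using assms ends by (auto simp: C_def)
    qed
    then show ?thesis using A1 A2 B1 B2 tri sum unfolding \<Delta>_def[symmetric] by linarith
  qed
qed

end

text \<open>The angles of a = 1 - s w and \<open>b\<close> are compared through the sines of their
  difference and sum, which up to the factor |a| |b| are Im (a \<open>cnj b\<close>) and Im (a b)
  and have explicit signs. This keeps the logarithm of the ratio in a strip of height \<pi>.\<close>

lemma reflect_log_bounds:
  assumes w: "1 < cmod w" "Im w \<le> 0" and a: "1 - of_real s * w \<noteq> 0"
  defines "b \<equiv> 1 - of_real s / cnj w"
  shows "0 \<le> Im (Ln b)" "Im (Ln b) < pi / 2"
    and "Im (Ln b) \<le> Im (Ln (1 - of_real s * w))" "Im (Ln (1 - of_real s * w)) + Im (Ln b) \<le> pi"
    and "Im w < 0 \<Longrightarrow> Im (Ln b) < Im (Ln (1 - of_real s * w))"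
    and "Im w < 0 \<Longrightarrow> Im (Ln (1 - of_real s * w)) + Im (Ln b) < pi"
proof -
  define a' where "a' = 1 - of_real s * w"
  define N where "N = (cmod w)\<^sup>2"
  have N: "N > 1" using w by (simp add: N_def one_less_power)
  have b0: "0 < Re b" using reflected_base_pos[OF s, of "cnj w"] w by (simp add: b_def)
  have bnz: "b \<noteq> 0" using b0 by auto
  have sw: "of_real s / cnj w = of_real (s / N) * w"
    using w complex_norm_square[of w] by (auto simp: N_def field_simps)
  have beq: "Re b = 1 - s / N * Re w" "Im b = - (s / N * Im w)" unfolding b_def sw by simp_all
  have aeq: "Re a' = 1 - s * Re w" "Im a' = - (s * Im w)" unfolding a'_def by simp_all
  have N2: "N = Re w * Re w + Im w * Im w" unfolding N_def cmod_power2 by (simp add: power2_eq_square)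
  have Imb: "0 \<le> Im b" unfolding beq using s w N mult_nonneg_nonpos[of "s / N" "Im w"] by simp
  have Ima: "0 \<le> Im a'" unfolding aeq using s w by (simp add: mult_nonneg_nonpos)
  show b1: "0 \<le> Im (Ln b)" using Im_Ln_pos_le[OF bnz] Imb by simp
  show b2: "Im (Ln b) < pi / 2" using Re_Ln_pos_lt[OF bnz] b0 by simp
  have a1: "0 \<le> Im (Ln a')" "Im (Ln a') \<le> pi"
    using Im_Ln_pos_le[of a'] Ima a by (auto simp: a'_def)
  have polar: "Re u = cmod u * cos (Im (Ln u))" "Im u = cmod u * sin (Im (Ln u))" if "u \<noteq> 0" for u
    using that Re_exp[of "Ln u"] Im_exp[of "Ln u"] by simp_all
  have nn: "0 < cmod a' * cmod b" using a bnz by (simp add: a'_def)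
  have sin_diff: "cmod a' * cmod b * sin (Im (Ln a') - Im (Ln b)) = Im a' * Re b - Re a' * Im b"
    unfolding polar[OF bnz] polar[OF a[folded a'_def]] sin_diff by (simp add: algebra_simps)
  have sin_sum: "cmod a' * cmod b * sin (Im (Ln a') + Im (Ln b)) = Im a' * Re b + Re a' * Im b"
    unfolding polar[OF bnz] polar[OF a[folded a'_def]] sin_add by (simp add: algebra_simps)
  have d: "Im a' * Re b - Re a' * Im b = - Im w * (s * (1 - 1 / N))"
    unfolding aeq beq using N by (simp add: field_simps)
  have e: "Im a' * Re b + Re a' * Im b = - Im w * (s / N * (N + 1 - 2 * s * Re w))"
    unfolding aeq beq using N by (simp add: field_simps)
  have d': "0 < s * (1 - 1 / N)" using s N by simp
  have e': "0 < s / N * (N + 1 - 2 * s * Re w)"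
  proof -
    have "2 * (s * Re w) \<le> 2 * cmod w"
    proof -
      have "s * Re w \<le> s * cmod w" using s complex_Re_le_cmod[of w] by (intro mult_left_mono) auto
      also have "\<dots> \<le> 1 * cmod w" using s by (intro mult_right_mono) auto
      finally show ?thesis by simp
    qed
    moreover have "0 < (cmod w - 1)\<^sup>2" using w by simp
    then have "2 * cmod w < N + 1" by (simp add: N_def power2_eq_square algebra_simps)
    ultimately have "0 < N + 1 - 2 * s * Re w" by linarith
    then show ?thesis using s N by (intro mult_pos_pos divide_pos_pos) auto
  qed
  have D0: "0 \<le> sin (Im (Ln a') - Im (Ln b))"
  proof -
    have "0 \<le> cmod a' * cmod b * sin (Im (Ln a') - Im (Ln b))"
      unfolding sin_diff d using w by (intro mult_nonneg_nonneg less_imp_le[OF d']) simp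
    then show ?thesis using nn by (simp add: zero_le_mult_iff)
  qed
  have E0: "0 \<le> sin (Im (Ln a') + Im (Ln b))"
  proof -
    have "0 \<le> cmod a' * cmod b * sin (Im (Ln a') + Im (Ln b))"
      unfolding sin_sum e using w by (intro mult_nonneg_nonneg less_imp_le[OF e']) simp
    then show ?thesis using nn by (simp add: zero_le_mult_iff)
  qed
  show L: "Im (Ln b) \<le> Im (Ln (1 - of_real s * w))"
  proof (rule ccontr)
    assume "\<not> ?thesis"
    then have "0 < sin (Im (Ln b) - Im (Ln a'))"
      using a1 b1 b2 pi_gt_zero unfolding a'_def[symmetric] by (intro sin_gt_zero) linarith+
    then show False using D0 sin_minus[of "Im (Ln b) - Im (Ln a')"] by simp
  qed
  show U: "Im (Ln (1 - of_real s * w)) + Im (Ln b) \<le> pi"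
  proof (rule ccontr)
    assume "\<not> ?thesis"
    then have "sin (Im (Ln a') + Im (Ln b)) < 0"
      using a1 b1 b2 pi_gt_zero unfolding a'_def[symmetric] by (intro sin_lt_zero) linarith+
    then show False using E0 by simp
  qed
  assume neg: "Im w < 0"
  have "0 < cmod a' * cmod b * sin (Im (Ln a') - Im (Ln b))"
    unfolding sin_diff d using neg by (intro mult_pos_pos d') simp
  then show "Im (Ln b) < Im (Ln (1 - of_real s * w))"
    using L unfolding a'_def[symmetric] by (cases "Im (Ln a') = Im (Ln b)") auto
  have "0 < cmod a' * cmod b * sin (Im (Ln a') + Im (Ln b))"
    unfolding sin_sum e using neg by (intro mult_pos_pos e') simp
  then show "Im (Ln (1 - of_real s * w)) + Im (Ln b) < pi"
    using U unfolding a'_def[symmetric] by (cases "Im (Ln a') + Im (Ln b) = pi") auto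
qed

context
  fixes e :: real
  assumes e: "0 < e" "e \<le> 2"
begin

lemma coordinate_ratio_eq_0_iff: "coordinate_ratio e s w = 0 \<longleftrightarrow> w = of_real (1 / s)"
proof -
  have nz: "1 - of_real s * w \<noteq> 0" if "cmod w \<le> 1" by (rule nonzero_if_Re_pos[OF base_pos[OF s that]])
  have nz': "1 - of_real s / cnj w \<noteq> 0" if "\<not> cmod w \<le> 1"
    using reflected_base_pos[OF s, of "cnj w"] that by auto
  have "1 - of_real s * w = 0 \<longleftrightarrow> w = of_real (1 / s)" using s by (auto simp: field_simps)
  then show ?thesis using nz nz' by (auto simp: coordinate_ratio_def)
qed

text \<open>Because -1 < e - 1 \<le> 1, the imaginary part lies between the difference and the sum
  of the two angles, hence in [0, \<pi>]. There \<open>exp\<close> is injective and takes values in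
  the closed upper half plane.\<close>

lemma coordinate_ratio_exp:
  assumes w: "Im w \<le> 0" "w \<noteq> of_real (1 / s)"
  obtains X where "0 \<le> Im X" "Im X \<le> pi" "from_log X = w"
    and "coordinate_ratio e s w = exp (X + of_real (e - 1) * reflect_log X)"
    and "0 \<le> Im (X + of_real (e - 1) * reflect_log X)" "Im (X + of_real (e - 1) * reflect_log X) \<le> pi"
    and "Im w < 0 \<Longrightarrow> 0 < Im (X + of_real (e - 1) * reflect_log X)"
    and "Im w < 0 \<Longrightarrow> Im (X + of_real (e - 1) * reflect_log X) < pi"
proof -
  define a where "a = 1 - of_real s * w"
  have a0: "a \<noteq> 0" using w s by (auto simp: a_def field_simps)
  define X where "X = Ln a"
  have Ima: "0 \<le> Im a" "Im w < 0 \<Longrightarrow> 0 < Im a"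
    using w s by (auto simp: a_def mult_nonneg_nonpos mult_pos_neg)
  have X: "0 \<le> Im X" "Im X \<le> pi" using Im_Ln_pos_le[OF a0] Ima by (auto simp: X_def)
  have fX: "from_log X = w" using a0 s by (simp add: X_def from_log_def a_def)
  let ?U = "X + of_real (e - 1) * reflect_log X"
  have "coordinate_ratio e s w = exp ?U \<and> 0 \<le> Im ?U \<and> Im ?U \<le> pi \<and> (Im w < 0 \<longrightarrow> 0 < Im ?U \<and> Im ?U < pi)"
  proof (cases "cmod w \<le> 1")
    case True
    then have "0 < Re a" using base_pos[OF s] by (simp add: a_def)
    then have X2: "Im X < pi / 2" using Re_Ln_pos_lt[OF a0] X by (simp add: X_def)
    have U: "?U = of_real e * X" using True by (simp add: reflect_log_def fX algebra_simps)
    have ImU: "Im ?U = e * Im X" unfolding U by simp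
    have "e * Im X \<le> 2 * Im X" using e X by (intro mult_right_mono) auto
    then have lt: "Im ?U < pi" unfolding ImU using X2 by simp
    have "0 < Im ?U" if "Im w < 0"
      unfolding ImU using Im_Ln_pos_lt[OF a0] Ima(2)[OF that] e by (simp add: X_def)
    moreover have "0 \<le> Im ?U" unfolding ImU using e X by simp
    moreover have "coordinate_ratio e s w = exp ?U"
      unfolding U using True a0 by (simp add: coordinate_ratio_def powr_def X_def a_def)
    ultimately show ?thesis using lt less_imp_le by blast
  next
    case False
    define b where "b = 1 - of_real s / cnj w"
    have b0: "b \<noteq> 0" using reflected_base_pos[OF s, of "cnj w"] False by (auto simp: b_def)
    have rX: "reflect_log X = Ln b" using False by (simp add: reflect_log_def fX b_def)
    have "coordinate_ratio e s w = a * b powr of_real (e - 1)"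
      using False by (simp add: coordinate_ratio_def a_def b_def)
    also have "\<dots> = exp X * exp (of_real (e - 1) * Ln b)" using a0 b0 by (simp add: powr_def X_def)
    also have "\<dots> = exp ?U" by (simp only: rX exp_add)
    finally have 1: "coordinate_ratio e s w = exp ?U" .
    have ImU: "Im ?U = Im X + (e - 1) * Im (Ln b)" by (simp add: rX)
    have w1: "1 < cmod w" using False by simp
    note B = reflect_log_bounds[OF w1 w(1) a0[unfolded a_def], folded a_def b_def, folded X_def]
    have le: "(e - 1) * Im (Ln b) \<le> 1 * Im (Ln b)" "(- 1) * Im (Ln b) \<le> (e - 1) * Im (Ln b)"
      using e B(1) by (intro mult_right_mono; simp)+
    show ?thesis using 1 le B unfolding ImU by auto
  qed
  then show thesis using that[OF X fX] by auto
qed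

text \<open>Equal ratios give X2 - X1 = -(e - 1) (\<open>reflect_log X2 - reflect_log X1\<close>).
  Strict contraction is essential for \<open>e = 2\<close>, that is \<open>p = 1\<close>, where |e -
  1| = 1. If both points lie in the closed disc, \<open>reflect_log\<close> is the identity and
  \<open>e \<noteq> 0\<close> decides.\<close>

lemma coordinate_ratio_inj_lower:
  assumes w: "Im w1 \<le> 0" "Im w2 \<le> 0" and eq: "coordinate_ratio e s w1 = coordinate_ratio e s w2"
  shows "w1 = w2"
proof (cases "w1 = of_real (1 / s) \<or> w2 = of_real (1 / s)")
  case True
  then show ?thesis using coordinate_ratio_eq_0_iff eq by metis
next
  case False
  obtain X1 where X1: "0 \<le> Im X1" "Im X1 \<le> pi" "from_log X1 = w1"
    "coordinate_ratio e s w1 = exp (X1 + of_real (e - 1) * reflect_log X1)"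
    "0 \<le> Im (X1 + of_real (e - 1) * reflect_log X1)" "Im (X1 + of_real (e - 1) * reflect_log X1) \<le> pi"
    using coordinate_ratio_exp[OF w(1)] False by metis
  obtain X2 where X2: "0 \<le> Im X2" "Im X2 \<le> pi" "from_log X2 = w2"
    "coordinate_ratio e s w2 = exp (X2 + of_real (e - 1) * reflect_log X2)"
    "0 \<le> Im (X2 + of_real (e - 1) * reflect_log X2)" "Im (X2 + of_real (e - 1) * reflect_log X2) \<le> pi"
    using coordinate_ratio_exp[OF w(2)] False by metis
  have "exp (X1 + of_real (e - 1) * reflect_log X1) = exp (X2 + of_real (e - 1) * reflect_log X2)"
    using eq unfolding X1(4) X2(4) .
  moreover have "\<bar>Im (X1 + of_real (e - 1) * reflect_log X1) - Im (X2 + of_real (e - 1) * reflect_log X2)\<bar> < 2 * pi"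
    using X1(5,6) X2(5,6) pi_gt_zero by linarith
  ultimately have "X1 + of_real (e - 1) * reflect_log X1 = X2 + of_real (e - 1) * reflect_log X2"
    by (rule exp_complex_eqI[rotated])
  then have U: "X2 - X1 = - of_real (e - 1) * (reflect_log X2 - reflect_log X1)"
    by (simp add: algebra_simps)
  have "X1 = X2"
  proof (rule ccontr)
    assume ne: "X1 \<noteq> X2"
    show False
    proof (cases "cmod (from_log X1) \<le> 1 \<and> cmod (from_log X2) \<le> 1")
      case True
      then have "X2 - X1 = - of_real (e - 1) * (X2 - X1)" using U by (simp add: reflect_log_def)
      then have "of_real e * (X2 - X1) = 0" by (simp add: algebra_simps)
      then show False using ne e by simp
    next
      case False
      have "cmod (X2 - X1) = \<bar>e - 1\<bar> * cmod (reflect_log X2 - reflect_log X1)"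
        by (subst U) (simp only: norm_mult norm_minus_cancel norm_of_real)
      also have "\<dots> \<le> 1 * cmod (reflect_log X2 - reflect_log X1)"
        using e by (intro mult_right_mono) auto
      also have "\<dots> < cmod (X2 - X1)"
        using reflect_log_contraction[OF X1(1,2) X2(1,2) ne False] by simp
      finally show False by simp
    qed
  qed
  then show ?thesis using X1 X2 by simp
qed

lemma coordinate_ratio_cnj: "coordinate_ratio e s (cnj w) = cnj (coordinate_ratio e s w)"
proof (cases "cmod w \<le> 1")
  case True
  have "cnj ((1 - of_real s * w) powr of_real e) = cnj (1 - of_real s * w) powr cnj (of_real e)"
    using base_pos[OF s True] by (intro cnj_powr) linarith
  then show ?thesis using True by (simp add: coordinate_ratio_def cnj_powr)
next
  case False
  have "cnj ((1 - of_real s / cnj w) powr of_real (e - 1)) = cnj (1 - of_real s / cnj w) powr cnj (of_real (e - 1))"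
    using reflected_base_pos[OF s, of "cnj w"] False by (intro cnj_powr) simp
  then show ?thesis using False by (simp add: coordinate_ratio_def)
qed

lemma coordinate_ratio_Im:
  assumes w: "Im w \<le> 0"
  shows "0 \<le> Im (coordinate_ratio e s w)" "Im w < 0 \<Longrightarrow> 0 < Im (coordinate_ratio e s w)"
proof -
  have "0 \<le> Im (coordinate_ratio e s w) \<and> (Im w < 0 \<longrightarrow> 0 < Im (coordinate_ratio e s w))"
  proof (cases "w = of_real (1 / s)")
    case True
    then have "coordinate_ratio e s w = 0" using coordinate_ratio_eq_0_iff by blast
    then show ?thesis using True by simp
  next
    case False
    then obtain X where X: "coordinate_ratio e s w = exp (X + of_real (e - 1) * reflect_log X)"
      "0 \<le> Im (X + of_real (e - 1) * reflect_log X)" "Im (X + of_real (e - 1) * reflect_log X) \<le> pi"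
      "Im w < 0 \<Longrightarrow> 0 < Im (X + of_real (e - 1) * reflect_log X)"
      "Im w < 0 \<Longrightarrow> Im (X + of_real (e - 1) * reflect_log X) < pi"
      using coordinate_ratio_exp[OF w] by metis
    then show ?thesis unfolding X(1) Im_exp by (auto intro!: mult_nonneg_nonneg mult_pos_pos sin_ge_zero sin_gt_zero)
  qed
  then show "0 \<le> Im (coordinate_ratio e s w)" "Im w < 0 \<Longrightarrow> 0 < Im (coordinate_ratio e s w)" by auto
qed

text \<open>The closed lower half plane goes to the closed upper one, and by conjugation the open
  upper one to the open lower one, so points from different sides cannot collide.\<close>

lemma inj_coordinate_ratio: "inj (coordinate_ratio e s)"
proof (rule injI)
  fix w1 w2 assume eq: "coordinate_ratio e s w1 = coordinate_ratio e s w2"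
  have upper: "Im (coordinate_ratio e s w) < 0" if "Im w > 0" for w
    using coordinate_ratio_Im(2)[of "cnj w"] that by (simp add: coordinate_ratio_cnj)
  consider "Im w1 \<le> 0" "Im w2 \<le> 0" | "Im w1 > 0" "Im w2 > 0" | "Im w1 \<le> 0" "Im w2 > 0" | "Im w1 > 0" "Im w2 \<le> 0"
    by linarith
  then show "w1 = w2"
  proof cases
    case 1
    then show ?thesis using coordinate_ratio_inj_lower eq by blast
  next
    case 2
    have "coordinate_ratio e s (cnj w1) = coordinate_ratio e s (cnj w2)" using eq by (simp only: coordinate_ratio_cnj)
    from coordinate_ratio_inj_lower[OF _ _ this] show ?thesis using 2 by simp
  next
    case 3
    then show ?thesis using coordinate_ratio_Im(1)[of w1] upper[of w2] eq by simp
  next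
    case 4
    then show ?thesis using coordinate_ratio_Im(1)[of w2] upper[of w1] eq by simp
  qed
qed

end

end

section \<open>Surjectivity of the ratio and continuity of its inverse\<close>

lemma continuous_on_coordinate_ratio:
  assumes e: "0 < e"
  shows "continuous_on ({0<..<1} \<times> UNIV) (\<lambda>(s, w). coordinate_ratio e s w)"
proof -
  let ?S = "{0<..<1::real} \<times> (UNIV :: complex set)"
  let ?f = "\<lambda>x. (1 - of_real (fst x) * snd x) powr complex_of_real e"
  let ?g = "\<lambda>x. (1 - of_real (fst x) * snd x) * (1 - of_real (fst x) / cnj (snd x)) powr complex_of_real (e - 1)"
  have f: "continuous_on {x \<in> ?S. cmod (snd x) \<le> 1} ?f"
  proof (rule continuous_on_powr_complex)
    show "{x \<in> ?S. cmod (snd x) \<le> 1} \<subseteq> {x. 0 \<le> Re (1 - complex_of_real (fst x) * snd x) \<or> Im (1 - complex_of_real (fst x) * snd x) \<noteq> 0}"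
    proof
      fix x assume "x \<in> {x \<in> ?S. cmod (snd x) \<le> 1}"
      then have "0 < Re (1 - complex_of_real (fst x) * snd x)" by (intro base_pos) auto
      then show "x \<in> {x. 0 \<le> Re (1 - complex_of_real (fst x) * snd x) \<or> Im (1 - complex_of_real (fst x) * snd x) \<noteq> 0}"
        by simp
    qed
  qed (use e in \<open>auto intro!: continuous_intros\<close>)
  have b: "0 < Re (1 - complex_of_real (fst x) / cnj (snd x))" if "x \<in> {x \<in> ?S. 1 \<le> cmod (snd x)}" for x
    using that by (intro reflected_base_pos) auto
  have g: "continuous_on {x \<in> ?S. 1 \<le> cmod (snd x)} ?g"
  proof (intro continuous_on_mult continuous_on_powr_complex)
    show "{x \<in> ?S. 1 \<le> cmod (snd x)} \<subseteq> {x. 0 \<le> Re (1 - complex_of_real (fst x) / cnj (snd x)) \<or> Im (1 - complex_of_real (fst x) / cnj (snd x)) \<noteq> 0}"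
      using b less_imp_le by blast
    show "0 < Re (complex_of_real (e - 1))" if "x \<in> {x \<in> ?S. 1 \<le> cmod (snd x)}" "1 - complex_of_real (fst x) / cnj (snd x) = 0" for x
      using nonzero_if_Re_pos[OF b[OF that(1)]] that(2) by contradiction
  qed (auto intro!: continuous_intros)
  have h: "continuous_on ?S (\<lambda>x. cmod (snd x))" by (intro continuous_intros)
  have agree: "?f x = ?g x" if x: "x \<in> ?S" "cmod (snd x) = 1" for x
  proof -
    define a where "a = 1 - complex_of_real (fst x) * snd x"
    have "a \<noteq> 0" unfolding a_def using x by (intro nonzero_if_Re_pos base_pos) auto
    moreover have "complex_of_real e = 1 + complex_of_real (e - 1)" by simp
    ultimately have "a powr complex_of_real e = a * a powr complex_of_real (e - 1)"
      by (metis powr_add powr_to_1)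
    then show ?thesis unfolding inverse_cnj_unit[OF x(2)] a_def .
  qed
  from continuous_on_cases_le[OF f g h agree]
  show ?thesis by (simp add: coordinate_ratio_def case_prod_beta)
qed

text \<open>The range is open by invariance of domain and closed because the map is proper, hence it
  is the whole plane.\<close>

lemma surj_coordinate_ratio:
  assumes s: "0 < s" "s < 1" and e: "0 < e" "e \<le> 2"
  shows "surj (coordinate_ratio e s)"
proof -
  let ?R = "coordinate_ratio e s"
  have "continuous_on UNIV (\<lambda>w :: complex. (s, w))" by (intro continuous_on_Pair continuous_on_const continuous_on_id)
  moreover have "range (\<lambda>w :: complex. (s, w)) \<subseteq> {0<..<1} \<times> UNIV" using s by auto
  ultimately have cont: "continuous_on UNIV ?R"
    using continuous_on_compose2[OF continuous_on_coordinate_ratio[OF e(1)]] by fastforce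
  have "open (range ?R)"
    using invariance_of_domain[OF cont open_UNIV] inj_coordinate_ratio[OF s e] by simp
  moreover have "closed (range ?R)"
  proof -
    \<comment> \<open>A lower bound for |b| powr (e - 1) with |b| between 1 - s and 1 + s; the
      minimum covers both signs of \<open>e - 1\<close>.\<close>
    define m where "m = min ((1 - s) powr (e - 1)) ((1 + s) powr (e - 1))"
    have m: "m > 0" using s by (simp add: m_def)
    have bound: "cmod w \<le> max 1 ((B / m + 1) / s)" if "cmod (?R w) \<le> B" for w B
    proof (cases "cmod w \<le> 1")
      case False
      define b where "b = 1 - of_real s / cnj w"
      have "cmod (of_real s / cnj w) \<le> s / 1" unfolding norm_divide using s False by (intro frac_le) auto
      then have b: "1 - s \<le> cmod b" "cmod b \<le> 1 + s"
        using norm_triangle_ineq2[of 1 "of_real s / cnj w"] norm_triangle_ineq4[of 1 "of_real s / cnj w"] by (auto simp: b_def)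
      have "m \<le> cmod b powr (e - 1)"
      proof (cases "e \<ge> 1")
        case True
        then have "(1 - s) powr (e - 1) \<le> cmod b powr (e - 1)" using b s by (intro powr_mono2) auto
        then show ?thesis by (simp add: m_def)
      next
        case False
        then have "(1 + s) powr (e - 1) \<le> cmod b powr (e - 1)" using b s by (intro powr_mono2') auto
        then show ?thesis by (simp add: m_def)
      qed
      moreover have "s * cmod w - 1 \<le> cmod (1 - of_real s * w)"
        using norm_triangle_ineq2[of "of_real s * w" 1] s by (simp add: norm_mult norm_minus_commute)
      ultimately have "(s * cmod w - 1) * m \<le> cmod (1 - of_real s * w) * cmod b powr (e - 1)"
        using m by (intro order_trans[OF mult_right_mono mult_left_mono]) auto
      also have "\<dots> = cmod (?R w)"
        using False by (simp add: coordinate_ratio_def norm_mult b_def norm_powr_of_real del: of_real_diff)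
      also have "\<dots> \<le> B" by fact
      finally have "cmod w \<le> (B / m + 1) / s" using m s by (simp add: field_simps)
      then show ?thesis by simp
    qed simp
    have "l \<in> range ?R" if l: "l \<in> closure (range ?R)" for l
    proof -
      define K where "K = ?R ` cball 0 (max 1 (((cmod l + 1) / m + 1) / s))"
      have "compact K" unfolding K_def
        by (intro compact_continuous_image continuous_on_subset[OF cont]) auto
      have "range ?R \<inter> ball l 1 \<subseteq> K"
      proof
        fix y assume "y \<in> range ?R \<inter> ball l 1"
        then obtain w where w: "y = ?R w" "dist l y < 1" by auto
        have "cmod y \<le> cmod l + 1" using w(2) norm_triangle_sub[of y l] by (simp add: dist_norm norm_minus_commute)
        then show "y \<in> K" using bound[of w "cmod l + 1"] w by (auto simp: K_def)
      qed
      moreover have "l \<in> closure (range ?R \<inter> ball l 1)"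
        using open_Int_closure_subset[of "ball l 1" "range ?R"] l by (auto simp: Int_commute)
      ultimately have "l \<in> K"
        using closure_mono[of "range ?R \<inter> ball l 1" K] compact_imp_closed[OF \<open>compact K\<close>] by auto
      then show ?thesis by (auto simp: K_def)
    qed
    then show ?thesis using closure_subset_eq by blast
  qed
  ultimately have "range ?R = {} \<or> range ?R = UNIV" by (rule clopen[THEN iffD1, OF conjI, rotated])
  then show ?thesis by auto
qed

text \<open>Keeping \<open>s\<close> as an extra coordinate turns the family into one injective map
  of \<open>real \<times> complex\<close>, whose inverse is continuous in both variables by
  invariance of domain.\<close>

lemma continuous_on_inv_coordinate_ratio:
  assumes e: "0 < e" "e \<le> 2"
  shows "continuous_on ({0<..<1} \<times> UNIV) (\<lambda>(s, v). inv (coordinate_ratio e s) v)"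
proof -
  let ?S = "{0<..<1::real} \<times> (UNIV :: complex set)"
  let ?f = "\<lambda>x. (fst x, coordinate_ratio e (fst x) (snd x))"
  let ?g = "\<lambda>x. (fst x, inv (coordinate_ratio e (fst x)) (snd x))"
  have "continuous_on (?f ` ?S) ?g"
  proof (rule continuous_on_inverse_open)
    show "open ?S" by (intro open_Times) auto
    show "continuous_on ?S ?f"
      using continuous_on_coordinate_ratio[OF e(1)] by (intro continuous_on_Pair continuous_intros) (simp add: case_prod_beta)
    show "?g (?f x) = x" if "x \<in> ?S" for x
      using inj_coordinate_ratio[of "fst x" e] that e by (auto simp: inv_f_f)
  qed simp
  moreover have "?f ` ?S = ?S"
  proof -
    have "(t, v) \<in> ?f ` ?S" if t: "0 < t" "t < 1" for t v
    proof -
      obtain w where "v = coordinate_ratio e t w" using surj_coordinate_ratio[OF t e] by (metis surjD)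
      then show ?thesis using t by (intro image_eqI[of _ _ "(t, w)"]) auto
    qed
    then show ?thesis by auto
  qed
  ultimately have "continuous_on ?S (\<lambda>x. snd (?g x))" by (intro continuous_on_snd) simp
  then show ?thesis by (simp add: case_prod_beta)
qed

section \<open>The data of one coordinate as functions of \<open>s\<close> and \<gamma>\<close>

definition coord_point :: "real \<Rightarrow> real \<Rightarrow> complex \<Rightarrow> complex \<Rightarrow> complex \<Rightarrow> complex" where
  "coord_point p s \<gamma> a b =
     inv (coordinate_ratio (2 / p) s) (b / a * (1 - cnj \<gamma> * of_real s) powr of_real (2 / p))"

text \<open>The case \<open>a = 0\<close> is the limit of \<open>w\<close> at infinity: the zero of
  the Moebius factor moves to 0.\<close>

definition coord_alpha :: "real \<Rightarrow> real \<Rightarrow> complex \<Rightarrow> complex \<Rightarrow> complex \<Rightarrow> complex" where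
  "coord_alpha p s \<gamma> a b =
     (if a = 0 then 0
      else if cmod (coord_point p s \<gamma> a b) \<le> 1 then cnj (coord_point p s \<gamma> a b)
      else 1 / coord_point p s \<gamma> a b)"

text \<open>Solves the condition at 0, where the disc has the value c (-\<alpha>)^\<beta>. If
  \<open>a = 0\<close> that condition is void and the value at \<open>s\<close> determines
  \<open>c\<close>.\<close>

definition coord_c :: "real \<Rightarrow> real \<Rightarrow> complex \<Rightarrow> complex \<Rightarrow> complex \<Rightarrow> complex" where
  "coord_c p s \<gamma> a b =
     (if a = 0 then b * (1 - cnj \<gamma> * of_real s) powr of_real (2 / p) / of_real s
      else if cmod (coord_point p s \<gamma> a b) \<le> 1 then a
      else - a * coord_point p s \<gamma> a b)"

definition coord_beta :: "real \<Rightarrow> real \<Rightarrow> complex \<Rightarrow> complex \<Rightarrow> complex \<Rightarrow> nat" where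
  "coord_beta p s \<gamma> a b = (if a \<noteq> 0 \<and> cmod (coord_point p s \<gamma> a b) \<le> 1 then 0 else 1)"

lemma coord_beta_01: "coord_beta p s \<gamma> a b \<in> {0, 1}"
  by (simp add: coord_beta_def)

lemma coord_alpha_le_1: "cmod (coord_alpha p s \<gamma> a b) \<le> 1"
  by (auto simp: coord_alpha_def norm_divide divide_le_eq)

text \<open>The borderline |w| = 1 is assigned to \<beta> = 0, the choice under which the disc
  extends continuously.\<close>

lemma coord_beta_0: "cmod (coord_alpha p s \<gamma> a b) = 1 \<Longrightarrow> coord_beta p s \<gamma> a b = 0"
  by (auto simp: coord_alpha_def coord_beta_def norm_divide split: if_splits)

lemma two_div_bounds:
  fixes p :: real
  assumes "1 \<le> p"
  shows "0 < 2 / p" "2 / p \<le> 2"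
  using assms by (auto simp: field_simps)

text \<open>\<gamma> may lie on the circle here, since Brouwer's theorem works on a compact
  parameter set; \<open>s < 1\<close> keeps the denominator away from 0.\<close>

lemma extremal_disc_coord:
  assumes p: "1 \<le> p" and s: "0 < s" "s < 1" and \<gamma>: "cmod \<gamma> \<le> 1"
    and \<alpha>: "\<alpha> j = coord_alpha p s \<gamma> a b" and c: "c j = coord_c p s \<gamma> a b" and \<beta>: "\<beta> j = coord_beta p s \<gamma> a b"
  shows "extremal_disc p \<gamma> \<alpha> c \<beta> 0 j = a" "extremal_disc p \<gamma> \<alpha> c \<beta> (of_real s) j = b"
proof -
  define g where "g = (1 - cnj \<gamma> * of_real s) powr complex_of_real (2 / p)"
  have "0 < Re (1 - cnj \<gamma> * of_real s)"
    using s \<gamma> norm_mult_less_1[of \<gamma> "of_real s"] by (intro Re_one_minus_cnj_pos) auto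
  then have g0: "g \<noteq> 0" unfolding g_def using nonzero_if_Re_pos by (metis powr_eq_0_iff)
  show "extremal_disc p \<gamma> \<alpha> c \<beta> 0 j = a"
    by (auto simp: extremal_disc_def \<alpha> c \<beta> coord_alpha_def coord_c_def coord_beta_def)
  have D: "extremal_disc p \<gamma> \<alpha> c \<beta> (of_real s) j =
      c j * ((of_real s - \<alpha> j) / (1 - cnj (\<alpha> j) * of_real s)) ^ \<beta> j * ((1 - cnj (\<alpha> j) * of_real s) powr complex_of_real (2 / p) / g)"
    by (simp only: extremal_disc_def g_def)
  show "extremal_disc p \<gamma> \<alpha> c \<beta> (of_real s) j = b"
  proof (cases "a = 0")
    case True
    have "c j = b * g / of_real s" unfolding c coord_c_def g_def using True by simp
    moreover have "\<alpha> j = 0" "\<beta> j = 1" using True by (simp_all add: \<alpha> \<beta> coord_alpha_def coord_beta_def)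
    ultimately show ?thesis unfolding D using s g0 by simp
  next
    case False
    define w where "w = coord_point p s \<gamma> a b"
    have "coordinate_ratio (2 / p) s w = b / a * g"
      unfolding w_def coord_point_def g_def
      by (rule surj_f_inv_f[OF surj_coordinate_ratio[OF s two_div_bounds[OF p]]])
    then have b: "b = a * coordinate_ratio (2 / p) s w / g" using False g0 by (simp add: field_simps)
    show ?thesis
    proof (cases "cmod w \<le> 1")
      case True
      then have "\<alpha> j = cnj w" "c j = a" "\<beta> j = 0"
        using False by (simp_all add: \<alpha> c \<beta> coord_alpha_def coord_c_def coord_beta_def flip: w_def)
      then show ?thesis unfolding D using True by (simp add: b coordinate_ratio_def mult.commute)
    next
      case w1: False
      define d where "d = 1 - of_real s / cnj w"
      have d0: "d \<noteq> 0" unfolding d_def using w1 by (intro nonzero_if_Re_pos reflected_base_pos[OF s]) simp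
      have w0: "w \<noteq> 0" using w1 by auto
      have \<alpha>w: "\<alpha> j = 1 / w" "c j = - a * w" "\<beta> j = 1"
        using False w1 by (simp_all add: \<alpha> c \<beta> coord_alpha_def coord_c_def coord_beta_def flip: w_def)
      have dd: "1 - cnj (\<alpha> j) * of_real s = d" by (simp add: \<alpha>w d_def)
      have "complex_of_real (2 / p) = complex_of_real (2 / p - 1) + 1" by simp
      then have dp: "d powr complex_of_real (2 / p) = d powr complex_of_real (2 / p - 1) * d"
        by (metis powr_add powr_to_1)
      have "extremal_disc p \<gamma> \<alpha> c \<beta> (of_real s) j = - a * w * ((of_real s - 1 / w) / d) * (d powr complex_of_real (2 / p - 1) * d / g)"
        unfolding D dd dp[symmetric] by (simp add: \<alpha>w)
      also have "\<dots> = a * ((1 - of_real s * w) * d powr complex_of_real (2 / p - 1)) / g"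
        using d0 w0 g0 by (simp add: field_simps)
      also have "\<dots> = b" using w1 by (simp add: b coordinate_ratio_def d_def)
      finally show ?thesis .
    qed
  qed
qed

text \<open>\<open>coord_P\<close> and \<open>coord_Q\<close> are the terms of the two sums in the
  extremal data.\<close>

definition coord_P :: "real \<Rightarrow> real \<Rightarrow> complex \<Rightarrow> complex \<Rightarrow> complex \<Rightarrow> real" where
  "coord_P p s \<gamma> a b = cmod (coord_c p s \<gamma> a b) powr p * (1 + (cmod (coord_alpha p s \<gamma> a b))\<^sup>2)"

definition coord_Q :: "real \<Rightarrow> real \<Rightarrow> complex \<Rightarrow> complex \<Rightarrow> complex \<Rightarrow> complex" where
  "coord_Q p s \<gamma> a b = complex_of_real (cmod (coord_c p s \<gamma> a b) powr p) * coord_alpha p s \<gamma> a b"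

text \<open>\<open>c\<close> and \<beta> jump where |w| = 1, but these expressions depend on
  \<open>w\<close> through \<open>hP\<close> and \<open>hQ\<close>, whose two branches agree
  there.\<close>

lemma coord_continuous:
  assumes p: "1 \<le> p"
  shows "continuous_on ({0<..<1} \<times> cball 0 1) (\<lambda>x. coord_P p (fst x) (snd x) a b)"
    and "continuous_on ({0<..<1} \<times> cball 0 1) (\<lambda>x. coord_Q p (fst x) (snd x) a b)"
proof -
  let ?S = "{0<..<1::real} \<times> cball (0::complex) 1"
  let ?g = "\<lambda>x :: real \<times> complex. (1 - cnj (snd x) * of_real (fst x)) powr complex_of_real (2 / p)"
  have contg: "continuous_on ?S ?g"
  proof (rule continuous_on_powr_complex)
    show "?S \<subseteq> {x. 0 \<le> Re (1 - cnj (snd x) * of_real (fst x)) \<or> Im (1 - cnj (snd x) * of_real (fst x)) \<noteq> 0}"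
    proof
      fix x assume "x \<in> ?S"
      then have "0 < Re (1 - cnj (snd x) * of_real (fst x))"
        by (intro Re_one_minus_cnj_pos norm_mult_less_1) auto
      then show "x \<in> {x. 0 \<le> Re (1 - cnj (snd x) * of_real (fst x)) \<or> Im (1 - cnj (snd x) * of_real (fst x)) \<noteq> 0}" by simp
    qed
  qed (use two_div_bounds[OF p] in \<open>auto intro!: continuous_intros\<close>)
  have "continuous_on ?S (\<lambda>x. coord_P p (fst x) (snd x) a b) \<and> continuous_on ?S (\<lambda>x. coord_Q p (fst x) (snd x) a b)"
  proof (cases "a = 0")
    case True
    have "continuous_on ?S (\<lambda>x. cmod (b * ?g x / of_real (fst x)) powr p)"
      using p by (intro continuous_on_powr' continuous_on_norm continuous_on_divide continuous_on_mult
        continuous_on_const contg continuous_on_of_real continuous_on_fst continuous_on_id) auto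
    then show ?thesis using True by (simp add: coord_P_def coord_Q_def coord_c_def coord_alpha_def)
  next
    case False
    let ?w = "\<lambda>x. coord_point p (fst x) (snd x) a b"
    have "continuous_on ?S (\<lambda>x. (fst x, b / a * ?g x))"
      by (intro continuous_on_Pair continuous_on_mult continuous_on_const contg continuous_on_fst continuous_on_id)
    moreover have "(\<lambda>x. (fst x, b / a * ?g x)) ` ?S \<subseteq> {0<..<1} \<times> UNIV" by auto
    ultimately have contw: "continuous_on ?S ?w"
      using continuous_on_compose2[OF continuous_on_inv_coordinate_ratio[OF two_div_bounds[OF p]], of ?S "\<lambda>x. (fst x, b / a * ?g x)"]
      by (simp add: coord_point_def)
    define hP where "hP w = (if cmod w \<le> 1 then 1 + (cmod w)\<^sup>2 else cmod w powr p * (1 + (1 / cmod w)\<^sup>2))" for w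
    define hQ where "hQ w = (if cmod w \<le> 1 then cnj w else complex_of_real (cmod w powr p) / w)" for w
    have P1: "continuous_on {w \<in> UNIV. cmod w \<le> 1} (\<lambda>w. 1 + (cmod w)\<^sup>2)" by (intro continuous_intros)
    have P2: "continuous_on {w \<in> UNIV. 1 \<le> cmod w} (\<lambda>w. cmod w powr p * (1 + (1 / cmod w)\<^sup>2))"
      using p by (intro continuous_on_powr' continuous_intros) auto
    have Q1: "continuous_on {w \<in> UNIV. cmod w \<le> 1} cnj" by (intro continuous_intros)
    have Q2: "continuous_on {w \<in> UNIV. 1 \<le> cmod w} (\<lambda>w. complex_of_real (cmod w powr p) / w)"
      using p by (intro continuous_on_divide continuous_on_of_real continuous_on_powr' continuous_intros) auto
    have N: "continuous_on UNIV cmod" by (intro continuous_intros)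
    have "continuous_on UNIV hP"
      using continuous_on_cases_le[OF P1 P2 N] by (simp add: hP_def[abs_def])
    moreover have "continuous_on UNIV hQ"
    proof -
      have "cnj w = complex_of_real (cmod w powr p) / w" if "cmod w = 1" for w
        using inverse_cnj_unit[of "cnj w" 1] that by simp
      then show ?thesis using continuous_on_cases_le[OF Q1 Q2 N] by (simp add: hQ_def[abs_def])
    qed
    ultimately have "continuous_on ?S (\<lambda>x. hP (?w x))" "continuous_on ?S (\<lambda>x. hQ (?w x))"
      using continuous_on_compose2[OF _ contw] by blast+
    then have "continuous_on ?S (\<lambda>x. cmod a powr p * hP (?w x))" "continuous_on ?S (\<lambda>x. complex_of_real (cmod a powr p) * hQ (?w x))"
      by (intro continuous_on_mult continuous_on_const; simp)+
    moreover have "cmod a powr p * hP (?w x) = coord_P p (fst x) (snd x) a b"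
      "complex_of_real (cmod a powr p) * hQ (?w x) = coord_Q p (fst x) (snd x) a b" for x
      using False by (auto simp: coord_P_def coord_Q_def coord_c_def coord_alpha_def hP_def hQ_def norm_mult powr_mult norm_divide)
    ultimately show ?thesis by simp
  qed
  then show "continuous_on ?S (\<lambda>x. coord_P p (fst x) (snd x) a b)" "continuous_on ?S (\<lambda>x. coord_Q p (fst x) (snd x) a b)"
    by auto
qed

section \<open>Bounds that are uniform in the parameters\<close>

lemma coord_P_nonneg: "0 \<le> coord_P p s \<gamma> a b"
  by (simp add: coord_P_def)

text \<open>This inequality, 2r \<le> 1 + r^2 termwise, keeps the quotient of the two sums in the
  disc of radius 1/2.\<close>

lemma coord_Q_le: "cmod (coord_Q p s \<gamma> a b) \<le> coord_P p s \<gamma> a b / 2"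
proof -
  define r where "r = cmod (coord_alpha p s \<gamma> a b)"
  have "0 \<le> (1 - r)\<^sup>2" by simp
  then have "r \<le> (1 + r\<^sup>2) / 2" by (simp add: power2_eq_square algebra_simps)
  then have "cmod (coord_c p s \<gamma> a b) powr p * r \<le> cmod (coord_c p s \<gamma> a b) powr p * ((1 + r\<^sup>2) / 2)"
    by (intro mult_left_mono) auto
  then show ?thesis by (simp add: coord_P_def coord_Q_def norm_mult r_def)
qed

lemma coord_P_pos:
  assumes p: "1 \<le> p" and s: "0 < s" "s < 1" and \<gamma>: "cmod \<gamma> \<le> 1" and ne: "a \<noteq> b"
  shows "0 < coord_P p s \<gamma> a b"
proof -
  have "coord_c p s \<gamma> a b \<noteq> 0"
  proof
    assume c0: "coord_c p s \<gamma> a b = 0"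
    note E = extremal_disc_coord[OF p s \<gamma>, of "\<lambda>_. coord_alpha p s \<gamma> a b" 0 a b "\<lambda>_. coord_c p s \<gamma> a b" "\<lambda>_. coord_beta p s \<gamma> a b"]
    have "a = 0" using E(1) by (simp add: extremal_disc_def c0)
    moreover have "b = 0" using E(2) by (simp add: extremal_disc_def c0)
    ultimately show False using ne by simp
  qed
  then show ?thesis unfolding coord_P_def using p by (intro mult_pos_pos) (auto simp: add_pos_nonneg)
qed

lemma powr_add_le:
  fixes a b p :: real
  assumes "0 \<le> a" "0 \<le> b" "1 \<le> p"
  shows "(a + b) powr p \<le> 2 powr p * (a powr p + b powr p)"
proof -
  have "(a + b) powr p \<le> (2 * max a b) powr p" using assms by (intro powr_mono2) auto
  also have "\<dots> = 2 powr p * max a b powr p" using assms by (simp add: powr_mult)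
  also have "\<dots> \<le> 2 powr p * (a powr p + b powr p)" by (intro mult_left_mono) (auto simp: max_def)
  finally show ?thesis .
qed

text \<open>The summands of \<open>K\<close> belong to three cases. For \<beta> = 0 one has c = a.
  Otherwise c \<alpha> = -a bounds \<open>c\<close> if |\<alpha>| \<ge> s0 / 2; if \<alpha> is
  smaller, \<open>s\<close> is at distance at least s0 / 2 from the zero \<alpha> and the value
  \<open>b\<close> at \<open>s\<close> bounds \<open>c\<close>.\<close>

lemma coord_c_bound:
  assumes p: "1 \<le> p" and s: "0 < s0" "s0 \<le> s" "s \<le> s1" "s1 < 1" and \<gamma>: "cmod \<gamma> \<le> 1"
  defines "K \<equiv> 1 + 2 / s0 + 4 / s0 * (2 / (1 - s1)) powr (2 / p)"
  shows "cmod (coord_c p s \<gamma> a b) \<le> K * (cmod a + cmod b)"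
proof -
  have s01: "0 < s" "s < 1" using s by auto
  have e: "0 < 2 / p" using p by simp
  define \<alpha> where "\<alpha> = coord_alpha p s \<gamma> a b"
  define c where "c = coord_c p s \<gamma> a b"
  define \<beta> where "\<beta> = coord_beta p s \<gamma> a b"
  note E = extremal_disc_coord[OF p s01 \<gamma>, of "\<lambda>_. \<alpha>" 0 a b "\<lambda>_. c" "\<lambda>_. \<beta>", OF \<alpha>_def c_def \<beta>_def]
  have K: "1 \<le> K" "2 / s0 \<le> K" "4 / s0 * (2 / (1 - s1)) powr (2 / p) \<le> K"
    using s by (auto simp: K_def)
  have le: "k * cmod u \<le> K * (cmod a + cmod b)" if "k \<le> K" "u = a \<or> u = b" "0 \<le> k" for k u
    using that K by (intro mult_mono) auto
  have "cmod c \<le> K * (cmod a + cmod b)"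
  proof (cases "\<beta> = 0")
    case True
    then have "c = a" using E(1) by (simp add: extremal_disc_def)
    then show ?thesis using le[of 1 a] K by simp
  next
    case False
    then have \<beta>1: "\<beta> = 1" using coord_beta_01[of p s \<gamma> a b] by (auto simp: \<beta>_def)
    have a: "c * - \<alpha> = a" using E(1) by (simp add: extremal_disc_def \<beta>1)
    then have na: "cmod c * cmod \<alpha> = cmod a" by (metis norm_minus_cancel norm_mult)
    show ?thesis
    proof (cases "cmod \<alpha> \<ge> s0 / 2")
      case True
      have "cmod c * (s0 / 2) \<le> cmod a" unfolding na[symmetric] using True by (intro mult_left_mono) auto
      then have "cmod c \<le> 2 / s0 * cmod a" using s by (simp add: field_simps)
      then show ?thesis using le[of "2 / s0" a] K s by simp
    next
      case False
      define A where "A = cmod (1 - cnj \<alpha> * of_real s)"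
      define G where "G = cmod (1 - cnj \<gamma> * of_real s)"
      have \<alpha>1: "cmod \<alpha> \<le> 1" unfolding \<alpha>_def by (rule coord_alpha_le_1)
      have bnd: "1 - s1 \<le> cmod (1 - cnj u * of_real s)" "cmod (1 - cnj u * of_real s) \<le> 2" if "cmod u \<le> 1" for u
      proof -
        have "cmod (cnj u * of_real s) \<le> 1 * s1" unfolding norm_mult complex_mod_cnj using that s by (intro mult_mono) auto
        then show "1 - s1 \<le> cmod (1 - cnj u * of_real s)" "cmod (1 - cnj u * of_real s) \<le> 2"
          using norm_triangle_ineq2[of 1 "cnj u * of_real s"] norm_triangle_ineq4[of 1 "cnj u * of_real s"] s by auto
      qed
      have A: "1 - s1 \<le> A" "A \<le> 2" and G: "1 - s1 \<le> G" "G \<le> 2"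
        using bnd[OF \<alpha>1] bnd[OF \<gamma>] by (auto simp: A_def G_def)
      have sa: "s0 / 2 \<le> cmod (of_real s - \<alpha>)"
        using norm_triangle_ineq2[of "of_real s" \<alpha>] False s s01 by simp
      have b: "cmod b = cmod c * (cmod (of_real s - \<alpha>) / A) * (A powr (2 / p) / G powr (2 / p))"
        unfolding E(2)[symmetric] extremal_disc_def \<beta>1 A_def G_def
        by (simp only: norm_mult norm_divide norm_powr_of_real power_one_right)
      have "((1 - s1) / 2) powr (2 / p) \<le> (A / G) powr (2 / p)"
        using A G s e by (intro powr_mono2 frac_le) auto
      then have "((1 - s1) / 2) powr (2 / p) \<le> A powr (2 / p) / G powr (2 / p)"
        using A G s by (simp add: powr_divide)
      moreover have "s0 / 4 \<le> cmod (of_real s - \<alpha>) / A"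
      proof -
        have "s0 / 2 / 2 \<le> cmod (of_real s - \<alpha>) / A" using sa A s by (intro frac_le) auto
        then show ?thesis by simp
      qed
      ultimately have le_b: "cmod c * (s0 / 4) * ((1 - s1) / 2) powr (2 / p) \<le> cmod b"
        unfolding b using s A by (intro mult_mono mult_nonneg_nonneg divide_nonneg_nonneg) auto
      define q where "q = ((1 - s1) / 2) powr (2 / p)"
      define q' where "q' = (2 / (1 - s1)) powr (2 / p)"
      have "(1 - s1) / 2 * (2 / (1 - s1)) = 1" using s by simp
      then have "q * q' = 1" unfolding q_def q'_def by (simp only: powr_mult[symmetric] powr_one_eq_one)
      then have "cmod c = cmod c * (q * q')" by simp
      also have "\<dots> = 4 / s0 * q' * (cmod c * (s0 / 4) * q)" using s by simp
      also have "\<dots> \<le> 4 / s0 * q' * cmod b"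
        using le_b s unfolding q_def[symmetric] by (intro mult_left_mono) (auto simp: q'_def)
      finally have "cmod c \<le> 4 / s0 * (2 / (1 - s1)) powr (2 / p) * cmod b" by (simp add: q'_def)
      then show ?thesis using le[of "4 / s0 * (2 / (1 - s1)) powr (2 / p)" b] K s by simp
    qed
  qed
  then show ?thesis by (simp add: c_def)
qed

lemma coord_P_le:
  assumes p: "1 \<le> p" and s: "0 < s0" "s0 \<le> s" "s \<le> s1" "s1 < 1" and \<gamma>: "cmod \<gamma> \<le> 1"
  defines "K \<equiv> 1 + 2 / s0 + 4 / s0 * (2 / (1 - s1)) powr (2 / p)"
  shows "coord_P p s \<gamma> a b \<le> 2 * (K powr p * 2 powr p) * (cmod a powr p + cmod b powr p)"
proof -
  have K: "0 \<le> K" using s by (simp add: K_def)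
  have "cmod (coord_c p s \<gamma> a b) powr p \<le> (K * (cmod a + cmod b)) powr p"
    using coord_c_bound[OF p s \<gamma>] p by (intro powr_mono2) (auto simp: K_def)
  also have "\<dots> = K powr p * (cmod a + cmod b) powr p" using K by (simp add: powr_mult)
  also have "\<dots> \<le> K powr p * (2 powr p * (cmod a powr p + cmod b powr p))"
    using p by (intro mult_left_mono powr_add_le) auto
  finally have 1: "cmod (coord_c p s \<gamma> a b) powr p \<le> K powr p * 2 powr p * (cmod a powr p + cmod b powr p)" by simp
  have "1 + (cmod (coord_alpha p s \<gamma> a b))\<^sup>2 \<le> 2" using coord_alpha_le_1 by (simp add: power_le_one)
  then have "coord_P p s \<gamma> a b \<le> cmod (coord_c p s \<gamma> a b) powr p * 2"
    unfolding coord_P_def by (intro mult_left_mono) auto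
  then show ?thesis using 1 by simp
qed

text \<open>The solution \<open>\<gamma>\<close> of \<open>\<gamma> = (1 + \<bar>\<gamma>\<bar>\<^sup>2) * \<kappa>\<close> in the closed unit disc.\<close>

definition disc_center :: "complex \<Rightarrow> complex" where
  "disc_center \<kappa> = 2 * \<kappa> / of_real (1 + sqrt (1 - 4 * (cmod \<kappa>)\<^sup>2))"

lemma disc_center:
  assumes "cmod \<kappa> \<le> 1 / 2"
  shows "cmod (disc_center \<kappa>) \<le> 1" "of_real (1 + (cmod (disc_center \<kappa>))\<^sup>2) * \<kappa> = disc_center \<kappa>"
proof -
  define r where "r = sqrt (1 - 4 * (cmod \<kappa>)\<^sup>2)"
  have "(cmod \<kappa>)\<^sup>2 \<le> (1 / 2)\<^sup>2" using assms by (intro power_mono) auto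
  then have r: "0 \<le> r" and r2: "r\<^sup>2 = 1 - 4 * (cmod \<kappa>)\<^sup>2" by (auto simp: r_def power2_eq_square)
  have "(cmod (disc_center \<kappa>))\<^sup>2 = 4 * (cmod \<kappa>)\<^sup>2 / (1 + r)\<^sup>2"
    unfolding disc_center_def r_def[symmetric] norm_divide norm_of_real norm_mult by (simp add: power_divide power_mult_distrib)
  also have "4 * (cmod \<kappa>)\<^sup>2 = (1 - r) * (1 + r)" using r2 by (simp add: power2_eq_square algebra_simps)
  finally have n: "(cmod (disc_center \<kappa>))\<^sup>2 = (1 - r) / (1 + r)" using r by (simp add: power2_eq_square)
  then have "(cmod (disc_center \<kappa>))\<^sup>2 \<le> 1\<^sup>2" using r by simp
  then show "cmod (disc_center \<kappa>) \<le> 1" using power2_le_imp_le zero_le_one by blast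
  have "1 + (cmod (disc_center \<kappa>))\<^sup>2 = 2 / (1 + r)" unfolding n using r by (simp add: field_simps)
  then show "of_real (1 + (cmod (disc_center \<kappa>))\<^sup>2) * \<kappa> = disc_center \<kappa>"
    by (simp add: disc_center_def r_def[symmetric])
qed

lemma continuous_on_disc_center: "continuous_on (cball 0 (1 / 2)) disc_center"
proof -
  have "1 + sqrt (1 - 4 * (cmod \<kappa>)\<^sup>2) \<noteq> 0" if "cmod \<kappa> \<le> 1 / 2" for \<kappa>
  proof -
    have "(cmod \<kappa>)\<^sup>2 \<le> (1 / 2)\<^sup>2" using that by (intro power_mono) auto
    then have "0 \<le> sqrt (1 - 4 * (cmod \<kappa>)\<^sup>2)" by (simp add: power2_eq_square)
    then show ?thesis by linarith
  qed
  then show ?thesis unfolding disc_center_def[abs_def]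
    by (intro continuous_intros) (auto simp: of_real_eq_0_iff simp del: of_real_add)
qed

lemma extremal_disc_scale: "extremal_disc p \<gamma> \<alpha> (\<lambda>j. \<tau> * c j) \<beta> z j = \<tau> * extremal_disc p \<gamma> \<alpha> c \<beta> z j"
  by (simp add: extremal_disc_def)

section \<open>Joining two points\<close>

text \<open>
  A fixed point of \<open>F\<close> in the proof yields sums that are \<open>t\<close> times the required ones, and \<open>t = 1\<close> unless \<open>s\<close> is an
  end point of \<open>{s0..s1}\<close>. After scaling with \<open>\<tau> = t powr (- 1 / p)\<close> the disc is extremal. If \<open>t > 1\<close>, it
  joins points of norm at most \<open>r < 1\<close> at distance \<open>s1\<close>, too close to \<open>1\<close>; if \<open>t < 1\<close>, it moves too far within \<open>s0\<close>.
\<close>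

lemma extremal_disc_exists:
  assumes p: "1 \<le> p" and x: "x \<in> lp_ball p" and y: "y \<in> lp_ball p" and ne: "x \<noteq> y"
  obtains \<gamma> \<alpha> c \<beta> s where "extremal_data p \<gamma> \<alpha> c \<beta>" "\<And>j. cmod (\<alpha> j) = 1 \<Longrightarrow> \<beta> j = 0"
    "0 < s" "s < 1" "extremal_disc p \<gamma> \<alpha> c \<beta> 0 = x" "extremal_disc p \<gamma> \<alpha> c \<beta> (of_real s) = y"
    "\<And>z. cmod z < 1 \<Longrightarrow> extremal_disc p \<gamma> \<alpha> c \<beta> z \<in> lp_ball p"
proof -
  obtain i where i: "x i \<noteq> y i" using ne by auto
  have xl: "x \<in> lp_space p" "lp_norm p x < 1" and yl: "y \<in> lp_space p" "lp_norm p y < 1"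
    using x y by (auto simp: lp_ball_def)
  define r where "r = max (lp_norm p x) (lp_norm p y)"
  have r: "0 \<le> r" "r < 1" "lp_norm p x \<le> r" "lp_norm p y \<le> r"
    using xl yl lp_norm_nonneg[of p x] by (auto simp: r_def)
  \<comment> \<open>If the norms at 0 and \<open>s\<close> are at most \<open>r\<close>, then
    |\<gamma>| and |\<open>mob \<gamma> s\<close>| are at most \<open>r\<close>, and
    \<open>mob_norm_sq\<close> yields \<delta> \<le> 1 - s^2. The choice of \<open>s1\<close> gives
    1 - s1^2 \<le> \<delta> / 2, a contradiction at that end.\<close>
  define \<delta> where "\<delta> = (1 - r\<^sup>2) * (1 - r)\<^sup>2"
  have r2: "0 < 1 - r\<^sup>2" "1 - r\<^sup>2 \<le> 1" using r by (auto simp: power_less_one_iff)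
  have r3: "0 < (1 - r)\<^sup>2" "(1 - r)\<^sup>2 \<le> 1" using r by (auto simp: power_le_one)
  have \<delta>: "0 < \<delta>" "\<delta> \<le> 1" using r2 r3 mult_mono[of "1 - r\<^sup>2" 1 "(1 - r)\<^sup>2" 1] by (auto simp: \<delta>_def)
  \<comment> \<open>By the Schwarz lemma a disc in the ball changes its i-th coordinate by at most 2
    s between 0 and \<open>s\<close>, and 2 s0 is only half of |y i - x i|. The cap 1/2 keeps
    \<open>s0\<close> below \<open>s1\<close>.\<close>
  define s0 where "s0 = min (1 / 2) (cmod (y i - x i) / 4)"
  define s1 where "s1 = 1 - \<delta> / 4"
  have s0: "0 < s0" "s0 \<le> 1 / 2" "4 * s0 \<le> cmod (y i - x i)" using i by (auto simp: s0_def)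
  have s1: "3 / 4 \<le> s1" "s1 < 1" using \<delta> by (auto simp: s1_def)
  have s01: "s0 \<le> s1" using s0 s1 by simp
  define K where "K = 1 + 2 / s0 + 4 / s0 * (2 / (1 - s1)) powr (2 / p)"
  define M where "M j = 2 * (K powr p * 2 powr p) * (cmod (x j) powr p + cmod (y j) powr p)" for j
  have M: "summable M"
    unfolding M_def using xl yl by (intro summable_mult summable_add) (auto simp: lp_space_def)
  define S' where "S' = {s0..s1} \<times> cball (0::complex) 1"
  have S': "S' \<subseteq> {0<..<1} \<times> cball 0 1" using s0 s1 by (auto simp: S'_def)
  define P where "P u = (\<Sum>j. coord_P p (fst u) (snd u) (x j) (y j))" for u
  define Q where "Q u = (\<Sum>j. coord_Q p (fst u) (snd u) (x j) (y j))" for u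
  have Ple: "coord_P p (fst u) (snd u) (x j) (y j) \<le> M j" if "u \<in> S'" for u j
    unfolding M_def K_def using that s0 s1 by (intro coord_P_le[OF p]) (auto simp: S'_def)
  have Pj0: "0 \<le> coord_P p t g a b" for t g a b by (rule coord_P_nonneg)
  have Qle: "cmod (coord_Q p (fst u) (snd u) (x j) (y j)) \<le> M j" if "u \<in> S'" for u j
    using coord_Q_le[of p "fst u" "snd u" "x j" "y j"] Ple[OF that, of j] Pj0[of "fst u" "snd u" "x j" "y j"] by linarith
  have sumP: "(\<lambda>j. coord_P p (fst u) (snd u) (x j) (y j)) sums P u" if "u \<in> S'" for u
    unfolding P_def by (intro summable_sums summable_comparison_test'[OF M, of 0]) (use Ple[OF that] Pj0 in auto)
  have sumQ: "(\<lambda>j. coord_Q p (fst u) (snd u) (x j) (y j)) sums Q u"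
    and sumnQ: "summable (\<lambda>j. cmod (coord_Q p (fst u) (snd u) (x j) (y j)))" if "u \<in> S'" for u
  proof -
    show "summable (\<lambda>j. cmod (coord_Q p (fst u) (snd u) (x j) (y j)))"
      by (intro summable_comparison_test'[OF M, of 0]) (use Qle[OF that] in auto)
    then show "(\<lambda>j. coord_Q p (fst u) (snd u) (x j) (y j)) sums Q u"
      unfolding Q_def by (rule summable_sums[OF summable_norm_cancel])
  qed
  have contP: "continuous_on S' P"
  proof (rule uniform_limit_theorem)
    show "uniform_limit S' (\<lambda>n u. \<Sum>j<n. coord_P p (fst u) (snd u) (x j) (y j)) P sequentially"
      unfolding P_def by (rule Weierstrass_m_test[OF _ M]) (use Ple Pj0 in auto)
    show "\<forall>\<^sub>F n in sequentially. continuous_on S' (\<lambda>u. \<Sum>j<n. coord_P p (fst u) (snd u) (x j) (y j))"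
      by (intro always_eventually allI continuous_on_sum continuous_on_subset[OF coord_continuous(1)[OF p] S'])
  qed simp
  have contQ: "continuous_on S' Q"
  proof (rule uniform_limit_theorem)
    show "uniform_limit S' (\<lambda>n u. \<Sum>j<n. coord_Q p (fst u) (snd u) (x j) (y j)) Q sequentially"
      unfolding Q_def by (rule Weierstrass_m_test[OF _ M]) (use Qle in auto)
    show "\<forall>\<^sub>F n in sequentially. continuous_on S' (\<lambda>u. \<Sum>j<n. coord_Q p (fst u) (snd u) (x j) (y j))"
      by (intro always_eventually allI continuous_on_sum continuous_on_subset[OF coord_continuous(2)[OF p] S'])
  qed simp
  have Ppos: "0 < P u" if u: "u \<in> S'" for u
  proof -
    have "0 < coord_P p (fst u) (snd u) (x i) (y i)"
      using u s0 s1 i by (intro coord_P_pos[OF p]) (auto simp: S'_def)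
    also have "\<dots> \<le> P u"
      using sum_le_suminf[of "\<lambda>j. coord_P p (fst u) (snd u) (x j) (y j)" "{i}"] sumP[OF u] Pj0 by (auto simp: sums_iff)
    finally show ?thesis .
  qed
  have QP: "cmod (Q u) \<le> P u / 2" if u: "u \<in> S'" for u
  proof -
    have "cmod (Q u) \<le> (\<Sum>j. cmod (coord_Q p (fst u) (snd u) (x j) (y j)))"
      unfolding Q_def by (rule summable_norm[OF sumnQ[OF u]])
    also have "\<dots> \<le> P u / 2"
      using sums_le[OF coord_Q_le summable_sums[OF sumnQ[OF u]] sums_divide[OF sumP[OF u]]] .
    finally show ?thesis .
  qed
  \<comment> \<open>The second component is \<kappa> = \<gamma> / (1 + |\<gamma>|^2). Division turns
    the two conditions into Q / P = \<kappa> and a scalar equation for P, and \<open>QP\<close>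
    shows that the quotient stays in this disc.\<close>
  define S where "S = {s0..s1} \<times> cball (0::complex) (1 / 2)"
  define h where "h u = (fst u, disc_center (snd u))" for u :: "real \<times> complex"
  have conth: "continuous_on S h"
    unfolding h_def S_def
    by (intro continuous_on_Pair continuous_on_fst continuous_on_id continuous_on_compose2[OF continuous_on_disc_center] continuous_on_snd) auto
  have hS: "h u \<in> S'" if "u \<in> S" for u using that disc_center(1) by (auto simp: h_def S_def S'_def)
  have cP: "continuous_on S (\<lambda>u. P (h u))" and cQ: "continuous_on S (\<lambda>u. Q (h u))"
    using continuous_on_compose2[OF contP conth image_subsetI[OF hS]]
      continuous_on_compose2[OF contQ conth image_subsetI[OF hS]] by simp_all
  have cN: "continuous_on S (\<lambda>u. 1 + (cmod (snd (h u)))\<^sup>2)"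
    by (intro continuous_intros conth)
  \<comment> \<open>The first component moves \<open>s\<close> by the defect of the scalar equation
    and clamps the result, so a fixed point has no defect, or sits at \<open>s1\<close> with too
    large a sum, or at \<open>s0\<close> with too small a one.\<close>
  define F where "F u = (max s0 (min s1 (fst u + P (h u) / (1 + (cmod (snd (h u)))\<^sup>2) - 1)), Q (h u) / of_real (P (h u)))" for u
  have npos: "0 < 1 + (cmod g)\<^sup>2" for g :: complex by (simp add: add_pos_nonneg)
  have contF: "continuous_on S F"
    unfolding F_def
    by (intro continuous_on_Pair continuous_on_max continuous_on_min continuous_on_const continuous_on_diff continuous_on_add
        continuous_on_divide continuous_on_of_real cP cQ cN continuous_on_fst continuous_on_id)
       (use npos Ppos hS in \<open>auto simp: less_imp_neq[symmetric]\<close>)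
  have FS: "F \<in> S \<rightarrow> S"
  proof
    fix u assume u: "u \<in> S"
    have "cmod (Q (h u) / of_real (P (h u))) \<le> 1 / 2"
      using QP[OF hS[OF u]] Ppos[OF hS[OF u]] by (simp add: norm_divide divide_le_eq)
    then show "F u \<in> S" using s01 by (auto simp: F_def S_def)
  qed
  have "compact S" "convex S" "S \<noteq> {}"
    using s01 by (auto simp: S_def intro!: compact_Times convex_Times)
  then obtain u where u: "u \<in> S" "F u = u" using brouwer[OF _ _ _ contF FS] by blast
  define s where "s = fst u"
  define \<gamma> where "\<gamma> = disc_center (snd u)"
  have hu: "h u = (s, \<gamma>)" by (simp add: h_def s_def \<gamma>_def)
  have usg: "(s, \<gamma>) \<in> S'" using hS[OF u(1)] hu by simp
  have s: "0 < s" "s < 1" "s0 \<le> s" "s \<le> s1" and \<gamma>1: "cmod \<gamma> \<le> 1" using usg s0 s1 by (auto simp: S'_def)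
  define t where "t = P (s, \<gamma>) / (1 + (cmod \<gamma>)\<^sup>2)"
  have t0: "0 < t" unfolding t_def using Ppos[OF usg] npos by (intro divide_pos_pos)
  have Pt: "P (s, \<gamma>) = t * (1 + (cmod \<gamma>)\<^sup>2)" unfolding t_def using npos[of \<gamma>] by simp
  have fix1: "max s0 (min s1 (s + t - 1)) = s"
    using u(2) unfolding F_def hu t_def by (simp add: s_def prod_eq_iff)
  have fix2: "Q (s, \<gamma>) / of_real (P (s, \<gamma>)) = snd u" using u(2) unfolding F_def hu by (simp add: prod_eq_iff)
  have \<kappa>: "cmod (snd u) \<le> 1 / 2" using u(1) by (auto simp: S_def)
  have Qt: "Q (s, \<gamma>) = of_real t * \<gamma>"
  proof -
    have "Q (s, \<gamma>) = of_real (P (s, \<gamma>)) * snd u" using fix2 Ppos[OF usg] by (simp add: field_simps)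
    also have "\<dots> = of_real t * (of_real (1 + (cmod \<gamma>)\<^sup>2) * snd u)" unfolding Pt by simp
    also have "of_real (1 + (cmod \<gamma>)\<^sup>2) * snd u = \<gamma>" unfolding \<gamma>_def by (rule disc_center(2)[OF \<kappa>])
    finally show ?thesis .
  qed
  define \<alpha> where "\<alpha> j = coord_alpha p s \<gamma> (x j) (y j)" for j
  define c where "c j = coord_c p s \<gamma> (x j) (y j)" for j
  define \<beta> where "\<beta> j = coord_beta p s \<gamma> (x j) (y j)" for j
  have E: "extremal_disc p \<gamma> \<alpha> c \<beta> 0 j = x j" "extremal_disc p \<gamma> \<alpha> c \<beta> (of_real s) j = y j" for j
    using extremal_disc_coord[where \<alpha> = \<alpha> and c = c and \<beta> = \<beta> and j = j, OF p s(1,2) \<gamma>1 \<alpha>_def c_def \<beta>_def]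
    by simp_all
  have \<beta>: "\<beta> j = 0" if "cmod (\<alpha> j) = 1" for j using that unfolding \<alpha>_def \<beta>_def by (rule coord_beta_0)
  have sP: "(\<lambda>j. cmod (c j) powr p * (1 + (cmod (\<alpha> j))\<^sup>2)) sums (t * (1 + (cmod \<gamma>)\<^sup>2))"
    using sumP[OF usg] by (simp add: Pt coord_P_def c_def \<alpha>_def)
  have sQ: "(\<lambda>j. complex_of_real (cmod (c j) powr p) * \<alpha> j) sums (of_real t * \<gamma>)"
    using sumQ[OF usg] by (simp add: Qt coord_Q_def c_def \<alpha>_def)
  \<comment> \<open>For |\<gamma>| = 1 the variance of the \<open>\<alpha> j\<close> about \<gamma>
    vanishes. Then each relevant \<open>\<alpha> j\<close> equals \<gamma>, \<open>\<beta> j\<close>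
    is 0 and the disc is constant, against \<open>x \<noteq> y\<close>.\<close>
  have \<gamma>: "cmod \<gamma> < 1"
  proof (rule ccontr)
    assume "\<not> cmod \<gamma> < 1"
    then have g1: "cmod \<gamma> = 1" using \<gamma>1 by simp
    have "(\<lambda>j. cmod (c j) powr p * (1 + (cmod (\<alpha> j))\<^sup>2) - 2 * Re (complex_of_real (cmod (c j) powr p) * \<alpha> j * cnj \<gamma>))
       sums (t * (1 + (cmod \<gamma>)\<^sup>2) - 2 * Re (of_real t * \<gamma> * cnj \<gamma>))"
      by (intro sums_diff sP sums_mult sums_Re sums_mult2 sQ)
    moreover have "t * (1 + (cmod \<gamma>)\<^sup>2) - 2 * Re (of_real t * \<gamma> * cnj \<gamma>) = 0"
      using g1 cmod_power2[of \<gamma>] by (simp add: power2_eq_square algebra_simps flip: distrib_left)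
    moreover have "cmod (c j) powr p * (1 + (cmod (\<alpha> j))\<^sup>2) - 2 * Re (complex_of_real (cmod (c j) powr p) * \<alpha> j * cnj \<gamma>)
        = cmod (c j) powr p * (cmod (\<alpha> j - \<gamma>))\<^sup>2" for j
    proof -
      have n: "(cmod (\<alpha> j - \<gamma>))\<^sup>2 = (cmod (\<alpha> j))\<^sup>2 + (cmod \<gamma>)\<^sup>2 - 2 * Re (\<alpha> j * cnj \<gamma>)"
        unfolding cmod_power2 by (simp add: power2_eq_square algebra_simps)
      show ?thesis unfolding n g1 by (simp add: algebra_simps)
    qed
    ultimately have "(\<lambda>j. cmod (c j) powr p * (cmod (\<alpha> j - \<gamma>))\<^sup>2) sums 0" by simp
    then have v0: "cmod (c j) powr p * (cmod (\<alpha> j - \<gamma>))\<^sup>2 = 0" for j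
      using suminf_eq_zero_iff[of "\<lambda>j. cmod (c j) powr p * (cmod (\<alpha> j - \<gamma>))\<^sup>2"] by (auto simp: sums_iff)
    have "x j = y j" for j
    proof (cases "c j = 0")
      case True
      then show ?thesis using E[of j] by (simp add: extremal_disc_def)
    next
      case False
      then have "\<alpha> j = \<gamma>" using v0[of j] p by auto
      moreover from this have "\<beta> j = 0" using g1 \<beta> by simp
      moreover have "1 - cnj \<gamma> * of_real s \<noteq> 0"
        using s \<gamma>1 norm_mult_less_1[of \<gamma> "of_real s"] by (intro one_minus_cnj_nonzero) auto
      ultimately show ?thesis using E[of j] by (simp add: extremal_disc_def)
    qed
    then show False using ne by auto
  qed
  define \<tau> where "\<tau> = t powr (- 1 / p)"
  have \<tau>0: "0 < \<tau>" using t0 by (simp add: \<tau>_def)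
  have \<tau>p: "\<tau> powr p = 1 / t"
  proof -
    have "- 1 / p * p = - 1" using p by simp
    then have "\<tau> powr p = t powr - 1" by (simp only: \<tau>_def powr_powr)
    then show ?thesis using t0 by (simp add: powr_minus_divide)
  qed
  define c' where "c' j = of_real \<tau> * c j" for j
  have c'p: "cmod (c' j) powr p = cmod (c j) powr p / t" for j
    using \<tau>0 by (simp add: c'_def norm_mult powr_mult \<tau>p)
  have data: "extremal_data p \<gamma> \<alpha> c' \<beta>"
  proof
    show "cmod (\<alpha> j) \<le> 1" for j unfolding \<alpha>_def by (rule coord_alpha_le_1)
    show "\<beta> j \<in> {0, 1}" for j unfolding \<beta>_def by (rule coord_beta_01)
    show "(\<lambda>j. cmod (c' j) powr p * (1 + (cmod (\<alpha> j))\<^sup>2)) sums (1 + (cmod \<gamma>)\<^sup>2)"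
      using sums_divide[OF sP, of t] t0 by (simp add: c'p)
    show "(\<lambda>j. complex_of_real (cmod (c' j) powr p) * \<alpha> j) sums \<gamma>"
      using sums_divide[OF sQ, of "of_real t"] t0 by (simp add: c'p)
  qed (use p \<gamma> in auto)
  then interpret D: extremal_data p \<gamma> \<alpha> c' \<beta> .
  have D0: "D.disc 0 = (\<lambda>j. of_real \<tau> * x j)" and Ds: "D.disc (of_real s) = (\<lambda>j. of_real \<tau> * y j)"
    by (auto simp: c'_def[abs_def] extremal_disc_scale E)
  have s': "cmod (complex_of_real s) < 1" using s by simp
  have "D.disc 0 i \<noteq> D.disc (of_real s) i" using i \<tau>0 unfolding D0 Ds by simp
  then have nc: "D.disc 0 \<noteq> D.disc (of_real s)" by metis
  have ball: "D.disc z \<in> lp_ball p" if "cmod z < 1" for z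
    by (rule D.disc_mem_ball[OF nc _ s' that]) simp
  have mob_le: "cmod (mob \<gamma> z) \<le> lp_norm p (D.disc z)" if "cmod z < 1" for z
    using D.pairing_norm[OF D.disc_lp(1)[OF that] that] D.pairing_disc[OF that] by simp
  have "t \<le> 1"
  proof (rule ccontr)
    assume t1: "\<not> t \<le> 1"
    then have ss1: "s = s1" using fix1 s by (auto simp: max_def min_def split: if_splits)
    have "\<tau> \<le> 1 powr (- 1 / p)" unfolding \<tau>_def using t1 p by (intro powr_mono2') auto
    then have \<tau>1: "\<tau> \<le> 1" by simp
    have "\<tau> * lp_norm p x \<le> 1 * r" "\<tau> * lp_norm p y \<le> 1 * r"
      using \<tau>1 \<tau>0 r lp_norm_nonneg by (intro mult_mono; simp)+
    then have "lp_norm p (D.disc 0) \<le> r" "lp_norm p (D.disc (of_real s)) \<le> r"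
      unfolding D0 Ds using lp_scale(2)[OF p xl(1)] lp_scale(2)[OF p yl(1)] \<tau>0 by simp_all
    then have m0: "cmod \<gamma> \<le> r" and ms: "cmod (mob \<gamma> (of_real s)) \<le> r"
      using mob_le[of 0] mob_le[OF s'] by auto
    have nz: "1 - cnj \<gamma> * of_real s \<noteq> 0" using D.denominator_pos(4)[OF s'] .
    have "1 - r \<le> cmod (1 - cnj \<gamma> * of_real s)" using D.denominator_bound[of "of_real s"] s' m0 by linarith
    then have "(1 - r)\<^sup>2 \<le> (cmod (1 - cnj \<gamma> * of_real s))\<^sup>2" using r by (intro power_mono) auto
    then have "(1 - (cmod \<gamma>)\<^sup>2) * (1 - s\<^sup>2) / (cmod (1 - cnj \<gamma> * of_real s))\<^sup>2 \<le> 1 * (1 - s\<^sup>2) / (1 - r)\<^sup>2"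
      using r3 s \<gamma> by (intro frac_le mult_right_mono mult_nonneg_nonneg) (auto simp: power_le_one)
    moreover have "1 - (cmod (mob \<gamma> (of_real s)))\<^sup>2 = (1 - (cmod \<gamma>)\<^sup>2) * (1 - s\<^sup>2) / (cmod (1 - cnj \<gamma> * of_real s))\<^sup>2"
      using mob_norm_sq[OF nz] s by simp
    moreover have "(cmod (mob \<gamma> (of_real s)))\<^sup>2 \<le> r\<^sup>2" using ms by (intro power_mono) auto
    ultimately have "1 - r\<^sup>2 \<le> (1 - s\<^sup>2) / (1 - r)\<^sup>2" by linarith
    then have "\<delta> \<le> 1 - s\<^sup>2" unfolding \<delta>_def using r3 by (simp add: pos_le_divide_eq)
    also have "\<dots> = (1 - s) * (1 + s)" by (simp add: power2_eq_square algebra_simps)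
    also have "\<dots> \<le> (1 - s) * 2" using s by (intro mult_left_mono) auto
    also have "\<dots> = \<delta> / 2" by (simp add: ss1 s1_def)
    finally show False using \<delta> by simp
  qed
  moreover have "1 \<le> t"
  proof (rule ccontr)
    assume t1: "\<not> 1 \<le> t"
    then have ss0: "s = s0" using fix1 s by (auto simp: max_def min_def split: if_splits)
    have "1 powr (- 1 / p) \<le> \<tau>" unfolding \<tau>_def using t1 t0 p by (intro powr_mono2') auto
    then have \<tau>1: "1 \<le> \<tau>" by simp
    define f where "f z = (D.disc z i - D.disc 0 i) / 2" for z
    have "f holomorphic_on ball 0 1" unfolding f_def by (intro holomorphic_intros D.disc_holomorphic) auto
    moreover have "f 0 = 0" by (simp add: f_def)
    moreover have "cmod (f z) < 1" if "cmod z < 1" for z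
    proof -
      have "cmod (D.disc u i) < 1" if "cmod u < 1" for u
        using lp_norm_coordinate[OF p, of "D.disc u" i] ball[OF that] by (auto simp: lp_ball_def)
      then have "cmod (D.disc z i) < 1" "cmod (D.disc 0 i) < 1" using that by auto
      then show ?thesis unfolding f_def norm_divide
        using norm_triangle_ineq4[of "D.disc z i" "D.disc 0 i"] by simp
    qed
    ultimately have "cmod (f (of_real s)) \<le> cmod (complex_of_real s)" using s' by (intro Schwarz_Lemma(1))
    moreover have "f (of_real s) = of_real \<tau> * (y i - x i) / 2"
      unfolding f_def D0 Ds by (simp add: right_diff_distrib)
    ultimately have "\<tau> * cmod (y i - x i) / 2 \<le> s" using \<tau>0 s by (simp add: norm_mult norm_divide)
    moreover have "1 * cmod (y i - x i) \<le> \<tau> * cmod (y i - x i)" using \<tau>1 by (intro mult_right_mono) auto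
    ultimately have "cmod (y i - x i) \<le> 2 * s0" by (simp add: ss0)
    then show False using s0 by simp
  qed
  ultimately have "t = 1" by simp
  then have "\<tau> = 1" by (simp add: \<tau>_def)
  then have "D.disc 0 = x" "D.disc (of_real s) = y" using D0 Ds by simp_all
  then show thesis using that[OF data \<beta> s(1,2)] ball by blast
qed

section \<open>Identification of the geodesics\<close>

lemma complex_geodesic_nonconstant:
  assumes "complex_geodesic p D \<phi>"
  shows "\<phi> 0 \<noteq> \<phi> (1 / 2)"
proof
  assume eq: "\<phi> 0 = \<phi> (1 / 2)"
  have "(\<lambda>x. 0) \<in> hol_to_disc p D"
    using lp_holomorphic_on_const[of p D 0] by (auto simp: hol_to_disc_def)
  then have "hol_to_disc p D \<noteq> {}" by blast
  then have "caratheodory_dist p D (\<phi> 0) (\<phi> 0) = 0"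
    by (simp add: caratheodory_dist_def poincare_dist_def)
  then have "poincare_dist 0 (1 / 2) = 0"
    using assms eq by (auto simp: complex_geodesic_def)
  then have "artanh (1 / 2 :: real) = artanh 0" by (simp add: poincare_dist_def norm_divide)
  then show False using artanh_real_eq_iff[of "1 / 2" 0] by simp
qed

text \<open>A geodesic joins its own values at 0 and 1/2 in normalized form, so it coincides with
  the extremal disc constructed for these points. That disc has \<open>\<beta> j = 0\<close>
  whenever |\<open>\<alpha> j\<close>| = 1, so this representation extends continuously to the
  circle.\<close>

lemma complex_geodesic_is_extremal_disc:
  assumes p: "1 \<le> p" and \<phi>: "complex_geodesic p (lp_ball p) \<phi>"
  obtains \<gamma> \<alpha> c \<beta> where "extremal_data p \<gamma> \<alpha> c \<beta>" "\<And>j. cmod (\<alpha> j) = 1 \<Longrightarrow> \<beta> j = 0"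
    "\<And>z. cmod z < 1 \<Longrightarrow> extremal_disc p \<gamma> \<alpha> c \<beta> z \<in> lp_ball p"
    "\<And>z. cmod z < 1 \<Longrightarrow> \<phi> z = extremal_disc p \<gamma> \<alpha> c \<beta> z"
proof -
  have mem: "\<phi> z \<in> lp_ball p" if "cmod z < 1" for z
    using \<phi> hol_from_disc_mem[OF _ that] by (auto simp: complex_geodesic_def)
  have half: "cmod (1 / 2) < 1" by (simp add: norm_divide)
  obtain \<gamma> \<alpha> c \<beta> s where E: "extremal_data p \<gamma> \<alpha> c \<beta>" "\<And>j. cmod (\<alpha> j) = 1 \<Longrightarrow> \<beta> j = 0"
    "0 < s" "s < 1" "extremal_disc p \<gamma> \<alpha> c \<beta> 0 = \<phi> 0" "extremal_disc p \<gamma> \<alpha> c \<beta> (of_real s) = \<phi> (1 / 2)"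
    "\<And>z. cmod z < 1 \<Longrightarrow> extremal_disc p \<gamma> \<alpha> c \<beta> z \<in> lp_ball p"
    using extremal_disc_exists[OF p mem mem[OF half] complex_geodesic_nonconstant[OF \<phi>]] by (metis norm_zero zero_less_one)
  have "normalized_geodesic_joining p (lp_ball p) (\<phi> 0) (\<phi> (1 / 2)) \<phi>"
    unfolding normalized_geodesic_joining_def using \<phi> by (auto intro!: exI[of _ "1 / 2 :: real"])
  then have "\<phi> z = extremal_disc p \<gamma> \<alpha> c \<beta> z" if "cmod z < 1" for z
    using extremal_data.disc_unique[OF E(1) E(7) _ E(5) E(3,4,6) that] by blast
  then show thesis using that E by blast
qed

text \<open>Data with |\<open>\<alpha> j\<close>| = 1 and \<open>\<beta> j = 1\<close> are covered:
  inside the disc their Moebius factor is the constant -\<open>\<alpha> j\<close>. Off the open disc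
  \<phi> is arbitrary, so its holomorphy is obtained from its own coordinates.\<close>

lemma (in extremal_data) complex_geodesic_if_eq_disc:
  assumes ball: "\<phi> ` unit_disc \<subseteq> lp_ball p" and eq: "\<And>z. cmod z < 1 \<Longrightarrow> \<phi> z = disc z"
  shows "complex_geodesic p (lp_ball p) \<phi>"
proof -
  have disc_ball: "disc z \<in> lp_ball p" if "cmod z < 1" for z
  proof -
    have "\<phi> z \<in> lp_ball p" using ball that by (auto simp: image_subset_iff)
    then show ?thesis using eq[OF that] by simp
  qed
  have "\<phi> \<in> hol_from_disc p (lp_ball p)"
  proof (rule hol_from_disc_dominated[OF p1 _ bd_summable _ ball])
    show "(\<lambda>z. \<phi> z j) holomorphic_on ball 0 1" for j
      using disc_holomorphic[of j] by (rule holomorphic_transform) (simp add: eq)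
    show "cmod (\<phi> z j) powr p \<le> bd j" if "cmod z < 1" for j z
      using disc_norm_powr_le_bd[OF that] by (simp add: eq[OF that])
  qed
  then show ?thesis using disc_geodesic[OF disc_ball] eq by (auto simp: complex_geodesic_def)
qed

lemma complex_geodesic_iff:
  assumes p: "1 \<le> p" and ball: "\<phi> ` unit_disc \<subseteq> lp_ball p"
  shows "complex_geodesic p (lp_ball p) \<phi> \<longleftrightarrow> \<not> \<phi> constant_on unit_disc \<and>
    (\<exists>\<gamma> \<alpha> c \<beta>. extremal_data p \<gamma> \<alpha> c \<beta> \<and> (\<forall>z\<in>unit_disc. \<forall>j. \<phi> z j = extremal_disc p \<gamma> \<alpha> c \<beta> z j))"
    (is "_ \<longleftrightarrow> _ \<and> ?form")
proof (intro iffI conjI)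
  assume g: "complex_geodesic p (lp_ball p) \<phi>"
  have "1 / 2 \<in> unit_disc" by (simp add: norm_divide)
  then show "\<not> \<phi> constant_on unit_disc"
    using complex_geodesic_nonconstant[OF g] unfolding constant_on_def by (metis centre_in_ball zero_less_one)
  show ?form
    using complex_geodesic_is_extremal_disc[OF p g] by (metis mem_ball_0)
next
  assume "\<not> \<phi> constant_on unit_disc \<and> ?form"
  then obtain \<gamma> \<alpha> c \<beta> where E: "extremal_data p \<gamma> \<alpha> c \<beta>"
    "\<And>z j. z \<in> unit_disc \<Longrightarrow> \<phi> z j = extremal_disc p \<gamma> \<alpha> c \<beta> z j"
    by blast
  show "complex_geodesic p (lp_ball p) \<phi>"
    using E(2) by (intro extremal_data.complex_geodesic_if_eq_disc[OF E(1) ball] ext) simp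
qed

theorem corollary5p8:
  fixes p :: real
  assumes "1 \<le> p"
  shows
    "(\<forall>x\<in>lp_ball p. \<forall>y\<in>lp_ball p. x \<noteq> y \<longrightarrow>
        (\<exists>\<phi>. normalized_geodesic_joining p (lp_ball p) x y \<phi> \<and>
           (\<forall>\<psi>. normalized_geodesic_joining p (lp_ball p) x y \<psi> \<longrightarrow> (\<forall>\<zeta>\<in>unit_disc. \<psi> \<zeta> = \<phi> \<zeta>))))
     \<and>
     (\<forall>\<phi>. complex_geodesic p (lp_ball p) \<phi> \<longrightarrow>
        (\<exists>\<Phi>. continuous_map (top_of_set (closure unit_disc))
                (subtopology (lp_topology p) (lp_topology p closure_of lp_ball p)) \<Phi> \<and>
             (\<forall>\<zeta>\<in>unit_disc. \<Phi> \<zeta> = \<phi> \<zeta>)))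
     \<and>
     (\<forall>\<phi> :: complex \<Rightarrow> nat \<Rightarrow> complex. \<phi> ` unit_disc \<subseteq> lp_ball p \<longrightarrow>
        (complex_geodesic p (lp_ball p) \<phi> \<longleftrightarrow>
           \<not> \<phi> constant_on unit_disc \<and>
           (\<exists>(\<gamma>::complex) (\<alpha>::nat \<Rightarrow> complex) (c::nat \<Rightarrow> complex) (\<beta>::nat \<Rightarrow> nat).
              \<gamma> \<in> unit_disc \<and> (\<forall>j. \<alpha> j \<in> closure unit_disc) \<and> (\<forall>j. \<beta> j \<in> {0, 1}) \<and>
              (\<lambda>j. cmod (c j) powr p * (1 + (cmod (\<alpha> j))\<^sup>2)) sums (1 + (cmod \<gamma>)\<^sup>2) \<and>
              (\<lambda>j. complex_of_real (cmod (c j) powr p) * \<alpha> j) sums \<gamma> \<and>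
              (\<forall>\<zeta>\<in>unit_disc. \<forall>j. \<phi> \<zeta> j =
                 c j * ((\<zeta> - \<alpha> j) / (1 - cnj (\<alpha> j) * \<zeta>)) ^ \<beta> j *
                 ((1 - cnj (\<alpha> j) * \<zeta>) powr complex_of_real (2 / p) /
                  (1 - cnj \<gamma> * \<zeta>) powr complex_of_real (2 / p))))))"
  (is "_ \<and> _ \<and> (\<forall>\<phi>. _ \<longrightarrow> (?geodesic \<phi> \<longleftrightarrow> ?form \<phi>))")
proof (intro conjI ballI allI impI)
  fix x y assume xy: "x \<in> lp_ball p" "y \<in> lp_ball p" "x \<noteq> y"
  obtain \<gamma> \<alpha> c \<beta> s where E: "extremal_data p \<gamma> \<alpha> c \<beta>" "0 < s" "s < 1"
    "extremal_disc p \<gamma> \<alpha> c \<beta> 0 = x" "extremal_disc p \<gamma> \<alpha> c \<beta> (of_real s) = y"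
    "\<And>z. cmod z < 1 \<Longrightarrow> extremal_disc p \<gamma> \<alpha> c \<beta> z \<in> lp_ball p"
    using extremal_disc_exists[OF assms xy] by metis
  show "\<exists>\<phi>. normalized_geodesic_joining p (lp_ball p) x y \<phi> \<and>
      (\<forall>\<psi>. normalized_geodesic_joining p (lp_ball p) x y \<psi> \<longrightarrow> (\<forall>\<zeta>\<in>unit_disc. \<psi> \<zeta> = \<phi> \<zeta>))"
  proof (intro exI conjI allI impI ballI)
    show "normalized_geodesic_joining p (lp_ball p) x y (extremal_disc p \<gamma> \<alpha> c \<beta>)"
      unfolding normalized_geodesic_joining_def using extremal_data.disc_geodesic[OF E(1,6)] E(2-5) by blast
    fix \<psi> \<zeta> assume "normalized_geodesic_joining p (lp_ball p) x y \<psi>" "\<zeta> \<in> unit_disc"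
    then show "\<psi> \<zeta> = extremal_disc p \<gamma> \<alpha> c \<beta> \<zeta>"
      using extremal_data.disc_unique[OF E(1,6) _ E(4,2,3,5)] by simp
  qed
next
  fix \<phi> assume "complex_geodesic p (lp_ball p) \<phi>"
  then obtain \<gamma> \<alpha> c \<beta> where E: "extremal_data p \<gamma> \<alpha> c \<beta>" "\<And>j. cmod (\<alpha> j) = 1 \<Longrightarrow> \<beta> j = 0"
    "\<And>z. cmod z < 1 \<Longrightarrow> extremal_disc p \<gamma> \<alpha> c \<beta> z \<in> lp_ball p"
    "\<And>z. cmod z < 1 \<Longrightarrow> \<phi> z = extremal_disc p \<gamma> \<alpha> c \<beta> z"
    using complex_geodesic_is_extremal_disc[OF assms] by metis
  show "\<exists>\<Phi>. continuous_map (top_of_set (closure unit_disc))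
                (subtopology (lp_topology p) (lp_topology p closure_of lp_ball p)) \<Phi> \<and>
             (\<forall>\<zeta>\<in>unit_disc. \<Phi> \<zeta> = \<phi> \<zeta>)"
    using extremal_data.disc_continuous_map[OF E(1-3)] E(4) by (intro exI[of _ "extremal_disc p \<gamma> \<alpha> c \<beta>"]) simp
next
  fix \<phi> :: "complex \<Rightarrow> nat \<Rightarrow> complex"
  assume ball: "\<phi> ` unit_disc \<subseteq> lp_ball p"
  have data: "extremal_data p \<gamma> \<alpha> c \<beta> \<longleftrightarrow> \<gamma> \<in> unit_disc \<and> (\<forall>j. \<alpha> j \<in> closure unit_disc) \<and> (\<forall>j. \<beta> j \<in> {0, 1}) \<and>
      (\<lambda>j. cmod (c j) powr p * (1 + (cmod (\<alpha> j))\<^sup>2)) sums (1 + (cmod \<gamma>)\<^sup>2) \<and>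
      (\<lambda>j. complex_of_real (cmod (c j) powr p) * \<alpha> j) sums \<gamma>" for \<gamma> \<alpha> c \<beta>
    using assms by (simp add: extremal_data_def)
  note iff = complex_geodesic_iff[OF assms ball, unfolded data extremal_disc_def conj_assoc]
  show "?geodesic \<phi> \<longleftrightarrow> ?form \<phi>" by (rule iff)
qed

end
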